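(* Let $n\ge 2$ and let $G$ be a weighted graph on the vertex set $\{1,\dotsc,n\}$ with non-negative edge weights $a_{i,j}$ ($1\le i<j\le n$). Let $0=\lambda_0\le\lambda_1\le\dotsb\le\lambda_{n-1}$ be the eigenvalues of the continuous-time Laplacian of the random walk on $G$, and for $t\ge0$ and $1\le k\le n$ let $s_k(t)$ be the number of cycles of length $k$ in the interchange process on $G$ at time $t$. Then for every $1\le k\le n$ and every $t\ge 0$, $$\left|\mathbb{E}(s_k(t))-\frac1k\right|\le\frac{3^n}{k}e^{-t\lambda_1}.$$
   Context: Weighted graph: a collection of non-negative numbers $a_{i,j}$, $1\le i<j\le n$ (with $a_{i,j}=0$ meaning there is no edge $\{i,j\}$); put $a_{j,i}=a_{i,j}$. Interchange process on $G$: the continuous-time Markov chain on the symmetric group $S_n$ that starts at the identity permutation at time $0$ and, for each $i<j$, jumps from $g$ to $(ij)g$ with rate $a_{i,j}$. Equivalently, its distribution at time $t$ is the element $e^{-t\Delta}=\sum_{k\ge0}(-t\Delta)^k/k!$ of the group ring $\mathbb{R}[S_n]$ (viewed as a function on $S_n$), where $\Delta=\sum_{i<j}a_{i,j}(\mathbf 1-(ij))$. $s_k(t)$ is the number of cycles of length $k$ (with fixed points counted as cycles of length 1) of the permutation given by the process at time $t$. Continuous-time Laplacian of the random walk on $G$: the $n\times n$ symmetric matrix $L$ with $L_{ij}=-a_{i,j}$ for $i\neq j$ and $L_{ii}=\sum_{j\ne i}a_{i,j}$. Eigenvalues are listed with multiplicity. *)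

theory Defs
  imports
    "HOL-Probability.Probability_Mass_Function"
    "HOL-Combinatorics.Permutations"
    "HOL-Combinatorics.Orbits"
    "Jordan_Normal_Form.Char_Poly"
begin

section \<open>The Laplacian of a weighted graph\<close>

text \<open>
  A weighted graph on \<open>{1..n}\<close> is given by \<open>a :: nat \<Rightarrow> nat \<Rightarrow> real\<close>, of which only the values
  \<open>a i j\<close> with \<open>1 \<le> i < j \<le> n\<close> are ever used.
\<close>

definition vertex_pairs :: "nat \<Rightarrow> (nat \<times> nat) set" where
  "vertex_pairs n = {(i, j). 1 \<le> i \<and> i < j \<and> j \<le> n}"

definition edge_weight :: "(nat \<Rightarrow> nat \<Rightarrow> real) \<Rightarrow> nat \<Rightarrow> nat \<Rightarrow> real" where
  "edge_weight a i j = (if i < j then a i j else a j i)"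

text \<open>Matrix indices start at 0, so the entry at \<open>(i, j)\<close> belongs to the vertices \<open>i + 1\<close>, \<open>j + 1\<close>.\<close>

definition laplacian :: "nat \<Rightarrow> (nat \<Rightarrow> nat \<Rightarrow> real) \<Rightarrow> real mat" where
  "laplacian n a = Matrix.mat n n (\<lambda>(i, j).
     if i = j then \<Sum>k\<in>{1..n} - {i + 1}. edge_weight a (i + 1) k
     else - edge_weight a (i + 1) (j + 1))"


section \<open>The real group ring of the symmetric group\<close>

text \<open>
  Elements are functions on \<open>{p. p permutes {1..n}}\<close>, represented as functions on all of
  \<open>nat \<Rightarrow> nat\<close> that vanish elsewhere. The group operation is composition.
\<close>

definition gr_basis :: "(nat \<Rightarrow> nat) \<Rightarrow> (nat \<Rightarrow> nat) \<Rightarrow> real" where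
  "gr_basis p = (\<lambda>g. if g = p then 1 else 0)"

definition gr_mult ::
  "nat \<Rightarrow> ((nat \<Rightarrow> nat) \<Rightarrow> real) \<Rightarrow> ((nat \<Rightarrow> nat) \<Rightarrow> real) \<Rightarrow> (nat \<Rightarrow> nat) \<Rightarrow> real" where
  "gr_mult n x y = (\<lambda>g. \<Sum>p | p permutes {1..n}. x p * y (Hilbert_Choice.inv p \<circ> g))"

primrec gr_power :: "nat \<Rightarrow> ((nat \<Rightarrow> nat) \<Rightarrow> real) \<Rightarrow> nat \<Rightarrow> (nat \<Rightarrow> nat) \<Rightarrow> real" where
  "gr_power n x 0 = gr_basis id"
| "gr_power n x (Suc m) = gr_mult n x (gr_power n x m)"

definition gr_exp :: "nat \<Rightarrow> ((nat \<Rightarrow> nat) \<Rightarrow> real) \<Rightarrow> (nat \<Rightarrow> nat) \<Rightarrow> real" where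
  "gr_exp n x = (\<lambda>g. \<Sum>m. gr_power n x m g / fact m)"


section \<open>The interchange process\<close>

definition interchange_Delta :: "nat \<Rightarrow> (nat \<Rightarrow> nat \<Rightarrow> real) \<Rightarrow> (nat \<Rightarrow> nat) \<Rightarrow> real" where
  "interchange_Delta n a = (\<lambda>g. \<Sum>(i, j)\<in>vertex_pairs n.
     a i j * (gr_basis id g - gr_basis (Transposition.transpose i j) g))"

text \<open>
  The distribution of the process at time \<open>t\<close>, which is \<open>exp (- t \<Delta>)\<close> viewed as a function on
  permutations. That this is a probability distribution for \<open>a \<ge> 0\<close> and \<open>t \<ge> 0\<close>, so that
  \<open>embed_pmf\<close> is meaningful, is \<open>pmf_interchange\<close> below; \<open>interchange_initial\<close> and
  \<open>interchange_forward_equation\<close> show that it is the law of the Markov chain that starts at the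
  identity and jumps from \<open>g\<close> to \<open>(i j) g\<close> with rate \<open>a i j\<close>.
\<close>

definition interchange_pmf :: "nat \<Rightarrow> (nat \<Rightarrow> nat \<Rightarrow> real) \<Rightarrow> real \<Rightarrow> (nat \<Rightarrow> nat) pmf" where
  "interchange_pmf n a t = embed_pmf (gr_exp n (\<lambda>g. - t * interchange_Delta n a g))"

text \<open>
  The cycles of a permutation of \<open>{1..n}\<close> are its orbits, and fixed points are orbits of size 1.
\<close>

definition num_cycles :: "nat \<Rightarrow> nat \<Rightarrow> (nat \<Rightarrow> nat) \<Rightarrow> nat" where
  "num_cycles n k p = card {C \<in> Orbits.orbit p ` {1..n}. card C = k}"

definition expected_cycles :: "nat \<Rightarrow> (nat \<Rightarrow> nat \<Rightarrow> real) \<Rightarrow> nat \<Rightarrow> real \<Rightarrow> real" where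
  "expected_cycles n a k t =
     measure_pmf.expectation (interchange_pmf n a t) (\<lambda>p. real (num_cycles n k p))"


section \<open>The exponential is the law of the Markov chain\<close>

lemma finite_vertex_pairs [simp]: "finite (vertex_pairs n)"
  by (rule finite_subset[of _ "{1..n} \<times> {1..n}"]) (auto simp: vertex_pairs_def)

lemma transpose_permutes_pair:
  "(i, j) \<in> vertex_pairs n \<Longrightarrow> Transposition.transpose i j permutes {1..n}"
  by (rule permutes_swap_id) (auto simp: vertex_pairs_def)

lemma gr_mult_interchange_Delta:
  "gr_mult n (\<lambda>g. - t * interchange_Delta n a g) h g =
   (\<Sum>(i, j)\<in>vertex_pairs n. t * a i j * (h (Transposition.transpose i j \<circ> g) - h g))"
proof -
  let ?S = "{p. p permutes {1..n}}"
  have fin: "finite ?S" by (simp add: finite_permutations)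
  have "gr_mult n (\<lambda>g. - t * interchange_Delta n a g) h g =
    (\<Sum>p\<in>?S. \<Sum>e\<in>vertex_pairs n. t * a (fst e) (snd e) *
       ((if p = Transposition.transpose (fst e) (snd e) then h (Hilbert_Choice.inv p \<circ> g) else 0)
        - (if p = id then h (Hilbert_Choice.inv p \<circ> g) else 0)))"
    unfolding gr_mult_def interchange_Delta_def
    by (intro sum.cong refl)
      (auto simp: sum_distrib_left sum_distrib_right gr_basis_def case_prod_beta algebra_simps
            intro!: sum.cong)
  also have "\<dots> = (\<Sum>e\<in>vertex_pairs n. \<Sum>p\<in>?S. t * a (fst e) (snd e) *
       ((if p = Transposition.transpose (fst e) (snd e) then h (Hilbert_Choice.inv p \<circ> g) else 0)
        - (if p = id then h (Hilbert_Choice.inv p \<circ> g) else 0)))"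
    by (rule sum.swap)
  also have "\<dots> = (\<Sum>e\<in>vertex_pairs n. t * a (fst e) (snd e) *
       (h (Transposition.transpose (fst e) (snd e) \<circ> g) - h g))"
  proof (intro sum.cong refl)
    fix e assume e: "e \<in> vertex_pairs n"
    have "Transposition.transpose (fst e) (snd e) \<in> ?S"
      using transpose_permutes_pair[of "fst e" "snd e"] e by simp
    moreover have "id \<in> ?S" by (simp add: permutes_id)
    ultimately show "(\<Sum>p\<in>?S. t * a (fst e) (snd e) *
       ((if p = Transposition.transpose (fst e) (snd e) then h (Hilbert_Choice.inv p \<circ> g) else 0)
        - (if p = id then h (Hilbert_Choice.inv p \<circ> g) else 0))) =
      t * a (fst e) (snd e) * (h (Transposition.transpose (fst e) (snd e) \<circ> g) - h g)"
      unfolding sum_distrib_left[symmetric] sum_subtractf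
      using fin by (simp add: sum.delta inv_id)
  qed
  finally show ?thesis by (simp add: case_prod_beta)
qed

lemma gr_power_interchange_scale:
  "gr_power n (\<lambda>g. - t * interchange_Delta n a g) m g =
   t ^ m * gr_power n (\<lambda>g. - 1 * interchange_Delta n a g) m g"
proof (induction m arbitrary: g)
  case 0
  show ?case by simp
next
  case (Suc m)
  show ?case
    unfolding gr_power.simps gr_mult_interchange_Delta Suc.IH[abs_def]
    by (auto simp: sum_distrib_left algebra_simps case_prod_beta intro!: sum.cong)
qed

lemma abs_gr_power_interchange_le:
  "\<bar>gr_power n (\<lambda>g. - t * interchange_Delta n a g) m g\<bar> \<le>
   (\<Sum>(i, j)\<in>vertex_pairs n. \<bar>t * a i j\<bar> * 2) ^ m"
proof (induction m arbitrary: g)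
  case 0
  show ?case by (simp add: gr_basis_def)
next
  case (Suc m)
  let ?V = "gr_power n (\<lambda>g. - t * interchange_Delta n a g) m"
  let ?K = "\<Sum>(i, j)\<in>vertex_pairs n. \<bar>t * a i j\<bar> * 2"
  have "\<bar>gr_power n (\<lambda>g. - t * interchange_Delta n a g) (Suc m) g\<bar> \<le>
     (\<Sum>(i, j)\<in>vertex_pairs n. \<bar>t * a i j * (?V (Transposition.transpose i j \<circ> g) - ?V g)\<bar>)"
    unfolding gr_power.simps gr_mult_interchange_Delta case_prod_beta by (rule sum_abs)
  also have "\<dots> \<le> (\<Sum>(i, j)\<in>vertex_pairs n. \<bar>t * a i j\<bar> * 2 * ?K ^ m)"
  proof (intro sum_mono, clarify)
    fix i j
    have diff: "\<bar>?V (Transposition.transpose i j \<circ> g) - ?V g\<bar> \<le> 2 * ?K ^ m"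
      using Suc.IH[of "Transposition.transpose i j \<circ> g"] Suc.IH[of g] by linarith
    show "\<bar>t * a i j * (?V (Transposition.transpose i j \<circ> g) - ?V g)\<bar>
        \<le> \<bar>t * a i j\<bar> * 2 * ?K ^ m"
      by (subst abs_mult, subst mult.assoc, rule mult_left_mono[OF diff abs_ge_zero])
  qed
  also have "\<dots> = ?K ^ Suc m"
    unfolding case_prod_beta power_Suc sum_distrib_right ..
  finally show ?case .
qed

lemma summable_gr_exp_interchange:
  "summable (\<lambda>m. gr_power n (\<lambda>g. - t * interchange_Delta n a g) m g / fact m)"
proof (rule summable_comparison_test'[where N = 0])
  show "summable (\<lambda>m. (\<Sum>(i, j)\<in>vertex_pairs n. \<bar>t * a i j\<bar> * 2) ^ m / fact m)"
    using summable_exp_generic[of "\<Sum>(i, j)\<in>vertex_pairs n. \<bar>t * a i j\<bar> * 2"]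
    by (simp add: divide_inverse mult.commute)
  show "norm (gr_power n (\<lambda>g. - t * interchange_Delta n a g) m g / fact m) \<le>
    (\<Sum>(i, j)\<in>vertex_pairs n. \<bar>t * a i j\<bar> * 2) ^ m / fact m" for m
    using abs_gr_power_interchange_le[of n t a m g] by (simp add: divide_right_mono)
qed

text \<open>
  Up to the factor \<open>exp (- c)\<close> with \<open>c\<close> the total jump rate, \<open>exp (- t \<Delta>)\<close> is the exponential of
  the non-negative element \<open>\<Sum> t a\<^sub>i\<^sub>j (i j)\<close>, whose powers are the \<open>jump_power\<close>s.
\<close>

primrec jump_power ::
  "nat \<Rightarrow> (nat \<Rightarrow> nat \<Rightarrow> real) \<Rightarrow> real \<Rightarrow> nat \<Rightarrow> (nat \<Rightarrow> nat) \<Rightarrow> real" where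
  "jump_power n a t 0 = gr_basis id"
| "jump_power n a t (Suc m) = (\<lambda>g. \<Sum>(i, j)\<in>vertex_pairs n.
     t * a i j * jump_power n a t m (Transposition.transpose i j \<circ> g))"

lemma gr_power_eq_jump_power:
  fixes n a t
  defines "c \<equiv> \<Sum>(i, j)\<in>vertex_pairs n. t * a i j"
  shows "gr_power n (\<lambda>g. - t * interchange_Delta n a g) m g =
    (\<Sum>k\<le>m. real (m choose k) * (- c) ^ (m - k) * jump_power n a t k g)"
proof (induction m arbitrary: g)
  case 0
  show ?case by simp
next
  case (Suc m)
  let ?V = "gr_power n (\<lambda>g. - t * interchange_Delta n a g)"
  let ?U = "jump_power n a t"
  have "?V (Suc m) g = (\<Sum>(i, j)\<in>vertex_pairs n. t * a i j * ?V m (Transposition.transpose i j \<circ> g))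
      + (- c) * ?V m g"
    unfolding gr_power.simps gr_mult_interchange_Delta c_def
    by (simp add: right_diff_distrib sum_subtractf sum_distrib_right case_prod_beta)
  also have "(\<Sum>(i, j)\<in>vertex_pairs n. t * a i j * ?V m (Transposition.transpose i j \<circ> g)) =
      (\<Sum>e\<in>vertex_pairs n. \<Sum>k\<le>m. real (m choose k) * (- c) ^ (m - k) *
        (t * a (fst e) (snd e) * ?U k (Transposition.transpose (fst e) (snd e) \<circ> g)))"
    unfolding Suc.IH case_prod_beta sum_distrib_left
    by (intro sum.cong refl) (simp add: mult_ac)
  also have "\<dots> = (\<Sum>k\<le>m. real (m choose k) * (- c) ^ (m - k) * ?U (Suc k) g)"
    by (subst sum.swap) (simp add: sum_distrib_left case_prod_beta)
  also have "(- c) * ?V m g = (\<Sum>k\<le>m. real (m choose k) * (- c) ^ (Suc m - k) * ?U k g)"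
    unfolding Suc.IH sum_distrib_left
    by (intro sum.cong refl) (simp add: Suc_diff_le mult_ac)
  also have "\<dots> = (\<Sum>k\<le>Suc m. real (m choose k) * (- c) ^ (Suc m - k) * ?U k g)"
    by simp
  also have "\<dots> = (- c) ^ Suc m * ?U 0 g +
      (\<Sum>k\<le>m. real (m choose Suc k) * (- c) ^ (m - k) * ?U (Suc k) g)"
    by (subst sum.atMost_Suc_shift) simp
  finally have "?V (Suc m) g = (- c) ^ Suc m * ?U 0 g +
      (\<Sum>k\<le>m. real (Suc m choose Suc k) * (- c) ^ (m - k) * ?U (Suc k) g)"
    by (simp del: jump_power.simps add: sum.distrib[symmetric] distrib_right add_ac)
  then show ?case
    by (subst sum.atMost_Suc_shift) (simp del: jump_power.simps)
qed

lemma jump_power_nonneg: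
  assumes "\<And>i j. (i, j) \<in> vertex_pairs n \<Longrightarrow> 0 \<le> a i j" and "0 \<le> t"
  shows "0 \<le> jump_power n a t m g"
  by (induction m arbitrary: g) (auto simp: gr_basis_def assms intro!: sum_nonneg)

lemma jump_power_outside:
  "\<not> g permutes {1..n} \<Longrightarrow> jump_power n a t m g = 0"
proof (induction m arbitrary: g)
  case 0
  have "id permutes {1..n}" by (rule permutes_id)
  with 0 have "g \<noteq> id" by blast
  then show ?case by (simp add: gr_basis_def)
next
  case (Suc m)
  have "\<not> Transposition.transpose i j \<circ> g permutes {1..n}" if "(i, j) \<in> vertex_pairs n" for i j
  proof
    assume "Transposition.transpose i j \<circ> g permutes {1..n}"
    from permutes_compose[OF this transpose_permutes_pair[OF that]]
    have "g permutes {1..n}" by (simp add: o_assoc)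
    with Suc.prems show False ..
  qed
  then show ?case using Suc.IH by (auto intro!: sum.neutral)
qed

lemma sum_jump_power:
  "(\<Sum>g | g permutes {1..n}. jump_power n a t m g) =
   (\<Sum>(i, j)\<in>vertex_pairs n. t * a i j) ^ m"
proof (induction m)
  case 0
  show ?case
    by (simp add: gr_basis_def finite_permutations permutes_id)
next
  case (Suc m)
  let ?S = "{p. p permutes {1..n}}"
  have shift: "(\<Sum>g\<in>?S. jump_power n a t m (Transposition.transpose i j \<circ> g)) =
      (\<Sum>g\<in>?S. jump_power n a t m g)" if "(i, j) \<in> vertex_pairs n" for i j
    by (rule sum.reindex_bij_witness[of _ "\<lambda>g. Transposition.transpose i j \<circ> g"
          "\<lambda>g. Transposition.transpose i j \<circ> g"])
      (use permutes_compose[OF _ transpose_permutes_pair[OF that]] in \<open>auto simp: o_assoc\<close>)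
  have "(\<Sum>g\<in>?S. jump_power n a t (Suc m) g) =
      (\<Sum>e\<in>vertex_pairs n. \<Sum>g\<in>?S. t * a (fst e) (snd e) *
        jump_power n a t m (Transposition.transpose (fst e) (snd e) \<circ> g))"
    by (simp add: case_prod_beta) (rule sum.swap)
  also have "\<dots> = (\<Sum>e\<in>vertex_pairs n. t * a (fst e) (snd e) * (\<Sum>g\<in>?S. jump_power n a t m g))"
    by (intro sum.cong refl) (metis sum_distrib_left shift prod.collapse)
  finally show ?case
    unfolding Suc.IH by (simp add: sum_distrib_right case_prod_beta)
qed

lemma gr_exp_eq_jump_power:
  assumes "\<And>i j. (i, j) \<in> vertex_pairs n \<Longrightarrow> 0 \<le> a i j" and "0 \<le> t"
  defines "c \<equiv> \<Sum>(i, j)\<in>vertex_pairs n. t * a i j"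
  shows "summable (\<lambda>k. jump_power n a t k g / fact k)"
    and "gr_exp n (\<lambda>g. - t * interchange_Delta n a g) g =
      (\<Sum>k. jump_power n a t k g / fact k) * exp (- c)"
proof -
  let ?S = "{p. p permutes {1..n}}"
  have nonneg: "0 \<le> jump_power n a t m g" for m g
    using assms(1,2) by (rule jump_power_nonneg)
  have "0 \<le> c"
    unfolding c_def using assms(1,2) by (auto intro!: sum_nonneg)
  have le: "jump_power n a t k g \<le> c ^ k" for k
  proof (cases "g permutes {1..n}")
    case True
    then have "jump_power n a t k g \<le> (\<Sum>g\<in>?S. jump_power n a t k g)"
      by (intro member_le_sum) (auto simp: nonneg finite_permutations)
    then show ?thesis unfolding sum_jump_power c_def .
  qed (simp add: jump_power_outside \<open>0 \<le> c\<close>)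
  have norm: "summable (\<lambda>k. norm (jump_power n a t k g / fact k))"
  proof (rule summable_comparison_test'[where N = 0])
    show "summable (\<lambda>k. c ^ k / fact k)"
      using summable_exp_generic[of c] by (simp add: divide_inverse mult.commute)
    show "norm (norm (jump_power n a t k g / fact k)) \<le> c ^ k / fact k" for k
      using le[of k] nonneg[of k g] by (simp add: divide_right_mono)
  qed
  then show "summable (\<lambda>k. jump_power n a t k g / fact k)"
    by (rule summable_norm_cancel)
  have norm': "summable (\<lambda>k. norm ((- c) ^ k / fact k))"
    using summable_norm_exp[of "- c"] by (simp add: divide_inverse mult.commute)
  have "gr_power n (\<lambda>g. - t * interchange_Delta n a g) m g / fact m =
      (\<Sum>k\<le>m. jump_power n a t k g / fact k * ((- c) ^ (m - k) / fact (m - k)))" for m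
    unfolding gr_power_eq_jump_power c_def sum_divide_distrib
    by (intro sum.cong refl) (simp add: binomial_fact field_simps)
  then have "gr_exp n (\<lambda>g. - t * interchange_Delta n a g) g =
      (\<Sum>k. jump_power n a t k g / fact k) * (\<Sum>k. (- c) ^ k / fact k)"
    unfolding gr_exp_def using Cauchy_product[OF norm norm'] by simp
  also have "(\<Sum>k. (- c) ^ k / fact k) = exp (- c)"
    by (simp add: exp_def divide_inverse mult.commute)
  finally show "gr_exp n (\<lambda>g. - t * interchange_Delta n a g) g =
      (\<Sum>k. jump_power n a t k g / fact k) * exp (- c)" .
qed

lemma gr_exp_interchange_outside:
  assumes "\<not> g permutes {1..n}"
  shows "gr_exp n (\<lambda>g. - t * interchange_Delta n a g) g = 0"
  unfolding gr_exp_def gr_power_eq_jump_power by (simp add: jump_power_outside[OF assms])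

lemma pmf_interchange:
  assumes a: "\<And>i j. (i, j) \<in> vertex_pairs n \<Longrightarrow> 0 \<le> a i j" and t: "0 \<le> t"
  shows "pmf (interchange_pmf n a t) g = gr_exp n (\<lambda>g. - t * interchange_Delta n a g) g"
proof -
  let ?S = "{p. p permutes {1..n}}"
  let ?E = "gr_exp n (\<lambda>g. - t * interchange_Delta n a g)"
  let ?c = "\<Sum>(i, j)\<in>vertex_pairs n. t * a i j"
  have fin: "finite ?S" by (simp add: finite_permutations)
  have summ: "summable (\<lambda>k. jump_power n a t k g / fact k)" for g
    using a t by (rule gr_exp_eq_jump_power(1))
  have eq: "?E g = (\<Sum>k. jump_power n a t k g / fact k) * exp (- ?c)" for g
    using a t by (rule gr_exp_eq_jump_power(2))
  have jump_nonneg: "0 \<le> jump_power n a t m g" for m g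
    using a t by (rule jump_power_nonneg)
  have nonneg: "0 \<le> ?E g" for g
    unfolding eq by (intro mult_nonneg_nonneg suminf_nonneg summ)
      (auto simp: jump_nonneg)
  have "(\<Sum>g\<in>?S. ?E g) = (\<Sum>g\<in>?S. \<Sum>k. jump_power n a t k g / fact k) * exp (- ?c)"
    unfolding eq sum_distrib_right ..
  also have "(\<Sum>g\<in>?S. \<Sum>k. jump_power n a t k g / fact k) =
      (\<Sum>k. \<Sum>g\<in>?S. jump_power n a t k g / fact k)"
    by (rule suminf_sum[symmetric]) (rule summ)
  also have "\<dots> = (\<Sum>k. ?c ^ k / fact k)"
    unfolding sum_divide_distrib[symmetric] sum_jump_power ..
  also have "\<dots> = exp ?c"
    by (simp add: exp_def divide_inverse mult.commute)
  finally have one: "(\<Sum>g\<in>?S. ?E g) = 1"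
    by (simp add: exp_minus)
  have "(\<integral>\<^sup>+ g. ennreal (?E g) \<partial>count_space UNIV) = (\<Sum>g\<in>?S. ennreal (?E g))"
    by (rule nn_integral_count_space'[OF fin]) (use gr_exp_interchange_outside in \<open>auto simp del: mult_minus_left\<close>)
  also have "\<dots> = 1"
    by (subst sum_ennreal) (simp_all only: nonneg one ennreal_1)
  finally show ?thesis
    unfolding interchange_pmf_def by (rule pmf_embed_pmf[OF nonneg])
qed

lemma interchange_initial: "interchange_pmf n a 0 = return_pmf id"
proof -
  have "gr_exp n (\<lambda>g. - 0 * interchange_Delta n a g) g = gr_basis id g" for g
  proof -
    have "gr_power n (\<lambda>g. - 0 * interchange_Delta n a g) m g / fact m =
        (if m = 0 then gr_basis id g else 0)" for m
      by (cases m) (simp_all only: gr_power.simps gr_mult_interchange_Delta, simp_all)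
    then show ?thesis
      unfolding gr_exp_def using sums_If_finite[of "\<lambda>m. m = 0" "\<lambda>_. gr_basis id g"]
      by (simp add: sums_iff)
  qed
  then have "interchange_pmf n a 0 = embed_pmf (gr_basis id)"
    unfolding interchange_pmf_def by presburger
  also have "gr_basis id = pmf (return_pmf id)"
    by (auto simp: gr_basis_def indicator_def)
  also have "embed_pmf \<dots> = return_pmf id"
    using td_pmf_embed_pmf by (rule type_definition.Rep_inverse)
  finally show ?thesis .
qed

lemma interchange_forward_equation:
  assumes a: "\<And>i j. (i, j) \<in> vertex_pairs n \<Longrightarrow> 0 \<le> a i j" and t: "0 \<le> t"
  shows "((\<lambda>s. pmf (interchange_pmf n a s) g) has_real_derivative
    (\<Sum>(i, j)\<in>vertex_pairs n. a i j *
      (pmf (interchange_pmf n a t) (Transposition.transpose i j \<circ> g)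
       - pmf (interchange_pmf n a t) g))) (at t within {0..})"
proof -
  let ?V = "gr_power n (\<lambda>g. - 1 * interchange_Delta n a g)"
  let ?E = "\<lambda>s. gr_exp n (\<lambda>g. - s * interchange_Delta n a g)"
  have pmf_eq: "pmf (interchange_pmf n a s) g = ?E s g" if "0 \<le> s" for s g
    using a that by (rule pmf_interchange)
  have series: "gr_power n (\<lambda>g. - s * interchange_Delta n a g) m g / fact m =
      ?V m g / fact m * s ^ m" for s m g
    by (subst gr_power_interchange_scale) simp
  have summ: "summable (\<lambda>m. ?V m g / fact m * s ^ m)" for s g
    using summable_gr_exp_interchange[of n s a g]
    by (rule back_subst[of summable]) (rule ext, rule series)
  have E: "?E s g = (\<Sum>m. ?V m g / fact m * s ^ m)" for s g
    unfolding gr_exp_def by (rule arg_cong[of _ _ suminf]) (rule ext, rule series)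
  have "((\<lambda>s. \<Sum>m. ?V m g / fact m * s ^ m) has_real_derivative
      (\<Sum>m. diffs (\<lambda>m. ?V m g / fact m) m * t ^ m)) (at t)"
    by (rule termdiffs_strong_converges_everywhere) (rule summ)
  moreover have "(\<Sum>m. diffs (\<lambda>m. ?V m g / fact m) m * t ^ m) =
      (\<Sum>(i, j)\<in>vertex_pairs n. a i j * (?E t (Transposition.transpose i j \<circ> g) - ?E t g))"
  proof -
    have "diffs (\<lambda>m. ?V m g / fact m) m * t ^ m =
        (\<Sum>e\<in>vertex_pairs n. a (fst e) (snd e) *
          (?V m (Transposition.transpose (fst e) (snd e) \<circ> g) / fact m * t ^ m
            - ?V m g / fact m * t ^ m))" for m
    proof -
      have "diffs (\<lambda>m. ?V m g / fact m) m * t ^ m = ?V (Suc m) g * (t ^ m / fact m)"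
        by (simp add: diffs_def field_simps del: gr_power.simps of_nat_Suc)
      also have "?V (Suc m) g = (\<Sum>e\<in>vertex_pairs n. a (fst e) (snd e) *
          (?V m (Transposition.transpose (fst e) (snd e) \<circ> g) - ?V m g))"
        unfolding gr_power.simps(2) gr_mult_interchange_Delta by (simp add: case_prod_beta)
      finally show ?thesis
        unfolding sum_distrib_right by (simp add: algebra_simps)
    qed
    then have "(\<Sum>m. diffs (\<lambda>m. ?V m g / fact m) m * t ^ m) =
       (\<Sum>m. \<Sum>e\<in>vertex_pairs n. a (fst e) (snd e) *
          (?V m (Transposition.transpose (fst e) (snd e) \<circ> g) / fact m * t ^ m
            - ?V m g / fact m * t ^ m))"
      by simp
    also have "\<dots> = (\<Sum>e\<in>vertex_pairs n. \<Sum>m. a (fst e) (snd e) *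
          (?V m (Transposition.transpose (fst e) (snd e) \<circ> g) / fact m * t ^ m
            - ?V m g / fact m * t ^ m))"
      by (rule suminf_sum) (intro summable_mult summable_diff summ)
    also have "\<dots> = (\<Sum>e\<in>vertex_pairs n. a (fst e) (snd e) *
          (?E t (Transposition.transpose (fst e) (snd e) \<circ> g) - ?E t g))"
      unfolding E
      by (intro sum.cong refl, subst suminf_mult, intro summable_diff summ)
         (subst suminf_diff[symmetric], (rule summ)+, rule refl)
    finally show ?thesis by (simp add: case_prod_beta)
  qed
  ultimately have "((\<lambda>s. ?E s g) has_real_derivative
      (\<Sum>(i, j)\<in>vertex_pairs n. a i j * (?E t (Transposition.transpose i j \<circ> g) - ?E t g))) (at t)"
    unfolding E by simp
  then have "((\<lambda>s. ?E s g) has_real_derivative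
      (\<Sum>(i, j)\<in>vertex_pairs n. a i j * (?E t (Transposition.transpose i j \<circ> g) - ?E t g)))
      (at t within {0..})"
    by (rule has_field_derivative_at_within)
  then have "((\<lambda>s. pmf (interchange_pmf n a s) g) has_real_derivative
      (\<Sum>(i, j)\<in>vertex_pairs n. a i j * (?E t (Transposition.transpose i j \<circ> g) - ?E t g)))
      (at t within {0..})"
    by (rule has_field_derivative_transform_within[where d = 1])
       (use t pmf_eq in auto)
  then show ?thesis
    by (simp only: pmf_eq[OF t])
qed

end

theory Submission
  imports Defs
begin

text \<open>
  On permutations of \<open>V = {1..n}\<close> that preserve a set \<open>A\<close> of size \<open>k\<close>, the alternating sum of the
  traces on the exterior powers of the standard representation of \<open>A\<close> is \<open>k\<close> on \<open>k\<close>-cycles of \<open>A\<close>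
  and \<open>0\<close> otherwise. Written out on the basis vectors, this expresses \<open>k\<^sup>2 s\<^sub>k\<close> as a signed sum, over
  pairs \<open>B \<subset> A\<close>, of positive definite functions of the permutation with value \<open>k - |B|\<close> at the
  identity. Under the process each of them approaches its mean at the exponential rate given by the
  spectral gap of the interchange process, and there are at most \<open>(n choose k) 2\<^sup>k \<le> 3\<^sup>n\<close> terms.

  That this gap equals \<open>\<lambda>\<^sub>1\<close> is Aldous' conjecture, proved by Caputo, Liggett and Richthammer:
  functions without one-coordinate marginals are handled by removing a vertex \<open>x\<close> and adding
  \<open>c\<^sub>x\<^sub>y c\<^sub>x\<^sub>z / \<Sum>c\<^sub>x\<^sub>w\<close> to the weight of \<open>{y, z}\<close>, which does not increase the form of the process by the
  octopus inequality and does not decrease the gap of the random walk. For the octopus inequality,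
  put \<open>a\<^sub>x = - \<Sum>a\<^sub>y\<close>; then, summing the transpositions over \<open>i \<noteq> j\<close>, \<open>(\<Sum>a\<^sub>i\<^sup>2)\<^sup>2 - (\<Sum>a\<^sub>i a\<^sub>j (i j))\<^sup>2\<close> is a
  combination of one projection for each set \<open>{i, j, k, l}\<close>, with coefficients proportional to
  \<open>- a\<^sub>i a\<^sub>j a\<^sub>k a\<^sub>l\<close>, and the projection of \<open>{i, j, k, l}\<close> is
  at most the sum of those of the four sets obtained by replacing one element by \<open>x\<close>.
\<close>

text \<open>Bounding the 2-norm distance of the law from uniform would cost a factor like
  \<open>sqrt (n!)\<close>. A positive definite function costs only its value at the identity: it
  has the form \<open><f, g f>\<close>, and the process contracts the mean-zero part of
  \<open>f\<close>. So \<open>s_k\<close> has to be written through positive definite functions that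
  are small at the identity. The alternating sum of traces is \<open>det (1 - g)\<close> on the
  standard representation of \<open>A\<close>. For a k-cycle it is the product of
  \<open>1 - z\<close> over the k-th roots of unity \<open>z\<close> other than 1, which is
  \<open>k\<close>; with more than one cycle, 1 is an eigenvalue and the determinant vanishes. To
  avoid a choice of basis, the exterior powers are realised by wedging those of the permutation
  representation with the sum \<open>v\<close> of all basis vectors. The vectors
  \<open>v \<and> e_B\<close> with \<open>|B| = j\<close> form a tight frame of this copy with
  constant \<open>k = |v|^2\<close>, so their matrix coefficients add up to \<open>k\<close> times
  the trace; this turns \<open>k\<close> into \<open>k^2\<close>. The code replaces the determinant
  by cancelling sets \<open>B\<close> that differ by a cycle and by comparing \<open>g\<close> with
  \<open>tau a b \<circ> g\<close>.\<close>

section \<open>Computations in small symmetric groups\<close>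

text \<open>
  The list \<open>xs\<close> of positions stands for the permutation sending \<open>vs ! m\<close> to \<open>vs ! (xs ! m)\<close>, so that
  identities in the group ring of a small symmetric group can be checked by computation.
\<close>

definition list_act :: "'a list \<Rightarrow> nat list \<Rightarrow> 'a \<Rightarrow> 'a" where
  "list_act vs xs y = (case map_of (zip vs (map ((!) vs) xs)) y of Some z \<Rightarrow> z | None \<Rightarrow> y)"

definition lcomp :: "nat list \<Rightarrow> nat list \<Rightarrow> nat list" where
  "lcomp xs ys = map ((!) xs) ys"

definition linv :: "nat list \<Rightarrow> nat list" where
  "linv xs = map (\<lambda>m. length (takeWhile (\<lambda>y. y \<noteq> m) xs)) [0..<length xs]"

definition perm_list :: "nat \<Rightarrow> nat list \<Rightarrow> bool" where
  "perm_list n xs \<longleftrightarrow> length xs = n \<and> list_all (\<lambda>m. m < n) xs"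

lemma list_act_nth:
  assumes "distinct vs" "m < length vs" "perm_list (length vs) xs"
  shows "list_act vs xs (vs ! m) = vs ! (xs ! m)"
  using assms by (simp add: list_act_def perm_list_def map_of_zip_nth)

lemma list_act_notin: "y \<notin> set vs \<Longrightarrow> list_act vs xs y = y"
  by (auto simp: list_act_def split: option.split dest!: map_of_SomeD set_zip_leftD)

lemma list_act_eqI:
  assumes "distinct vs" "perm_list (length vs) xs"
    and "\<And>m. m < length vs \<Longrightarrow> h (vs ! m) = vs ! (xs ! m)" "\<And>y. y \<notin> set vs \<Longrightarrow> h y = y"
  shows "list_act vs xs = h"
proof
  fix y
  show "list_act vs xs y = h y"
  proof (cases "y \<in> set vs")
    case True
    then obtain m where "m < length vs" "y = vs ! m" by (metis in_set_conv_nth)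
    then show ?thesis using assms by (simp add: list_act_nth)
  qed (simp add: list_act_notin assms)
qed

lemma list_act_lcomp:
  assumes "distinct vs" "perm_list (length vs) xs" "perm_list (length vs) ys"
  shows "list_act vs (lcomp xs ys) = list_act vs xs \<circ> list_act vs ys"
  using assms
  by (intro list_act_eqI) (auto simp: list_act_nth list_act_notin lcomp_def perm_list_def list_all_length)

lemma list_act_upt: "distinct vs \<Longrightarrow> list_act vs [0..<length vs] = id"
  by (intro list_act_eqI) (auto simp: perm_list_def list_all_length)

text \<open>Invertibility is certified by computing both products with \<open>linv\<close>, so no
  general theorem about \<open>linv\<close> enters.\<close>

definition perm_lists :: "nat \<Rightarrow> (int \<times> nat list) list \<Rightarrow> bool" where
  "perm_lists n L \<longleftrightarrow> list_all (\<lambda>(e, p). perm_list n p \<and> perm_list n (linv p) \<and>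
     lcomp p (linv p) = [0..<n] \<and> lcomp (linv p) p = [0..<n]) L"

lemma list_act_linv:
  assumes "distinct vs" "perm_lists (length vs) L" "(e, p) \<in> set L"
  shows "list_act vs p permutes set vs" "Hilbert_Choice.inv (list_act vs p) = list_act vs (linv p)"
proof -
  have p: "perm_list (length vs) p" "perm_list (length vs) (linv p)"
    "lcomp p (linv p) = [0..<length vs]" "lcomp (linv p) p = [0..<length vs]"
    using assms(2,3) by (auto simp: perm_lists_def list_all_iff)
  have 1: "list_act vs p \<circ> list_act vs (linv p) = id" "list_act vs (linv p) \<circ> list_act vs p = id"
    using assms(1) p by (simp_all add: list_act_lcomp[symmetric] list_act_upt)
  then show "Hilbert_Choice.inv (list_act vs p) = list_act vs (linv p)"
    by (simp add: inv_unique_comp)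
  have "bij (list_act vs p)"
    using 1 by (rule o_bij[rotated])
  then show "list_act vs p permutes set vs"
    by (auto simp: permutes_def list_act_notin bij_iff)
qed

text \<open>The list is a formal integer combination of permutations, repetitions allowed, paired
  with an arbitrary function \<open>F\<close>; an identity in the group ring becomes an identity of
  such pairings.\<close>

fun linear_eval :: "(int \<times> nat list) list \<Rightarrow> (nat list \<Rightarrow> real) \<Rightarrow> real" where
  "linear_eval [] F = 0"
| "linear_eval ((e, p) # L) F = of_int e * F p + linear_eval L F"

fun add_coeff :: "int \<Rightarrow> nat list \<Rightarrow> (int \<times> nat list) list \<Rightarrow> (int \<times> nat list) list" where
  "add_coeff e p [] = [(e, p)]"
| "add_coeff e p ((e', q) # L) = (if p = q then (e + e', q) # L else (e', q) # add_coeff e p L)"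

lemma linear_eval_add_coeff [simp]:
  "linear_eval (add_coeff e p L) F = of_int e * F p + linear_eval L F"
  by (induction e p L rule: add_coeff.induct) (auto simp: algebra_simps)

text \<open>The factor from the second list stands on the left because correlating
  \<open>f (p \<circ> g)\<close> with \<open>f (q \<circ> g)\<close> produces
  \<open>q \<circ> inv p\<close>; with \<open>linv\<close> applied to the first list this is the
  product that occurs in a square.\<close>

fun conv_row :: "int \<Rightarrow> nat list \<Rightarrow> (int \<times> nat list) list \<Rightarrow> (int \<times> nat list) list \<Rightarrow> (int \<times> nat list) list" where
  "conv_row e p [] acc = acc"
| "conv_row e p ((e', q) # L) acc = conv_row e p L (add_coeff (e * e') (lcomp q p) acc)"

fun conv :: "(int \<times> nat list) list \<Rightarrow> (int \<times> nat list) list \<Rightarrow> (int \<times> nat list) list \<Rightarrow> (int \<times> nat list) list" where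
  "conv [] M acc = acc"
| "conv ((e, p) # L) M acc = conv L M (conv_row e p M acc)"

lemma linear_eval_conv_row:
  "linear_eval (conv_row e p L acc) F = of_int e * linear_eval L (\<lambda>q. F (lcomp q p)) + linear_eval acc F"
  by (induction e p L acc rule: conv_row.induct) (auto simp: algebra_simps)

lemma linear_eval_conv:
  "linear_eval (conv L M acc) F = linear_eval L (\<lambda>p. linear_eval M (\<lambda>q. F (lcomp q p))) + linear_eval acc F"
  by (induction L M acc rule: conv.induct) (auto simp: linear_eval_conv_row algebra_simps)

definition all_zero :: "(int \<times> nat list) list \<Rightarrow> bool" where
  "all_zero L = list_all (\<lambda>(e, p). e = 0) L"

lemma linear_eval_all_zero: "all_zero L \<Longrightarrow> linear_eval L F = 0"
  unfolding all_zero_def by (induction L) auto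

text \<open>
  \<open>F4\<close> is twelve times the projection \<open>P\<close> onto the functions invariant under the Klein four-group
  but orthogonal to those invariant under the alternating group of degree 4. In degree 5, the sum of
  the projections of all five point stabilisers is \<open>S = 2 Q\<close> for a central projection \<open>Q \<ge> P\<close>, and
  \<open>E5 = 6 (S - 2 P)\<close> with the \<open>P\<close> of the stabiliser of the last point.
\<close>

definition E5 :: "(int \<times> nat list) list" where
  "E5 = (3, [0,1,2,3,4]) #
    map (Pair (-1)) [[0,1,3,4,2],[0,1,4,2,3],[0,2,4,3,1],[0,3,2,4,1],[0,4,1,3,2],[0,4,2,1,3],
      [1,4,2,3,0],[2,1,4,3,0],[3,1,2,4,0],[4,0,2,3,1],[4,1,0,3,2],[4,1,2,0,3]] @
    map (Pair 1) [[0,2,1,4,3],[0,3,4,1,2],[0,4,3,2,1],[1,0,2,4,3],[1,0,4,3,2],[2,1,0,4,3],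
      [2,4,0,3,1],[3,1,4,0,2],[3,4,2,0,1],[4,1,3,2,0],[4,2,1,3,0],[4,3,2,1,0]] @
    map (Pair (-1)) [[1,0,3,2,4],[2,3,0,1,4],[3,2,1,0,4]]"

definition F4 :: "(int \<times> nat list) list" where
  "F4 = map (Pair 2) [[0,1,2,3],[1,0,3,2],[2,3,0,1],[3,2,1,0]] @
    map (Pair (-1)) [[1,2,0,3],[2,0,1,3],[1,3,2,0],[3,0,2,1],[2,1,3,0],[3,1,0,2],[0,2,3,1],
      [0,3,1,2]]"

text \<open>
  An element \<open>L\<close> with \<open>L\<^sup>* L = c L\<close> for some \<open>c > 0\<close> is a nonnegative multiple of a projection.
\<close>

definition square_is_multiple :: "int \<Rightarrow> nat \<Rightarrow> (int \<times> nat list) list \<Rightarrow> bool" where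
  "square_is_multiple c n L \<longleftrightarrow> perm_lists n L \<and>
     all_zero (conv (map (apsnd linv) L) L (map (apfst ((*) (- c))) L))"

lemma linear_eval_apfst: "linear_eval (map (apfst ((*) c)) L) F = of_int c * linear_eval L F"
  by (induction L) (auto simp: algebra_simps)

lemma linear_eval_apsnd: "linear_eval (map (apsnd h) L) F = linear_eval L (\<lambda>p. F (h p))"
  by (induction L) auto

lemma linear_eval_append: "linear_eval (L @ M) F = linear_eval L F + linear_eval M F"
  by (induction L) auto

lemma linear_eval_mult: "c * linear_eval L F = linear_eval L (\<lambda>p. c * F p)"
  by (induction L) (auto simp: algebra_simps)

lemma linear_eval_sum: "(\<Sum>g\<in>G. linear_eval L (F g)) = linear_eval L (\<lambda>p. \<Sum>g\<in>G. F g p)"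
  by (induction L) (auto simp: sum.distrib sum_distrib_left)

lemma linear_eval_cong:
  "(\<And>e p. (e, p) \<in> set L \<Longrightarrow> F p = F' p) \<Longrightarrow> linear_eval L F = linear_eval L F'"
  by (induction L) (auto, metis)

section \<open>Autocorrelations and their positivity\<close>

definition corr :: "'a set \<Rightarrow> (('a \<Rightarrow> 'a) \<Rightarrow> real) \<Rightarrow> ('a \<Rightarrow> 'a) \<Rightarrow> real" where
  "corr V f p = (\<Sum>g | g permutes V. f g * f (p \<circ> g))"

lemma sum_permutes_compose_left:
  assumes "p permutes V"
  shows "(\<Sum>g | g permutes V. F (p \<circ> g) :: real) = (\<Sum>g | g permutes V. F g)"
  by (rule sum.reindex_bij_witness[of _ "\<lambda>g. Hilbert_Choice.inv p \<circ> g" "\<lambda>g. p \<circ> g"])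
    (use assms permutes_inv_o[OF assms] in \<open>auto simp: o_assoc permutes_compose permutes_inv\<close>)

lemma corr_compose:
  assumes p: "p permutes V" and q: "q permutes V"
  shows "(\<Sum>g | g permutes V. f (p \<circ> g) * f (q \<circ> g)) = corr V f (q \<circ> Hilbert_Choice.inv p)"
  using sum_permutes_compose_left[OF permutes_inv[OF p], of "\<lambda>g. f (p \<circ> g) * f (q \<circ> g)"]
  by (simp add: corr_def o_assoc permutes_inv_o(1)[OF p])

text \<open>The sum over \<open>g\<close> of the squares of
  \<open>linear_eval L (\<lambda>p. f (list_act vs p \<circ> g))\<close> expands into correlations
  at \<open>q \<circ> inv p\<close>, that is, into the product of the adjoint of \<open>L\<close>
  with \<open>L\<close>, which is \<open>c L\<close>.\<close>

lemma linear_eval_corr_nonneg: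
  assumes "square_is_multiple c (length vs) L" "c > 0" "distinct vs" "set vs \<subseteq> V"
  shows "0 \<le> linear_eval L (\<lambda>p. corr V f (list_act vs p))"
proof -
  let ?a = "list_act vs"
  have L: "perm_lists (length vs) L"
    and z: "all_zero (conv (map (apsnd linv) L) L (map (apfst ((*) (- c))) L))"
    using assms(1) by (auto simp: square_is_multiple_def)
  have perm: "perm_list (length vs) p" "perm_list (length vs) (linv p)" if "(e, p) \<in> set L" for e p
    using L that by (auto simp: perm_lists_def list_all_iff)
  have permV: "?a p permutes V" if "(e, p) \<in> set L" for e p
    using list_act_linv(1)[OF assms(3) L that] assms(4) by (rule permutes_subset)
  have "0 \<le> (\<Sum>g | g permutes V. (linear_eval L (\<lambda>p. f (?a p \<circ> g)))\<^sup>2)"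
    by (simp add: sum_nonneg)
  also have "\<dots> = linear_eval L (\<lambda>p. linear_eval L (\<lambda>q.
      \<Sum>g | g permutes V. f (?a p \<circ> g) * f (?a q \<circ> g)))"
    by (simp add: power2_eq_square linear_eval_mult mult.commute[of "linear_eval _ _"]
        linear_eval_sum[symmetric])
  also have "\<dots> = linear_eval L (\<lambda>p. linear_eval L (\<lambda>q. corr V f (?a (lcomp q (linv p)))))"
    by (intro linear_eval_cong)
      (simp add: corr_compose[OF permV permV] list_act_linv(2)[OF assms(3) L] list_act_lcomp[OF assms(3)] perm)
  also have "\<dots> = of_int c * linear_eval L (\<lambda>p. corr V f (?a p))"
    using linear_eval_all_zero[OF z, of "\<lambda>p. corr V f (?a p)"]
    by (simp add: linear_eval_conv linear_eval_apfst linear_eval_apsnd)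
  finally show ?thesis
    using assms(2) by (simp add: zero_le_mult_iff)
qed

text \<open>Twelve times a projection squares to 12 times itself. For \<open>E5\<close> the same
  constant arises because \<open>6 (S - 2 P) = 12 (Q - P)\<close> with
  \<open>P \<le> Q\<close>.\<close>

lemma square_is_multiple_F4: "square_is_multiple 12 4 F4"
  by code_simp

lemma square_is_multiple_E5: "square_is_multiple 12 5 E5"
  by code_simp

section \<open>Projections attached to four points\<close>

fun collect_coeffs :: "(int \<times> nat list) list \<Rightarrow> (int \<times> nat list) list" where
  "collect_coeffs [] = []"
| "collect_coeffs ((e, p) # L) = add_coeff e p (collect_coeffs L)"

lemma linear_eval_collect_coeffs: "linear_eval (collect_coeffs L) F = linear_eval L F"
  by (induction L rule: collect_coeffs.induct) auto

definition embed_list :: "nat \<Rightarrow> nat list \<Rightarrow> nat list \<Rightarrow> nat list" where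
  "embed_list n c p = map (list_act c p) [0..<n]"

lemma list_act_embed:
  assumes "distinct vs" "distinct c" "perm_list (length c) p" "set c \<subseteq> {..<length vs}"
  shows "list_act vs (embed_list (length vs) c p) = list_act (map ((!) vs) c) p"
proof (rule list_act_eqI)
  have act: "list_act c p m = c ! (p ! k) \<and> p ! k < length c"
    if "m = c ! k" "k < length c" for m k
    using that assms by (auto simp: list_act_nth perm_list_def list_all_length)
  have nth: "\<exists>k<length c. m = c ! k" if "m \<in> set c" for m
    using that by (metis in_set_conv_nth)
  have lt: "list_act c p m < length vs" if "m < length vs" for m
  proof (cases "m \<in> set c")
    case True
    with nth act assms(4) show ?thesis by (metis lessThan_iff nth_mem subsetD)
  qed (use that in \<open>simp add: list_act_notin\<close>)
  then show "perm_list (length vs) (embed_list (length vs) c p)"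
    by (auto simp: perm_list_def embed_list_def list_all_length)
  have inj: "distinct (map ((!) vs) c)"
    using assms by (auto simp: distinct_map inj_on_def nth_eq_iff_index_eq subset_iff)
  have set: "set (map ((!) vs) c) \<subseteq> set vs"
    using assms(4) by auto
  show "list_act (map ((!) vs) c) p (vs ! m) = vs ! (embed_list (length vs) c p ! m)"
    if m: "m < length vs" for m
  proof (cases "m \<in> set c")
    case True
    then obtain k where k: "m = c ! k" "k < length c" using nth by blast
    have "list_act (map ((!) vs) c) p (map ((!) vs) c ! k) = map ((!) vs) c ! (p ! k)"
      by (rule list_act_nth) (use inj k assms in auto)
    then show ?thesis
      using k m act[OF k] by (simp add: embed_list_def)
  next
    case False
    then have "vs ! m \<notin> set (map ((!) vs) c)"
      using assms m by (auto simp: nth_eq_iff_index_eq subset_iff)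
    then show ?thesis using False m by (simp add: list_act_notin embed_list_def)
  qed
  show "list_act (map ((!) vs) c) p y = y" if "y \<notin> set vs" for y
    using that set by (intro list_act_notin) auto
qed (use assms in auto)

text \<open>For four distinct points of \<open>V\<close> this is twelve times the squared norm of
  the projection of \<open>f\<close> that belongs to them.\<close>

definition tetra :: "'a set \<Rightarrow> (('a \<Rightarrow> 'a) \<Rightarrow> real) \<Rightarrow> 'a list \<Rightarrow> real" where
  "tetra V f vs = linear_eval F4 (\<lambda>p. corr V f (list_act vs p))"

lemma tetra_nonneg:
  "distinct vs \<Longrightarrow> length vs = 4 \<Longrightarrow> set vs \<subseteq> V \<Longrightarrow> 0 \<le> tetra V f vs"
  unfolding tetra_def by (rule linear_eval_corr_nonneg[of 12]) (auto simp: square_is_multiple_F4)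

lemma tetra_embed:
  assumes "distinct vs" "distinct c" "set c \<subseteq> {..<length vs}" "length c = 4"
  shows "tetra V f (map ((!) vs) c) =
    linear_eval (map (apsnd (embed_list (length vs) c)) F4) (\<lambda>p. corr V f (list_act vs p))"
proof -
  have "perm_list 4 p" if "(e, p) \<in> set F4" for e p
    using square_is_multiple_F4 that by (auto simp: square_is_multiple_def perm_lists_def list_all_iff)
  then show ?thesis
    unfolding tetra_def linear_eval_apsnd
    by (intro linear_eval_cong) (simp add: list_act_embed assms)
qed

text \<open>The projection \<open>P\<close> of \<open>{i, j, k, l}\<close> is itself one of the five
  summands of \<open>S\<close>, so \<open>2 P \<le> S\<close>, the positivity of \<open>E5\<close>,
  bounds it by the other four. The factor 2 in front of \<open>E5\<close> comes from
  \<open>12 (S - 2 P) = 2 E5\<close>.\<close>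

lemma tetra_faces:
  assumes "distinct [i, j, k, l, x]" "{i, j, k, l, x} \<subseteq> V"
  shows "tetra V f [i, j, k, l] \<le>
    tetra V f [i, j, k, x] + tetra V f [i, j, l, x] + tetra V f [i, k, l, x] + tetra V f [j, k, l, x]"
proof -
  let ?F = "\<lambda>p. corr V f (list_act [i, j, k, l, x] p)"
  let ?emb = "\<lambda>c. map (apsnd (embed_list 5 c)) F4"
  have t: "tetra V f (map ((!) [i, j, k, l, x]) c) = linear_eval (?emb c) ?F"
    if "distinct c" "set c \<subseteq> {..<5}" "length c = 4" for c
    using tetra_embed[of "[i, j, k, l, x]" c V f] assms(1) that by (simp add: eval_nat_numeral)
  have eq: "all_zero (collect_coeffs (?emb [0,1,2,4] @ ?emb [0,1,3,4] @ ?emb [0,2,3,4] @ ?emb [1,2,3,4] @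
      map (apfst ((*) (-1))) (?emb [0,1,2,3]) @ map (apfst ((*) (-2))) E5))"
    by code_simp
  have "0 \<le> linear_eval E5 ?F"
    by (rule linear_eval_corr_nonneg[of 12]) (use assms square_is_multiple_E5 in \<open>auto simp: eval_nat_numeral\<close>)
  then show ?thesis
    using linear_eval_all_zero[OF eq, of ?F, unfolded linear_eval_collect_coeffs linear_eval_append linear_eval_apfst]
      t[of "[0,1,2,4]"] t[of "[0,1,3,4]"] t[of "[0,2,3,4]"] t[of "[1,2,3,4]"] t[of "[0,1,2,3]"]
    by (simp add: eval_nat_numeral)
qed

section \<open>The octopus inequality\<close>

abbreviation tau :: "'a \<Rightarrow> 'a \<Rightarrow> 'a \<Rightarrow> 'a" where
  "tau \<equiv> Transposition.transpose"

section \<open>Weighted sums over distinct points\<close>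

definition sum4 :: "'a set \<Rightarrow> ('a \<Rightarrow> real) \<Rightarrow> ('a \<Rightarrow> 'a \<Rightarrow> 'a \<Rightarrow> 'a \<Rightarrow> real) \<Rightarrow> real" where
  "sum4 V a G = (\<Sum>i\<in>V. \<Sum>j\<in>V. \<Sum>k\<in>V. \<Sum>l\<in>V.
     if distinct [i, j, k, l] then a i * a j * a k * a l * G i j k l else 0)"

lemma sum4_swap12: "sum4 V a (\<lambda>i j k l. G j i k l) = sum4 V a G"
  unfolding sum4_def by (rule trans[OF sum.swap]) (intro sum.cong refl; auto simp: mult_ac)

lemma sum4_swap23: "sum4 V a (\<lambda>i j k l. G i k j l) = sum4 V a G"
  unfolding sum4_def
  by (rule sum.cong[OF refl], rule trans[OF sum.swap]) (intro sum.cong refl; auto simp: mult_ac)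

lemma sum4_swap34: "sum4 V a (\<lambda>i j k l. G i j l k) = sum4 V a G"
  unfolding sum4_def
  by (rule sum.cong[OF refl], rule sum.cong[OF refl], rule trans[OF sum.swap])
    (intro sum.cong refl; auto simp: mult_ac)

lemma sum4_add: "sum4 V a (\<lambda>i j k l. G i j k l + H i j k l) = sum4 V a G + sum4 V a H"
  unfolding sum4_def sum.distrib[symmetric]
  by (intro sum.cong refl) (auto simp: algebra_simps)

lemma sum4_mult: "sum4 V a (\<lambda>i j k l. c * G i j k l) = c * sum4 V a G"
  unfolding sum4_def sum_distrib_left
  by (intro sum.cong refl) (auto simp: algebra_simps)

lemma sum4_cong:
  "(\<And>i j k l. distinct [i, j, k, l] \<Longrightarrow> {i, j, k, l} \<subseteq> V \<Longrightarrow> G i j k l = H i j k l) \<Longrightarrow>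
   sum4 V a G = sum4 V a H"
  unfolding sum4_def by (intro sum.cong refl) auto

lemma sum_if_eq_distinct:
  fixes F :: "'a \<Rightarrow> real"
  assumes "finite V" "j \<in> V"
  shows "(\<Sum>k\<in>V. if k = j \<and> Q then F k else 0) = (if Q then F j else 0)"
  using assms by (cases Q) auto

definition sum3 :: "'a set \<Rightarrow> ('a \<Rightarrow> 'a \<Rightarrow> 'a \<Rightarrow> real) \<Rightarrow> real" where
  "sum3 V F = (\<Sum>i\<in>V. \<Sum>j\<in>V. \<Sum>k\<in>V. if distinct [i, j, k] then F i j k else 0)"

lemma sum3_swap12: "sum3 V (\<lambda>i j k. F j i k) = sum3 V F"
  unfolding sum3_def by (rule trans[OF sum.swap]) (intro sum.cong refl; auto)

lemma sum3_swap23: "sum3 V (\<lambda>i j k. F i k j) = sum3 V F"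
  unfolding sum3_def
  by (rule sum.cong[OF refl], rule trans[OF sum.swap]) (intro sum.cong refl; auto)

lemma sum3_add: "sum3 V (\<lambda>i j k. F i j k + G i j k) = sum3 V F + sum3 V G"
  unfolding sum3_def sum.distrib[symmetric]
  by (intro sum.cong refl) auto

lemma sum3_cong:
  "(\<And>i j k. distinct [i, j, k] \<Longrightarrow> {i, j, k} \<subseteq> V \<Longrightarrow> F i j k = G i j k) \<Longrightarrow> sum3 V F = sum3 V G"
  unfolding sum3_def by (intro sum.cong refl) auto

text \<open>Cyclic invariance lets the square rest on any of the three factors, so three copies give
  \<open>a i * a j * a k * (a i + a j + a k)\<close>. As all weights sum to zero, the bracket is
  minus the sum of the weights of all further points \<open>l\<close>.\<close>

lemma sum3_cyclic:
  fixes C :: "'a \<Rightarrow> 'a \<Rightarrow> 'a \<Rightarrow> real"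
  assumes V: "finite V" and a: "(\<Sum>i\<in>V. a i) = 0"
    and C: "\<And>i j k. distinct [i, j, k] \<Longrightarrow> C i j k = C j k i"
  shows "3 * sum3 V (\<lambda>i j k. a i * a j ^ 2 * a k * C i j k) = - sum4 V a (\<lambda>i j k l. C i j k)"
proof -
  let ?S = "sum3 V (\<lambda>i j k. a i * a j ^ 2 * a k * C i j k)"
  have 1: "?S = sum3 V (\<lambda>i j k. a i * a j * a k ^ 2 * C i j k)"
  proof -
    have "?S = sum3 V (\<lambda>i j k. a j * a k ^ 2 * a i * C j k i)"
      by (subst (2) sum3_swap12[symmetric], subst (2) sum3_swap23[symmetric]) (rule refl)
    also have "\<dots> = sum3 V (\<lambda>i j k. a i * a j * a k ^ 2 * C i j k)"
      by (rule sum3_cong) (simp add: C[symmetric])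
    finally show ?thesis .
  qed
  have 2: "?S = sum3 V (\<lambda>i j k. a i ^ 2 * a j * a k * C i j k)"
  proof -
    have "?S = sum3 V (\<lambda>i j k. a k * a i ^ 2 * a j * C k i j)"
      by (subst (2) sum3_swap23[symmetric], subst (2) sum3_swap12[symmetric]) (rule refl)
    also have "\<dots> = sum3 V (\<lambda>i j k. a i ^ 2 * a j * a k * C i j k)"
      by (rule sum3_cong) (use C[symmetric] in \<open>auto simp: mult_ac\<close>)
    finally show ?thesis .
  qed
  have "3 * ?S = sum3 V (\<lambda>i j k. a i * a j * a k * (a i + a j + a k) * C i j k)"
  proof -
    have "sum3 V (\<lambda>i j k. a i * a j * a k * (a i + a j + a k) * C i j k) =
      sum3 V (\<lambda>i j k. a i ^ 2 * a j * a k * C i j k + a i * a j ^ 2 * a k * C i j k + a i * a j * a k ^ 2 * C i j k)"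
      by (rule sum3_cong) (simp add: algebra_simps power2_eq_square)
    then show ?thesis using 1 2 by (simp add: sum3_add)
  qed
  also have "\<dots> = - sum4 V a (\<lambda>i j k l. C i j k)"
    unfolding sum3_def sum4_def sum_negf[symmetric]
  proof (intro sum.cong refl)
    fix i j k assume ijk: "i \<in> V" "j \<in> V" "k \<in> V"
    show "(if distinct [i, j, k] then a i * a j * a k * (a i + a j + a k) * C i j k else 0) =
      (\<Sum>l\<in>V. - (if distinct [i, j, k, l] then a i * a j * a k * a l * C i j k else 0))"
    proof (cases "distinct [i, j, k]")
      case True
      have "(\<Sum>l\<in>V - {i, j, k}. a l) = - (a i + a j + a k)"
        using True ijk V a sum.subset_diff[of "{i, j, k}" V a] by simp
      then have "a i * a j * a k * (a i + a j + a k) * C i j k =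
          - (a i * a j * a k * (\<Sum>l\<in>V - {i, j, k}. a l) * C i j k)"
        by (simp only: mult_minus_left mult_minus_right minus_minus)
      also have "\<dots> = - (\<Sum>l\<in>V - {i, j, k}. a i * a j * a k * a l * C i j k)"
        by (simp only: sum_distrib_left sum_distrib_right)
      also have "(\<Sum>l\<in>V - {i, j, k}. a i * a j * a k * a l * C i j k) =
          (\<Sum>l\<in>V. if distinct [i, j, k, l] then a i * a j * a k * a l * C i j k else 0)"
        using True V by (intro sum.mono_neutral_cong_left) auto
      finally show ?thesis
        using True by (simp add: sum_negf del: distinct.simps)
    qed auto
  qed
  finally show ?thesis .
qed

text \<open>Two transpositions are disjoint, share one point, or coincide. Sharing happens in four
  ways, each giving a 3-cycle; coinciding gives the identity, where \<open>D\<close>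
  vanishes.\<close>

lemma sum_transpositions_pairs:
  fixes D :: "('a \<Rightarrow> 'a) \<Rightarrow> real"
  assumes V: "finite V" and D: "D id = 0"
  shows "(\<Sum>i\<in>V. \<Sum>j\<in>V. \<Sum>k\<in>V. \<Sum>l\<in>V. (if i \<noteq> j \<and> k \<noteq> l then a i * a j * (a k * a l) * D (tau k l \<circ> tau i j) else 0)) =
    sum4 V a (\<lambda>i j k l. D (tau k l \<circ> tau i j)) +
    4 * sum3 V (\<lambda>i j k. a i * a j ^ 2 * a k * D (tau j k \<circ> tau i j))"
proof -
  let ?f = "\<lambda>i j k. a i * a j ^ 2 * a k * D (tau j k \<circ> tau i j)"
  have id: "tau k l \<circ> tau i j = id" if "(k = i \<and> l = j) \<or> (k = j \<and> l = i)" for i j k l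
    using that by (auto simp: transpose_commute)
  have point: "(if i \<noteq> j \<and> k \<noteq> l then a i * a j * (a k * a l) * D (tau k l \<circ> tau i j) else 0) =
     (if distinct [i, j, k, l] then a i * a j * a k * a l * D (tau k l \<circ> tau i j) else 0) +
     (if k = j \<and> distinct [i, j, l] then ?f i j l else 0) +
     (if l = j \<and> distinct [i, j, k] then ?f i j k else 0) +
     (if k = i \<and> distinct [i, j, l] then ?f j i l else 0) +
     (if l = i \<and> distinct [i, j, k] then ?f j i k else 0)" for i j k l
    using id[of k i l j] D
    by (cases "k = i"; cases "k = j"; cases "l = i"; cases "l = j"; cases "i = j"; cases "k = l")
      (auto simp: transpose_commute power2_eq_square)
  have 1: "(\<Sum>i\<in>V. \<Sum>j\<in>V. \<Sum>k\<in>V. \<Sum>l\<in>V. if k = j \<and> distinct [i, j, l] then ?f i j l else 0) = sum3 V ?f"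
    unfolding sum3_def
    by (rule sum.cong[OF refl], rule sum.cong[OF refl], rule trans[OF sum.swap], rule sum.cong[OF refl]) (simp add: sum_if_eq_distinct[OF V] del: distinct.simps)
  have 2: "(\<Sum>i\<in>V. \<Sum>j\<in>V. \<Sum>k\<in>V. \<Sum>l\<in>V. if l = j \<and> distinct [i, j, k] then ?f i j k else 0) = sum3 V ?f"
    unfolding sum3_def
    by (intro sum.cong[OF refl]) (simp add: sum_if_eq_distinct[OF V] del: distinct.simps)
  have 3: "(\<Sum>i\<in>V. \<Sum>j\<in>V. \<Sum>k\<in>V. \<Sum>l\<in>V. if k = i \<and> distinct [i, j, l] then ?f j i l else 0) = sum3 V (\<lambda>i j k. ?f j i k)"
    unfolding sum3_def
    by (rule sum.cong[OF refl], rule sum.cong[OF refl], rule trans[OF sum.swap], rule sum.cong[OF refl]) (simp add: sum_if_eq_distinct[OF V] del: distinct.simps)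
  have 4: "(\<Sum>i\<in>V. \<Sum>j\<in>V. \<Sum>k\<in>V. \<Sum>l\<in>V. if l = i \<and> distinct [i, j, k] then ?f j i k else 0) = sum3 V (\<lambda>i j k. ?f j i k)"
    unfolding sum3_def
    by (intro sum.cong[OF refl]) (simp add: sum_if_eq_distinct[OF V] del: distinct.simps)
  show ?thesis
    unfolding point sum.distrib 1 2 3 4 sum3_swap12[of V ?f] by (simp add: sum4_def)
qed

lemma transpose_cycle: "distinct [i, j, k] \<Longrightarrow> tau j k \<circ> tau i j = tau k i \<circ> tau j k"
  by (auto simp: fun_eq_iff Transposition.transpose_def)

lemma list_act4:
  assumes "distinct [i, j, k, l]"
  shows "list_act [i, j, k, l] [0, 1, 2, 3] = id"
    "list_act [i, j, k, l] [1, 0, 3, 2] = tau k l \<circ> tau i j"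
    "list_act [i, j, k, l] [2, 3, 0, 1] = tau j l \<circ> tau i k"
    "list_act [i, j, k, l] [3, 2, 1, 0] = tau j k \<circ> tau i l"
    "list_act [i, j, k, l] [1, 2, 0, 3] = tau k j \<circ> tau i k"
    "list_act [i, j, k, l] [2, 0, 1, 3] = tau j k \<circ> tau i j"
    "list_act [i, j, k, l] [1, 3, 2, 0] = tau l j \<circ> tau i l"
    "list_act [i, j, k, l] [3, 0, 2, 1] = tau j l \<circ> tau i j"
    "list_act [i, j, k, l] [2, 1, 3, 0] = tau l k \<circ> tau i l"
    "list_act [i, j, k, l] [3, 1, 0, 2] = tau k l \<circ> tau i k"
    "list_act [i, j, k, l] [0, 2, 3, 1] = tau l k \<circ> tau j l"
    "list_act [i, j, k, l] [0, 3, 1, 2] = tau k l \<circ> tau j k"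
  using assms by (auto simp: fun_eq_iff list_act_def Transposition.transpose_def)

text \<open>The coefficients of \<open>F4\<close> sum to zero, which leaves only differences
  \<open>D\<close>. Symmetry of the weights identifies the three double transpositions (coefficient
  2) with each other, and likewise the eight 3-cycles (coefficient -1).\<close>

lemma sum4_tetra:
  fixes V :: "'a set" and f :: "('a \<Rightarrow> 'a) \<Rightarrow> real"
  defines "D \<equiv> \<lambda>p. corr V f id - corr V f p"
  shows "sum4 V a (\<lambda>i j k l. tetra V f [i, j, k, l]) =
    - 6 * sum4 V a (\<lambda>i j k l. D (tau k l \<circ> tau i j)) + 8 * sum4 V a (\<lambda>i j k l. D (tau j k \<circ> tau i j))"
proof -
  let ?G = "\<lambda>i j k l. D (tau k l \<circ> tau i j)" and ?C = "\<lambda>i j k l. D (tau j k \<circ> tau i j)"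
  have s: "sum4 V a (\<lambda>i j k l. G i k j l) = sum4 V a G"
    "sum4 V a (\<lambda>i j k l. G i l j k) = sum4 V a G"
    "sum4 V a (\<lambda>i j k l. G i j l k) = sum4 V a G"
    "sum4 V a (\<lambda>i j k l. G i l k j) = sum4 V a G"
    "sum4 V a (\<lambda>i j k l. G i k l j) = sum4 V a G"
    "sum4 V a (\<lambda>i j k l. G j l k i) = sum4 V a G"
    "sum4 V a (\<lambda>i j k l. G j k l i) = sum4 V a G" for G :: "'a \<Rightarrow> 'a \<Rightarrow> 'a \<Rightarrow> 'a \<Rightarrow> real"
    using sum4_swap12[of V a] sum4_swap23[of V a] sum4_swap34[of V a] by metis+
  have "sum4 V a (\<lambda>i j k l. tetra V f [i, j, k, l]) =
    sum4 V a (\<lambda>i j k l. (- 2) * ?G i j k l + (- 2) * ?G i k j l + (- 2) * ?G i l j k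
     + ?C i k j l + ?C i j k l + ?C i l j k + ?C i j l k + ?C i l k j + ?C i k l j + ?C j l k i + ?C j k l i)"
    by (rule sum4_cong) (simp add: tetra_def F4_def list_act4[simplified] D_def)
  also have "\<dots> = - 6 * sum4 V a ?G + 8 * sum4 V a ?C"
    unfolding sum4_add sum4_mult s[of ?G] s[of ?C] by simp
  finally show ?thesis .
qed

lemma sum_swap_double:
  fixes F :: "'g \<Rightarrow> 'a \<Rightarrow> 'b \<Rightarrow> real"
  shows "(\<Sum>g\<in>G. \<Sum>i\<in>A. \<Sum>j\<in>B. F g i j) = (\<Sum>i\<in>A. \<Sum>j\<in>B. \<Sum>g\<in>G. F g i j)"
  by (rule trans[OF sum.swap]) (rule sum.cong[OF refl], rule sum.swap)

lemma double_sum_product: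
  fixes F H :: "'a \<Rightarrow> 'b \<Rightarrow> real"
  shows "(\<Sum>i\<in>A. \<Sum>j\<in>B. F i j) * (\<Sum>i\<in>A. \<Sum>j\<in>B. H i j) =
    (\<Sum>i\<in>A. \<Sum>j\<in>B. \<Sum>k\<in>A. \<Sum>l\<in>B. F i j * H k l)"
  by (simp add: sum_distrib_right) (simp add: sum_distrib_left)

text \<open>
  The form is \<open>W |f|\<^sup>2 - \<langle>f, B f\<rangle>\<close> with \<open>W \<le> 0\<close>, so it suffices to show \<open>|B f|\<^sup>2 \<le> W\<^sup>2 |f|\<^sup>2\<close>.
\<close>

lemma sum_transposition_corr_le:
  assumes V: "finite V" and a: "(\<Sum>i\<in>V. a i) = 0"
    and le: "sum4 V a (\<lambda>i j k l. tetra V f [i, j, k, l]) \<le> 0"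
  shows "(\<Sum>i\<in>V. \<Sum>j\<in>V. a i * a j * (corr V f id - corr V f (tau i j))) \<le> 0"
proof -
  let ?K = "corr V f"
  define D where "D = (\<lambda>p. ?K id - ?K p)"
  define w where "w = (\<lambda>i j. if i \<noteq> j then a i * a j else 0)"
  define W where "W = (\<Sum>i\<in>V. \<Sum>j\<in>V. w i j)"
  define B where "B = (\<lambda>g. \<Sum>i\<in>V. \<Sum>j\<in>V. w i j * f (tau i j \<circ> g))"
  let ?S = "{g. g permutes V}"
  have W: "W = - (\<Sum>i\<in>V. (a i)\<^sup>2)"
  proof -
    have "W + (\<Sum>i\<in>V. (a i)\<^sup>2) = (\<Sum>i\<in>V. \<Sum>j\<in>V. w i j + (if j = i then (a i)\<^sup>2 else 0))"
      using V by (simp add: W_def sum.distrib)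
    also have "\<dots> = (\<Sum>i\<in>V. \<Sum>j\<in>V. a i * a j)"
      by (intro sum.cong refl) (auto simp: w_def power2_eq_square)
    also have "\<dots> = 0"
      by (simp add: sum_distrib_left[symmetric] a)
    finally show ?thesis by simp
  qed
  have perm: "tau i j permutes V" if "i \<in> V" "j \<in> V" for i j
    using that by (rule permutes_swap_id)
  have "(\<Sum>g\<in>?S. (B g)\<^sup>2) =
      (\<Sum>g\<in>?S. \<Sum>i\<in>V. \<Sum>j\<in>V. \<Sum>k\<in>V. \<Sum>l\<in>V. w i j * w k l * (f (tau i j \<circ> g) * f (tau k l \<circ> g)))"
    by (simp add: B_def power2_eq_square double_sum_product mult_ac)
  also have "\<dots> = (\<Sum>i\<in>V. \<Sum>j\<in>V. \<Sum>k\<in>V. \<Sum>l\<in>V. w i j * w k l *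
      (\<Sum>g\<in>?S. f (tau i j \<circ> g) * f (tau k l \<circ> g)))"
    unfolding sum_distrib_left
    by (rule trans[OF sum_swap_double], rule sum.cong[OF refl], rule sum.cong[OF refl], rule sum_swap_double)
  also have "\<dots> = (\<Sum>i\<in>V. \<Sum>j\<in>V. \<Sum>k\<in>V. \<Sum>l\<in>V. w i j * w k l * ?K (tau k l \<circ> tau i j))"
    by (intro sum.cong refl) (simp add: corr_compose perm inv_swap_id)
  finally have BB: "(\<Sum>g\<in>?S. (B g)\<^sup>2) = \<dots>" .
  have "W\<^sup>2 * ?K id = (\<Sum>i\<in>V. \<Sum>j\<in>V. \<Sum>k\<in>V. \<Sum>l\<in>V. w i j * w k l * ?K id)"
    unfolding W_def power2_eq_square double_sum_product by (simp only: sum_distrib_right)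
  then have "W\<^sup>2 * ?K id - (\<Sum>g\<in>?S. (B g)\<^sup>2) =
      (\<Sum>i\<in>V. \<Sum>j\<in>V. \<Sum>k\<in>V. \<Sum>l\<in>V. w i j * w k l * D (tau k l \<circ> tau i j))"
    unfolding BB by (simp add: D_def sum_subtractf right_diff_distrib)
  also have "\<dots> = (\<Sum>i\<in>V. \<Sum>j\<in>V. \<Sum>k\<in>V. \<Sum>l\<in>V.
      if i \<noteq> j \<and> k \<noteq> l then a i * a j * (a k * a l) * D (tau k l \<circ> tau i j) else 0)"
    by (intro sum.cong refl) (auto simp: w_def)
  also have "\<dots> = sum4 V a (\<lambda>i j k l. D (tau k l \<circ> tau i j)) +
    4 * sum3 V (\<lambda>i j k. a i * a j ^ 2 * a k * D (tau j k \<circ> tau i j))"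
    by (rule sum_transpositions_pairs[OF V, of D]) (simp add: D_def)
  \<comment> \<open>By \<open>sum3_cyclic\<close> the 3-cycles enter with weight
    \<open>- 4 / 3\<close> relative to the double transpositions, exactly the ratio
    \<open>8 / (- 6)\<close> in \<open>sum4_tetra\<close>.\<close>
  also have "\<dots> = - sum4 V a (\<lambda>i j k l. tetra V f [i, j, k, l]) / 6"
  proof -
    have "3 * sum3 V (\<lambda>i j k. a i * a j ^ 2 * a k * D (tau j k \<circ> tau i j)) =
        - sum4 V a (\<lambda>i j k l. D (tau j k \<circ> tau i j))"
      by (rule sum3_cyclic[OF V a, of "\<lambda>i j k. D (tau j k \<circ> tau i j)"])
        (rule arg_cong[OF transpose_cycle])
    then show ?thesis
      using sum4_tetra[of V a f] by (simp add: D_def)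
  qed
  finally have "(\<Sum>g\<in>?S. (B g)\<^sup>2) \<le> W\<^sup>2 * ?K id" using le by simp
  have Kid: "?K id = (\<Sum>g\<in>?S. (f g)\<^sup>2)" "0 \<le> ?K id"
    by (auto simp: corr_def power2_eq_square sum_nonneg)
  have "(\<Sum>g\<in>?S. f g * B g)\<^sup>2 \<le> (\<Sum>g\<in>?S. (f g)\<^sup>2) * (\<Sum>g\<in>?S. (B g)\<^sup>2)"
    by (rule Cauchy_Schwarz_ineq_sum)
  also have "\<dots> \<le> ?K id * (W\<^sup>2 * ?K id)"
    unfolding Kid(1)[symmetric] by (rule mult_left_mono) fact+
  also have "\<dots> = (W * ?K id)\<^sup>2" by (simp add: power2_eq_square)
  finally have "\<bar>\<Sum>g\<in>?S. f g * B g\<bar> \<le> \<bar>W * ?K id\<bar>"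
    by (simp add: abs_le_square_iff)
  moreover have "W * ?K id \<le> 0"
    unfolding W using Kid(2) by (simp add: sum_nonneg)
  moreover have "(\<Sum>g\<in>?S. f g * B g) = (\<Sum>i\<in>V. \<Sum>j\<in>V. w i j * ?K (tau i j))"
  proof -
    have "(\<Sum>g\<in>?S. f g * B g) = (\<Sum>g\<in>?S. \<Sum>i\<in>V. \<Sum>j\<in>V. w i j * (f g * f (tau i j \<circ> g)))"
      by (simp add: B_def sum_distrib_left mult_ac)
    also have "\<dots> = (\<Sum>i\<in>V. \<Sum>j\<in>V. w i j * ?K (tau i j))"
      unfolding corr_def sum_distrib_left by (rule sum_swap_double)
    finally show ?thesis .
  qed
  ultimately have "W * ?K id - (\<Sum>i\<in>V. \<Sum>j\<in>V. w i j * ?K (tau i j)) \<le> 0" by linarith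
  moreover have "W * ?K id - (\<Sum>i\<in>V. \<Sum>j\<in>V. w i j * ?K (tau i j)) = (\<Sum>i\<in>V. \<Sum>j\<in>V. a i * a j * D (tau i j))"
    unfolding W_def sum_distrib_right sum_subtractf[symmetric]
    by (intro sum.cong refl) (auto simp: w_def D_def algebra_simps)
  ultimately show ?thesis by (simp add: D_def)
qed

text \<open>The Klein four-group and the alternating group are normal in the symmetric group on four
  points, so the projection depends only on the set of points.\<close>

lemma tetra_permute:
  assumes "distinct [i, j, k, l]"
  shows "tetra V f [l, i, j, k] = tetra V f [i, j, k, l]"
    "tetra V f [i, l, j, k] = tetra V f [i, j, k, l]"
    "tetra V f [i, j, l, k] = tetra V f [i, j, k, l]"
proof -
  let ?emb = "\<lambda>c. map (apsnd (embed_list 4 c)) F4"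
  have t: "tetra V f (map ((!) [i, j, k, l]) c) = tetra V f [i, j, k, l]"
    if "all_zero (collect_coeffs (?emb c @ map (apfst ((*) (-1))) F4))"
      "distinct c" "set c \<subseteq> {..<4}" "length c = 4" for c
    using tetra_embed[of "[i, j, k, l]" c V f] assms that(2-)
      linear_eval_all_zero[OF that(1), of "\<lambda>p. corr V f (list_act [i, j, k, l] p)",
        unfolded linear_eval_collect_coeffs linear_eval_append linear_eval_apfst]
    by (simp add: tetra_def eval_nat_numeral)
  have "all_zero (collect_coeffs (?emb [3,0,1,2] @ map (apfst ((*) (-1))) F4))"
    "all_zero (collect_coeffs (?emb [0,3,1,2] @ map (apfst ((*) (-1))) F4))"
    "all_zero (collect_coeffs (?emb [0,1,3,2] @ map (apfst ((*) (-1))) F4))"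
    by code_simp+
  from this[THEN t] show "tetra V f [l, i, j, k] = tetra V f [i, j, k, l]"
    "tetra V f [i, l, j, k] = tetra V f [i, j, k, l]"
    "tetra V f [i, j, l, k] = tetra V f [i, j, k, l]"
    by (simp_all add: eval_nat_numeral)
qed

lemma sum4_insert:
  assumes "finite V" "x \<notin> V"
  shows "sum4 (insert x V) a G = sum4 V a G +
    a x * sum3 V (\<lambda>i j k. a i * a j * a k * (G x i j k + G i x j k + G i j x k + G i j k x))"
proof -
  let ?D = "\<lambda>i j k l. if distinct [i, j, k, l] then a i * a j * a k * a l * G i j k l else 0"
  have "sum4 (insert x V) a G = sum4 V a G +
     ((\<Sum>i\<in>V. \<Sum>j\<in>V. \<Sum>k\<in>V. ?D x i j k) + (\<Sum>i\<in>V. \<Sum>j\<in>V. \<Sum>k\<in>V. ?D i x j k) +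
      (\<Sum>i\<in>V. \<Sum>j\<in>V. \<Sum>k\<in>V. ?D i j x k) + (\<Sum>i\<in>V. \<Sum>j\<in>V. \<Sum>k\<in>V. ?D i j k x))"
    unfolding sum4_def sum.insert[OF assms] sum.distrib by (simp add: add_ac)
  also have "(\<Sum>i\<in>V. \<Sum>j\<in>V. \<Sum>k\<in>V. ?D x i j k) + (\<Sum>i\<in>V. \<Sum>j\<in>V. \<Sum>k\<in>V. ?D i x j k) +
      (\<Sum>i\<in>V. \<Sum>j\<in>V. \<Sum>k\<in>V. ?D i j x k) + (\<Sum>i\<in>V. \<Sum>j\<in>V. \<Sum>k\<in>V. ?D i j k x) =
    a x * sum3 V (\<lambda>i j k. a i * a j * a k * (G x i j k + G i x j k + G i j x k + G i j k x))"
    unfolding sum3_def sum_distrib_left sum.distrib[symmetric]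
  proof (intro sum.cong refl)
    fix i j k assume "i \<in> V" "j \<in> V" "k \<in> V"
    then have "i \<noteq> x" "j \<noteq> x" "k \<noteq> x" using assms(2) by auto
    then show "?D x i j k + ?D i x j k + ?D i j x k + ?D i j k x =
      a x * (if distinct [i, j, k] then a i * a j * a k * (G x i j k + G i x j k + G i j x k + G i j k x) else 0)"
      by (cases "distinct [i, j, k]") (auto simp: distrib_left mult_ac)
  qed
  finally show ?thesis .
qed

text \<open>Quadruples through \<open>x\<close> carry nonpositive weights, all others nonnegative
  ones. The latter are bounded by their faces through \<open>x\<close>; dropping the condition that
  \<open>l\<close> differs from \<open>i, j, k\<close> turns the sum over \<open>l\<close> into
  \<open>- a x\<close>, and the bound is then exactly minus the part through
  \<open>x\<close>.\<close>

lemma sum4_tetra_le_0: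
  assumes V: "finite V" "x \<notin> V" and a: "\<And>y. y \<in> V \<Longrightarrow> 0 \<le> a y" "a x = - (\<Sum>y\<in>V. a y)"
    and sub: "insert x V \<subseteq> U"
  shows "sum4 (insert x V) a (\<lambda>i j k l. tetra U f [i, j, k, l]) \<le> 0"
proof -
  let ?T = "tetra U f"
  have nn: "0 \<le> ?T [i, j, k, x]" if "distinct [i, j, k]" "{i, j, k} \<subseteq> V" for i j k
    using that V sub by (intro tetra_nonneg) auto
  have s: "sum4 V a (\<lambda>i j k l. G i j l k) = sum4 V a G"
    "sum4 V a (\<lambda>i j k l. G i k l j) = sum4 V a G"
    "sum4 V a (\<lambda>i j k l. G j k l i) = sum4 V a G" for G :: "'a \<Rightarrow> 'a \<Rightarrow> 'a \<Rightarrow> 'a \<Rightarrow> real"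
    using sum4_swap12[of V a] sum4_swap23[of V a] sum4_swap34[of V a] by metis+
  have "sum4 V a (\<lambda>i j k l. ?T [i, j, k, l]) \<le>
    sum4 V a (\<lambda>i j k l. ?T [i, j, k, x] + ?T [i, j, l, x] + ?T [i, k, l, x] + ?T [j, k, l, x])"
    unfolding sum4_def
  proof (intro sum_mono)
    fix i j k l assume ijkl: "i \<in> V" "j \<in> V" "k \<in> V" "l \<in> V"
    then have "0 \<le> a i * a j * a k * a l" by (simp add: a(1))
    moreover have "?T [i, j, k, l] \<le> ?T [i, j, k, x] + ?T [i, j, l, x] + ?T [i, k, l, x] + ?T [j, k, l, x]"
      if "distinct [i, j, k, l]"
      using that ijkl V(2) sub by (intro tetra_faces) auto
    ultimately show "(if distinct [i, j, k, l] then a i * a j * a k * a l * ?T [i, j, k, l] else 0) \<le>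
      (if distinct [i, j, k, l] then a i * a j * a k * a l *
        (?T [i, j, k, x] + ?T [i, j, l, x] + ?T [i, k, l, x] + ?T [j, k, l, x]) else 0)"
      by (simp add: mult_left_mono)
  qed
  also have "\<dots> = 4 * sum4 V a (\<lambda>i j k l. ?T [i, j, k, x])"
    unfolding sum4_add using s[of "\<lambda>i j k l. ?T [i, j, k, x]"] by simp
  also have "sum4 V a (\<lambda>i j k l. ?T [i, j, k, x]) \<le> - a x * sum3 V (\<lambda>i j k. a i * a j * a k * ?T [i, j, k, x])"
    unfolding sum4_def sum3_def sum_distrib_left
  proof (intro sum_mono)
    fix i j k assume ijk: "i \<in> V" "j \<in> V" "k \<in> V"
    have "(\<Sum>l\<in>V. if distinct [i, j, k, l] then a i * a j * a k * a l * ?T [i, j, k, x] else 0) \<le>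
       (\<Sum>l\<in>V. a l * (if distinct [i, j, k] then a i * a j * a k * ?T [i, j, k, x] else 0))"
      using ijk nn[of i j k] a(1) by (intro sum_mono) (auto simp: mult_ac)
    then show "(\<Sum>l\<in>V. if distinct [i, j, k, l] then a i * a j * a k * a l * ?T [i, j, k, x] else 0) \<le>
       - a x * (if distinct [i, j, k] then a i * a j * a k * ?T [i, j, k, x] else 0)"
      unfolding a(2) by (simp add: sum_distrib_right)
  qed
  finally have "sum4 V a (\<lambda>i j k l. ?T [i, j, k, l]) \<le> - a x * (4 * sum3 V (\<lambda>i j k. a i * a j * a k * ?T [i, j, k, x]))"
    by simp
  also have "4 * sum3 V (\<lambda>i j k. a i * a j * a k * ?T [i, j, k, x]) =
    sum3 V (\<lambda>i j k. a i * a j * a k * (?T [x, i, j, k] + ?T [i, x, j, k] + ?T [i, j, x, k] + ?T [i, j, k, x]))"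
    unfolding sum3_def sum_distrib_left
  proof (intro sum.cong refl)
    fix i j k assume "i \<in> V" "j \<in> V" "k \<in> V"
    then have "i \<noteq> x" "j \<noteq> x" "k \<noteq> x" using V(2) by auto
    then show "4 * (if distinct [i, j, k] then a i * a j * a k * ?T [i, j, k, x] else 0) =
      (if distinct [i, j, k] then a i * a j * a k *
        (?T [x, i, j, k] + ?T [i, x, j, k] + ?T [i, j, x, k] + ?T [i, j, k, x]) else 0)"
      using tetra_permute[of i j k x U f] by simp
  qed
  finally show ?thesis
    unfolding sum4_insert[OF V] by simp
qed

theorem octopus_inequality:
  fixes f :: "('a \<Rightarrow> 'a) \<Rightarrow> real"
  assumes V: "finite V" "x \<notin> V" and a: "\<And>y. y \<in> V \<Longrightarrow> 0 \<le> a y"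
  defines "D \<equiv> \<lambda>p. corr (insert x V) f id - corr (insert x V) f p"
  shows "(\<Sum>y\<in>V. \<Sum>z\<in>V. a y * a z * D (tau y z)) \<le> 2 * (\<Sum>y\<in>V. a y) * (\<Sum>y\<in>V. a y * D (tau x y))"
proof -
  define b where "b = a(x := - (\<Sum>y\<in>V. a y))"
  have b: "b y = a y" if "y \<in> V" for y using that V(2) by (auto simp: b_def)
  have bx: "b x = - (\<Sum>y\<in>V. b y)" using b sum.cong[of V V b a] by (simp add: b_def)
  have "(\<Sum>i\<in>insert x V. \<Sum>j\<in>insert x V. b i * b j * D (tau i j)) \<le> 0"
    unfolding D_def
  proof (rule sum_transposition_corr_le)
    show "(\<Sum>i\<in>insert x V. b i) = 0" using V bx by simp
    show "sum4 (insert x V) b (\<lambda>i j k l. tetra (insert x V) f [i, j, k, l]) \<le> 0"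
      using V bx a b by (intro sum4_tetra_le_0) auto
  qed (use V in simp)
  moreover have "D (tau x x) = 0" by (simp add: D_def)
  moreover have "(\<Sum>i\<in>V. b i * b x * D (tau i x)) = b x * (\<Sum>y\<in>V. a y * D (tau x y))"
    by (simp add: sum_distrib_left b transpose_commute mult_ac)
  moreover have "(\<Sum>i\<in>V. b x * b i * D (tau x i)) = b x * (\<Sum>y\<in>V. a y * D (tau x y))"
    by (simp add: sum_distrib_left b mult_ac)
  moreover have "(\<Sum>i\<in>V. \<Sum>j\<in>V. b i * b j * D (tau i j)) = (\<Sum>y\<in>V. \<Sum>z\<in>V. a y * a z * D (tau y z))"
    by (intro sum.cong refl) (simp add: b)
  moreover have "b x = - (\<Sum>y\<in>V. a y)" by (simp add: b_def)
  moreover have "(\<Sum>i\<in>insert x V. \<Sum>j\<in>insert x V. b i * b j * D (tau i j)) =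
      b x * b x * D (tau x x) + (\<Sum>i\<in>V. b i * b x * D (tau i x)) +
      ((\<Sum>i\<in>V. b x * b i * D (tau x i)) + (\<Sum>i\<in>V. \<Sum>j\<in>V. b i * b j * D (tau i j)))"
    unfolding sum.insert[OF V] sum.distrib ..
  ultimately show ?thesis by simp
qed

section \<open>The spectral gap of the interchange process\<close>

text \<open>This and \<open>interchange_form\<close> sum over ordered pairs, so for symmetric
  weights they are twice the usual Dirichlet forms, and an eigenvalue \<open>l\<close> enters the
  comparison as \<open>\<kappa> = 2 * l\<close>.\<close>

definition graph_form :: "('a \<Rightarrow> 'a \<Rightarrow> real) \<Rightarrow> 'a set \<Rightarrow> ('a \<Rightarrow> real) \<Rightarrow> real" where
  "graph_form c V u = (\<Sum>x\<in>V. \<Sum>y\<in>V. c x y * (u x - u y)\<^sup>2)"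

definition interchange_form :: "('a \<Rightarrow> 'a \<Rightarrow> real) \<Rightarrow> 'a set \<Rightarrow> (('a \<Rightarrow> 'a) \<Rightarrow> real) \<Rightarrow> real" where
  "interchange_form c V f = (\<Sum>x\<in>V. \<Sum>y\<in>V. c x y * (corr V f id - corr V f (tau x y)))"

definition marginal :: "'a set \<Rightarrow> (('a \<Rightarrow> 'a) \<Rightarrow> real) \<Rightarrow> 'a \<Rightarrow> 'a \<Rightarrow> real" where
  "marginal V f i y = (\<Sum>g | g permutes V. if g i = y then f g else 0)"

section \<open>Removing a vertex\<close>

lemma sum_permutes_compose_right:
  assumes "p permutes V"
  shows "(\<Sum>g | g permutes V. F (g \<circ> p) :: real) = (\<Sum>g | g permutes V. F g)"
  using sum_permutations_compose_right[OF assms, of F] by simp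

text \<open>In \<open>q \<circ> tau i x\<close> the index \<open>i\<close> is the preimage of
  \<open>x\<close>. Multiplying on the left by a permutation of \<open>V\<close> does not change it,
  so correlations split over \<open>i\<close> in \<open>corr_insert\<close>.\<close>

lemma sum_permutes_insert_right:
  fixes F :: "('a \<Rightarrow> 'a) \<Rightarrow> real"
  assumes V: "finite V" "x \<notin> V"
  shows "(\<Sum>g | g permutes insert x V. F g) = (\<Sum>i\<in>insert x V. \<Sum>q | q permutes V. F (q \<circ> tau i x))"
proof -
  have "(\<Sum>g | g permutes insert x V. F g) = (\<Sum>g | g permutes insert x V. F (Hilbert_Choice.inv g))"
    by (rule sum_permutations_inverse)
  also have "\<dots> = (\<Sum>i\<in>insert x V. \<Sum>q | q permutes V. F (Hilbert_Choice.inv (tau x i \<circ> q)))"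
    by (rule sum_over_permutations_insert[OF V])
  also have "\<dots> = (\<Sum>i\<in>insert x V. \<Sum>q | q permutes V. F (Hilbert_Choice.inv q \<circ> tau i x))"
    by (intro sum.cong refl) (simp add: o_inv_distrib permutes_bij inv_swap_id transpose_commute)
  also have "\<dots> = (\<Sum>i\<in>insert x V. \<Sum>q | q permutes V. F (q \<circ> tau i x))"
    by (rule sum.cong[OF refl], rule sum_permutations_inverse[symmetric])
  finally show ?thesis .
qed

lemma corr_insert:
  assumes V: "finite V" "x \<notin> V" and p: "p permutes V"
  shows "corr (insert x V) f p = (\<Sum>i\<in>insert x V. corr V (\<lambda>q. f (q \<circ> tau i x)) p)"
  unfolding corr_def sum_permutes_insert_right[OF V] by (simp add: o_assoc)

lemma marginal_insert:
  assumes V: "finite V" "x \<notin> V" and i: "i \<in> insert x V"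
  shows "marginal (insert x V) f i x = (\<Sum>q | q permutes V. f (q \<circ> tau i x))"
proof -
  have "marginal (insert x V) f i x =
      (\<Sum>j\<in>insert x V. \<Sum>q | q permutes V. if q (tau j x i) = x then f (q \<circ> tau j x) else 0)"
    unfolding marginal_def sum_permutes_insert_right[OF V] by simp
  also have "\<dots> = (\<Sum>j\<in>insert x V. if j = i then (\<Sum>q | q permutes V. f (q \<circ> tau i x)) else 0)"
  proof (rule sum.cong[OF refl])
    fix j assume j: "j \<in> insert x V"
    have "q (tau j x i) = x \<longleftrightarrow> j = i" if "q permutes V" for q
    proof -
      have "q z = x \<longleftrightarrow> z = x" for z
        using that V(2) by (metis permutes_def permutes_not_in)
      then show ?thesis by (auto simp: Transposition.transpose_def)
    qed
    then show "(\<Sum>q | q permutes V. if q (tau j x i) = x then f (q \<circ> tau j x) else 0) =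
        (if j = i then \<Sum>q | q permutes V. f (q \<circ> tau i x) else 0)"
      by (auto intro!: sum.neutral)
  qed
  also have "\<dots> = (\<Sum>q | q permutes V. f (q \<circ> tau i x))"
    using V i by simp
  finally show ?thesis .
qed

context
  fixes V :: "'a set" and x :: 'a and c :: "'a \<Rightarrow> 'a \<Rightarrow> real"
  assumes V: "finite V" "x \<notin> V"
    and sym: "\<And>y z. c y z = c z y" and nonneg: "\<And>y z. 0 \<le> c y z"
begin

definition total_rate :: real where
  "total_rate = (\<Sum>y\<in>V. c x y)"

text \<open>
  If \<open>x\<close> is isolated, the denominator is zero and the weights on \<open>V\<close> are not changed.
\<close>

definition reduced :: "'a \<Rightarrow> 'a \<Rightarrow> real" where
  "reduced y z = c y z + c x y * c x z / total_rate"

lemma total_rate_nonneg: "0 \<le> total_rate"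
  by (simp add: total_rate_def sum_nonneg nonneg)

lemma isolated: "total_rate = 0 \<Longrightarrow> y \<in> V \<Longrightarrow> c x y = 0"
  using V nonneg by (simp add: total_rate_def sum_nonneg_eq_0_iff)

text \<open>This is the octopus inequality for the weights \<open>c x\<close>, divided by their
  total. The loops \<open>reduced y y\<close> contribute zero, since \<open>tau y y\<close> is the
  identity.\<close>

lemma interchange_form_reduced:
  "(\<Sum>y\<in>V. \<Sum>z\<in>V. reduced y z * (corr (insert x V) f id - corr (insert x V) f (tau y z))) \<le>
   interchange_form c (insert x V) f"
proof -
  let ?D = "\<lambda>y z. corr (insert x V) f id - corr (insert x V) f (tau y z)"
  have "(\<Sum>y\<in>V. c y x * ?D y x) = (\<Sum>y\<in>V. c x y * ?D x y)"
    by (simp add: sym[of _ x] transpose_commute)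
  then have "interchange_form c (insert x V) f =
      (\<Sum>y\<in>V. \<Sum>z\<in>V. c y z * ?D y z) + 2 * (\<Sum>y\<in>V. c x y * ?D x y)"
    using V by (simp add: interchange_form_def sum.distrib)
  moreover have "(\<Sum>y\<in>V. \<Sum>z\<in>V. c x y * c x z * ?D y z) / total_rate \<le> 2 * (\<Sum>y\<in>V. c x y * ?D x y)"
  proof (cases "total_rate = 0")
    case True
    then show ?thesis using isolated by simp
  next
    case False
    then show ?thesis
      using octopus_inequality[OF V, of "c x" f] nonneg total_rate_nonneg
      by (simp add: total_rate_def[symmetric] divide_le_eq mult_ac)
  qed
  moreover have "(\<Sum>y\<in>V. \<Sum>z\<in>V. reduced y z * ?D y z) =
     (\<Sum>y\<in>V. \<Sum>z\<in>V. c y z * ?D y z) + (\<Sum>y\<in>V. \<Sum>z\<in>V. c x y * c x z * ?D y z) / total_rate"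
    by (simp add: reduced_def distrib_right sum.distrib sum_divide_distrib)
  ultimately show ?thesis by linarith
qed

text \<open>\<open>reduced\<close> is the Schur complement of the network at \<open>x\<close>:
  extending \<open>u\<close> to \<open>x\<close> by its weighted mean \<open>s\<close> gives the
  edges at \<open>x\<close> exactly the energy of the added edges. Recentring the extension by its
  mean \<open>m\<close> changes no energy, and its squared norm is at least that of \<open>u\<close>
  because \<open>u\<close> has mean zero.\<close>

lemma reduced_gap:
  assumes \<kappa>: "0 \<le> \<kappa>"
    and gap: "\<And>u. (\<Sum>y\<in>insert x V. u y) = 0 \<Longrightarrow> \<kappa> * (\<Sum>y\<in>insert x V. (u y)\<^sup>2) \<le> graph_form c (insert x V) u"
    and u: "(\<Sum>y\<in>V. u y) = 0"
  shows "\<kappa> * (\<Sum>y\<in>V. (u y)\<^sup>2) \<le> graph_form reduced V u"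
proof -
  \<comment> \<open>If \<open>x\<close> is isolated, division by zero makes \<open>s = 0\<close>,
    and both energies at \<open>x\<close> vanish.\<close>
  define s where "s = (\<Sum>y\<in>V. c x y * u y) / total_rate"
  define n where "n = real (card (insert x V))"
  define m where "m = s / n"
  define v where "v = (\<lambda>y. (if y = x then s else u y) - m)"
  have n: "n \<ge> 1" using V by (simp add: n_def)
  have vV: "v y = u y - m" if "y \<in> V" for y using that V by (auto simp: v_def)
  have vx: "v x = s - m" by (simp add: v_def)
  have nV: "real (card V) = n - 1" using V by (simp add: n_def)
  have sum0: "(\<Sum>y\<in>insert x V. v y) = 0"
  proof -
    have "(\<Sum>y\<in>insert x V. v y) = s - m + ((\<Sum>y\<in>V. u y) - (n - 1) * (m))"
      using V by (simp add: vV vx sum_subtractf nV)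
    then show ?thesis using n u by (simp add: m_def field_simps)
  qed
  have "(\<Sum>y\<in>insert x V. (v y)\<^sup>2) = (s - m)\<^sup>2 + ((\<Sum>y\<in>V. (u y)\<^sup>2) + (n - 1) * m\<^sup>2 - 2 * m * (\<Sum>y\<in>V. u y))"
    using V by (simp add: vV vx power2_diff sum_subtractf sum.distrib nV sum_distrib_left[symmetric] sum_distrib_right[symmetric])
  then have "(\<Sum>y\<in>V. (u y)\<^sup>2) \<le> (\<Sum>y\<in>insert x V. (v y)\<^sup>2)"
    using n u by simp
  then have "\<kappa> * (\<Sum>y\<in>V. (u y)\<^sup>2) \<le> graph_form c (insert x V) v"
    using gap[OF sum0] \<kappa> by (meson mult_left_mono order_trans)
  also have "\<dots> = graph_form c V u + 2 * (\<Sum>y\<in>V. c x y * (u y - s)\<^sup>2)"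
  proof -
    have "(\<Sum>y\<in>V. c y x * (v y - v x)\<^sup>2) = (\<Sum>y\<in>V. c x y * (u y - s)\<^sup>2)"
      "(\<Sum>y\<in>V. c x y * (v x - v y)\<^sup>2) = (\<Sum>y\<in>V. c x y * (u y - s)\<^sup>2)"
      by (auto intro!: sum.cong simp: vV vx sym[of _ x] power2_commute[of s])
    then show ?thesis
      using V by (simp add: graph_form_def sum.distrib vV)
  qed
  also have "2 * (\<Sum>y\<in>V. c x y * (u y - s)\<^sup>2) = (\<Sum>y\<in>V. \<Sum>z\<in>V. c x y * c x z * (u y - u z)\<^sup>2) / total_rate"
  proof (cases "total_rate = 0")
    case True
    then show ?thesis using isolated by simp
  next
    case False
    let ?q = "\<Sum>y\<in>V. c x y * (u y)\<^sup>2" and ?l = "\<Sum>y\<in>V. c x y * u y"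
    have "(\<Sum>y\<in>V. \<Sum>z\<in>V. c x y * c x z * (u y - u z)\<^sup>2) =
       (\<Sum>y\<in>V. \<Sum>z\<in>V. c x y * (u y)\<^sup>2 * c x z + c x y * (c x z * (u z)\<^sup>2) - 2 * (c x y * u y * (c x z * u z)))"
      by (intro sum.cong refl) (simp add: power2_diff algebra_simps)
    also have "\<dots> = ?q * total_rate + total_rate * ?q - 2 * (?l * ?l)"
      by (simp add: sum.distrib sum_subtractf sum_distrib_left[symmetric] sum_distrib_right[symmetric] total_rate_def)
    finally have 1: "(\<Sum>y\<in>V. \<Sum>z\<in>V. c x y * c x z * (u y - u z)\<^sup>2) = 2 * (total_rate * ?q) - 2 * (?l * ?l)"
      by simp
    have "(\<Sum>y\<in>V. c x y * (u y - s)\<^sup>2) = (\<Sum>y\<in>V. c x y * (u y)\<^sup>2 + c x y * s\<^sup>2 - 2 * s * (c x y * u y))"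
      by (intro sum.cong refl) (simp add: power2_diff algebra_simps)
    also have "\<dots> = ?q + total_rate * s\<^sup>2 - 2 * s * ?l"
      by (simp add: sum.distrib sum_subtractf sum_distrib_left[symmetric] sum_distrib_right[symmetric] total_rate_def)
    finally have 2: "(\<Sum>y\<in>V. c x y * (u y - s)\<^sup>2) = ?q + total_rate * s\<^sup>2 - 2 * s * ?l" .
    have "?l = total_rate * s" using False by (simp add: s_def)
    then show ?thesis
      unfolding 1 2 using False by (simp add: field_simps power2_eq_square)
  qed
  also have "graph_form c V u + \<dots> = graph_form reduced V u"
    by (simp add: graph_form_def reduced_def distrib_right sum.distrib sum_divide_distrib)
  finally show ?thesis .
qed

text \<open>A vanishing marginal at \<open>x\<close> says that each slice
  \<open>\<lambda>q. f (q \<circ> tau i x)\<close> has mean zero on the permutations of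
  \<open>V\<close>, so the inductive gap applies slice by slice.\<close>

lemma gap_zero_marginals:
  assumes \<kappa>: "0 \<le> \<kappa>"
    and gap: "\<And>u. (\<Sum>y\<in>insert x V. u y) = 0 \<Longrightarrow> \<kappa> * (\<Sum>y\<in>insert x V. (u y)\<^sup>2) \<le> graph_form c (insert x V) u"
    and IH: "\<And>f. (\<And>u. (\<Sum>y\<in>V. u y) = 0 \<Longrightarrow> \<kappa> * (\<Sum>y\<in>V. (u y)\<^sup>2) \<le> graph_form reduced V u) \<Longrightarrow>
      (\<Sum>g | g permutes V. f g) = 0 \<Longrightarrow> \<kappa> * corr V f id \<le> interchange_form reduced V f"
    and f: "\<And>i. i \<in> insert x V \<Longrightarrow> marginal (insert x V) f i x = 0"
  shows "\<kappa> * corr (insert x V) f id \<le> interchange_form c (insert x V) f"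
proof -
  let ?f = "\<lambda>i q. f (q \<circ> tau i x)"
  have "\<kappa> * corr (insert x V) f id = (\<Sum>i\<in>insert x V. \<kappa> * corr V (?f i) id)"
    using V by (simp only: corr_insert[OF V permutes_id] sum_distrib_left)
  also have "\<dots> \<le> (\<Sum>i\<in>insert x V. interchange_form reduced V (?f i))"
    by (intro sum_mono IH reduced_gap[OF \<kappa> gap]) (use f marginal_insert[OF V] in auto)
  also have "\<dots> = (\<Sum>y\<in>V. \<Sum>z\<in>V. \<Sum>i\<in>insert x V. reduced y z * (corr V (?f i) id - corr V (?f i) (tau y z)))"
    unfolding interchange_form_def
    by (subst sum.swap, rule sum.cong[OF refl], subst sum.swap, rule refl)
  also have "\<dots> = (\<Sum>y\<in>V. \<Sum>z\<in>V. reduced y z * (corr (insert x V) f id - corr (insert x V) f (tau y z)))"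
    by (intro sum.cong refl)
      (simp only: corr_insert[OF V permutes_id] corr_insert[OF V permutes_swap_id] sum_subtractf sum_distrib_left right_diff_distrib)
  also have "\<dots> \<le> interchange_form c (insert x V) f"
    by (rule interchange_form_reduced)
  finally show ?thesis .
qed

end

section \<open>Functions of one coordinate\<close>

lemma ex_permutes_pair:
  assumes "i \<in> V" "j \<in> V" "i \<noteq> j" "y \<in> V" "z \<in> V" "y \<noteq> z"
  shows "\<exists>p. p permutes V \<and> p i = y \<and> p j = z"
proof -
  let ?q = "tau i y"
  have q: "?q permutes V" using assms by (intro permutes_swap_id)
  have "?q j \<in> V" using q assms by (simp add: permutes_in_image)
  moreover have "?q j \<noteq> y" using assms by (auto simp: Transposition.transpose_def split: if_splits)
  ultimately have "(tau (?q j) z \<circ> ?q) permutes V \<and> (tau (?q j) z \<circ> ?q) i = y \<and> (tau (?q j) z \<circ> ?q) j = z"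
    using q assms by (auto intro!: permutes_compose permutes_swap_id)
  then show ?thesis by blast
qed

text \<open>Composing with permutations on both sides carries any such pair of constraints to any
  other, so all counts agree. With fewer than two points the claim is vacuous and 0 serves as the
  witness.\<close>

lemma card_permutes_pair:
  "\<exists>N::real. 0 \<le> N \<and> (\<forall>i\<in>V. \<forall>j\<in>V. \<forall>y\<in>V. \<forall>z\<in>V. i \<noteq> j \<longrightarrow> y \<noteq> z \<longrightarrow>
      (\<Sum>g | g permutes V. if g i = y \<and> g j = z then 1 else 0) = N)"
proof -
  define c :: "_ \<Rightarrow> _ \<Rightarrow> _ \<Rightarrow> _ \<Rightarrow> real" where
    "c = (\<lambda>i j y z. \<Sum>g | g permutes V. if g i = y \<and> g j = z then 1 else 0)"
  have eq: "c i j y z = c i' j' y' z'"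
    if *: "i \<in> V" "j \<in> V" "i \<noteq> j" "y \<in> V" "z \<in> V" "y \<noteq> z"
      "i' \<in> V" "j' \<in> V" "i' \<noteq> j'" "y' \<in> V" "z' \<in> V" "y' \<noteq> z'" for i j y z i' j' y' z'
  proof -
    obtain p q where p: "p permutes V" "p i' = i" "p j' = j" and q: "q permutes V" "q y = y'" "q z = z'"
      using ex_permutes_pair[of i' V j' i j] ex_permutes_pair[of y V z y' z'] * by auto
    have inj: "q u = q v \<longleftrightarrow> u = v" for u v using permutes_inj[OF q(1)] by (auto dest: injD)
    have "c i j y z = (\<Sum>g | g permutes V. if (q \<circ> (g \<circ> p)) i' = y' \<and> (q \<circ> (g \<circ> p)) j' = z' then 1 else 0)"
      unfolding c_def by (intro sum.cong refl) (simp add: p q(2,3)[symmetric] inj)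
    also have "\<dots> = (\<Sum>g | g permutes V. if (q \<circ> g) i' = y' \<and> (q \<circ> g) j' = z' then 1 else 0)"
      by (rule sum_permutes_compose_right[OF p(1), of "\<lambda>g. if (q \<circ> g) i' = y' \<and> (q \<circ> g) j' = z' then 1 else 0"])
    also have "\<dots> = c i' j' y' z'"
      unfolding c_def by (rule sum_permutes_compose_left[OF q(1), of "\<lambda>g. if g i' = y' \<and> g j' = z' then 1 else 0"])
    finally show ?thesis .
  qed
  have nonneg: "0 \<le> c i j y z" for i j y z by (simp add: c_def sum_nonneg)
  show ?thesis
  proof (cases "\<exists>i\<in>V. \<exists>j\<in>V. i \<noteq> j")
    case True
    then obtain i j where "i \<in> V" "j \<in> V" "i \<noteq> j" by blast
    then have "c k l y z = c i j i j" if "k \<in> V" "l \<in> V" "k \<noteq> l" "y \<in> V" "z \<in> V" "y \<noteq> z" for k l y z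
      by (intro eq that)
    then show ?thesis using nonneg[of i j i j] unfolding c_def by blast
  next
    case False
    then show ?thesis by (intro exI[of _ 0]) blast
  qed
qed

lemma card_permutes_point:
  assumes V: "finite V" "V \<noteq> {}"
  shows "\<exists>N::real. 0 < N \<and> (\<forall>i\<in>V. \<forall>y\<in>V. (\<Sum>g | g permutes V. if g i = y then 1 else 0) = N)"
proof -
  define c :: "_ \<Rightarrow> _ \<Rightarrow> real" where "c = (\<lambda>i y. \<Sum>g | g permutes V. if g i = y then 1 else 0)"
  have eq: "c i y = c i i" if "i \<in> V" "y \<in> V" for i y
  proof -
    have "c i i = (\<Sum>g | g permutes V. if (tau i y \<circ> g) i = y then 1 else 0)"
      unfolding c_def by (intro sum.cong refl) (auto simp: Transposition.transpose_def)
    also have "\<dots> = c i y"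
      unfolding c_def
      by (rule sum_permutes_compose_left[OF permutes_swap_id[OF that], of "\<lambda>g. if g i = y then 1 else 0"])
    finally show ?thesis ..
  qed
  have eq': "c i y = c j y" if "i \<in> V" "j \<in> V" for i j y
  proof -
    have "c i y = (\<Sum>g | g permutes V. if (g \<circ> tau i j) j = y then 1 else 0)"
      unfolding c_def by (intro sum.cong refl) auto
    also have "\<dots> = c j y"
      unfolding c_def
      by (rule sum_permutes_compose_right[OF permutes_swap_id[OF that], of "\<lambda>g. if g j = y then 1 else 0"])
    finally show ?thesis .
  qed
  obtain i where i: "i \<in> V" using V by blast
  have "(if (id::'a \<Rightarrow> 'a) i = i then 1 else 0 :: real) \<le> c i i"
    unfolding c_def
    by (rule member_le_sum[of id _ "\<lambda>g. if g i = i then 1 else 0"]) (auto simp: finite_permutations V)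
  then have "0 < c i i" by simp
  moreover have "c j y = c i i" if "j \<in> V" "y \<in> V" for j y
    using eq'[OF that(1) i, of y] eq[OF i that(2)] by simp
  ultimately show ?thesis unfolding c_def by blast
qed

text \<open>A sum of one-coordinate functions sees \<open>h\<close> only through its marginals, so
  it is orthogonal to every function without marginals.\<close>

lemma sum_mult_coordinates:
  assumes V: "finite V"
  shows "(\<Sum>g | g permutes V. h g * (\<Sum>i\<in>V. W i (g i))) = (\<Sum>i\<in>V. \<Sum>z\<in>V. W i z * marginal V h i z)"
proof -
  have "(\<Sum>g | g permutes V. h g * (\<Sum>i\<in>V. W i (g i))) =
      (\<Sum>g | g permutes V. \<Sum>i\<in>V. \<Sum>z\<in>V. W i z * (if g i = z then h g else 0))"
    unfolding sum_distrib_left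
  proof (intro sum.cong refl)
    fix g i assume "g \<in> {g. g permutes V}" "i \<in> V"
    then have "g i \<in> V" by (simp add: permutes_in_image)
    have "(\<Sum>z\<in>V. W i z * (if g i = z then h g else 0)) = (\<Sum>z\<in>V. if g i = z then W i z * h g else 0)"
      by (intro sum.cong) auto
    then show "h g * W i (g i) = (\<Sum>z\<in>V. W i z * (if g i = z then h g else 0))"
      using \<open>g i \<in> V\<close> V by simp
  qed
  also have "\<dots> = (\<Sum>i\<in>V. \<Sum>z\<in>V. W i z * marginal V h i z)"
    unfolding marginal_def sum_distrib_left by (rule sum_swap_double)
  finally show ?thesis .
qed

text \<open>For zero row and column sums, a coordinate \<open>j\<close> other than \<open>i\<close>
  contributes \<open>- N2 * U j y\<close>, and these add up to \<open>N2 * U i y\<close>; coordinate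
  \<open>i\<close> itself contributes \<open>N1 * U i y\<close>. So passing to coordinate sums and
  back to marginals is the scalar \<open>N1 + N2\<close>.\<close>

lemma marginal_coordinates:
  assumes V: "finite V" "V \<noteq> {}"
  shows "\<exists>N>0. \<forall>U. (\<forall>j\<in>V. (\<Sum>z\<in>V. U j z) = 0) \<longrightarrow> (\<forall>z\<in>V. (\<Sum>j\<in>V. U j z) = 0) \<longrightarrow>
    (\<forall>i\<in>V. \<forall>y\<in>V. marginal V (\<lambda>g. \<Sum>j\<in>V. U j (g j)) i y = N * U i y)"
proof -
  obtain N1 :: real where N1: "0 < N1"
    "\<forall>i\<in>V. \<forall>y\<in>V. (\<Sum>g | g permutes V. if g i = y then 1 else 0) = N1"
    using card_permutes_point[OF V] by (elim exE conjE)
  obtain N2 :: real where N2: "0 \<le> N2"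
    "\<forall>i\<in>V. \<forall>j\<in>V. \<forall>y\<in>V. \<forall>z\<in>V. i \<noteq> j \<longrightarrow> y \<noteq> z \<longrightarrow>
      (\<Sum>g | g permutes V. if g i = y \<and> g j = z then 1 else 0) = N2"
    using card_permutes_pair[of V] by (elim exE conjE)
  have "marginal V (\<lambda>g. \<Sum>j\<in>V. U j (g j)) i y = (N1 + N2) * U i y"
    if U: "\<And>j. j \<in> V \<Longrightarrow> (\<Sum>z\<in>V. U j z) = 0" "\<And>z. z \<in> V \<Longrightarrow> (\<Sum>j\<in>V. U j z) = 0"
      and iy: "i \<in> V" "y \<in> V" for U i y
  proof -
    let ?h = "\<lambda>g. if g i = y then 1 else 0 :: real"
    have m: "marginal V ?h j z = (if j = i then if z = y then N1 else 0 else if z = y then 0 else N2)"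
      if jz: "j \<in> V" "z \<in> V" for j z
    proof -
      have "marginal V ?h j z = (\<Sum>g | g permutes V. if g i = y \<and> g j = z then 1 else 0)"
        unfolding marginal_def by (intro sum.cong refl) auto
      moreover have "\<not> (g i = y \<and> g j = y)" if "g permutes V" "j \<noteq> i" for g
        using permutes_inj[OF that(1)] that(2) by (auto dest: injD)
      then have "(\<Sum>g | g permutes V. if g i = y \<and> g j = y then 1 else 0 :: real) = 0" if "j \<noteq> i"
        using that by (intro sum.neutral) auto
      moreover have "(\<Sum>g | g permutes V. if g i = y \<and> g i = z then 1 else 0 :: real) = (if z = y then N1 else 0)"
        using N1(2) iy by (auto intro!: sum.neutral)
      moreover have "(\<Sum>g | g permutes V. if g i = y \<and> g j = z then 1 else 0 :: real) = N2"
        if "j \<noteq> i" "z \<noteq> y"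
        by (rule N2(2)[rule_format]) (use iy jz that in auto)
      ultimately show ?thesis by (cases "j = i"; cases "z = y") simp_all
    qed
    have "marginal V (\<lambda>g. \<Sum>j\<in>V. U j (g j)) i y = (\<Sum>g | g permutes V. ?h g * (\<Sum>j\<in>V. U j (g j)))"
      unfolding marginal_def by (intro sum.cong refl) auto
    also have "\<dots> = (\<Sum>j\<in>V. \<Sum>z\<in>V. U j z * (if j = i then if z = y then N1 else 0 else if z = y then 0 else N2))"
      unfolding sum_mult_coordinates[OF V(1), of ?h U] by (intro sum.cong refl) (simp add: m)
    also have "\<dots> = (\<Sum>j\<in>V. if j = i then N1 * U i y else - N2 * U j y)"
    proof (rule sum.cong[OF refl])
      fix j assume j: "j \<in> V"
      have "(\<Sum>z\<in>V. U j z * (if z = y then 0 else N2)) = (\<Sum>z\<in>V. N2 * U j z - (if z = y then N2 * U j z else 0))"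
        by (intro sum.cong refl) auto
      also have "\<dots> = - N2 * U j y"
        using V(1) iy U(1)[OF j] by (simp add: sum_subtractf sum_distrib_left[symmetric])
      finally have "(\<Sum>z\<in>V. U j z * (if z = y then 0 else N2)) = - N2 * U j y" .
      moreover have "(\<Sum>z\<in>V. U j z * (if z = y then N1 else 0)) = N1 * U j y"
        using V(1) iy by (simp add: if_distrib[of "(*) _"] cong: if_cong)
      ultimately show "(\<Sum>z\<in>V. U j z * (if j = i then if z = y then N1 else 0 else if z = y then 0 else N2)) =
        (if j = i then N1 * U i y else - N2 * U j y)" by (cases "j = i") auto
    qed
    also have "\<dots> = (\<Sum>j\<in>V. (if j = i then (N1 + N2) * U i y else 0) - N2 * U j y)"
      by (intro sum.cong refl) (auto simp: algebra_simps)
    also have "\<dots> = (N1 + N2) * U i y"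
      using V(1) iy U(2) by (simp add: sum_subtractf sum_distrib_left[symmetric])
    finally show ?thesis .
  qed
  then show ?thesis using N1(1) N2(1) by (intro exI[of _ "N1 + N2"]) auto
qed

section \<open>The generator and the splitting of mean-zero functions\<close>

definition generator :: "('a \<Rightarrow> 'a \<Rightarrow> real) \<Rightarrow> 'a set \<Rightarrow> (('a \<Rightarrow> 'a) \<Rightarrow> real) \<Rightarrow> ('a \<Rightarrow> 'a) \<Rightarrow> real" where
  "generator c V f g = (\<Sum>x\<in>V. \<Sum>y\<in>V. c x y * (f g - f (tau x y \<circ> g)))"

lemma generator_symmetric:
  "(\<Sum>g | g permutes V. h g * generator c V f g) = (\<Sum>g | g permutes V. generator c V h g * f g)"
proof -
  have swap: "(\<Sum>g | g permutes V. h g * f (tau x y \<circ> g)) = (\<Sum>g | g permutes V. h (tau x y \<circ> g) * f g)"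
    if "x \<in> V" "y \<in> V" for x y
    using sum_permutes_compose_left[OF permutes_swap_id[OF that], of "\<lambda>g. h (tau x y \<circ> g) * f g"]
    by (simp add: o_assoc)
  have "(\<Sum>g | g permutes V. h g * generator c V f g) =
      (\<Sum>x\<in>V. \<Sum>y\<in>V. \<Sum>g | g permutes V. c x y * (h g * f g - h g * f (tau x y \<circ> g)))"
    unfolding generator_def sum_distrib_left
    by (rule trans[OF sum_swap_double]) (intro sum.cong refl, simp add: algebra_simps)
  also have "\<dots> = (\<Sum>x\<in>V. \<Sum>y\<in>V. \<Sum>g | g permutes V. c x y * (h g * f g - h (tau x y \<circ> g) * f g))"
    by (rule sum.cong[OF refl], rule sum.cong[OF refl])
      (simp add: sum_distrib_left[symmetric] sum_subtractf swap)
  also have "\<dots> = (\<Sum>g | g permutes V. generator c V h g * f g)"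
    unfolding generator_def sum_distrib_right
    by (rule trans[OF sum_swap_double[symmetric]]) (intro sum.cong refl, simp add: algebra_simps)
  finally show ?thesis .
qed

lemma interchange_form_generator:
  "interchange_form c V f = (\<Sum>g | g permutes V. f g * generator c V f g)"
proof -
  have "(\<Sum>g | g permutes V. f g * generator c V f g) =
      (\<Sum>x\<in>V. \<Sum>y\<in>V. \<Sum>g | g permutes V. c x y * (f g * f g - f g * f (tau x y \<circ> g)))"
    unfolding generator_def sum_distrib_left
    by (rule trans[OF sum_swap_double]) (intro sum.cong refl, simp add: algebra_simps)
  then show ?thesis
    unfolding interchange_form_def corr_def
    by (simp add: sum_distrib_left[symmetric] sum_subtractf)
qed

lemma generator_diff: "generator c V (\<lambda>g. f g - h g) g = generator c V f g - generator c V h g"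
  unfolding generator_def sum_subtractf[symmetric] by (intro sum.cong refl) (simp add: algebra_simps)

text \<open>\<open>tau x y\<close> moves only \<open>x\<close> and \<open>y\<close>, so for each
  pair only these two values of \<open>z\<close> contribute, and together they give the
  square.\<close>

lemma graph_form_laplacian:
  assumes V: "finite V"
  shows "(\<Sum>z\<in>V. (\<Sum>x\<in>V. \<Sum>y\<in>V. c x y * (u z - u (tau x y z))) * u z) = graph_form c V u"
proof -
  have "(\<Sum>z\<in>V. (\<Sum>x\<in>V. \<Sum>y\<in>V. c x y * (u z - u (tau x y z))) * u z) =
      (\<Sum>x\<in>V. \<Sum>y\<in>V. \<Sum>z\<in>V. c x y * ((u z - u (tau x y z)) * u z))"
    unfolding sum_distrib_right by (rule trans[OF sum_swap_double]) (simp add: mult_ac)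
  also have "\<dots> = (\<Sum>x\<in>V. \<Sum>y\<in>V. c x y * (u x - u y)\<^sup>2)"
  proof (intro sum.cong refl)
    fix x y assume xy: "x \<in> V" "y \<in> V"
    have "(\<Sum>z\<in>V. (u z - u (tau x y z)) * u z) = (\<Sum>z\<in>{x, y}. (u z - u (tau x y z)) * u z)"
      using V xy by (intro sum.mono_neutral_right) (auto simp: Transposition.transpose_def)
    also have "\<dots> = (u x - u y)\<^sup>2"
      by (cases "x = y") (auto simp: power2_eq_square algebra_simps)
    finally show "(\<Sum>z\<in>V. c x y * ((u z - u (tau x y z)) * u z)) = c x y * (u x - u y)\<^sup>2"
      by (simp add: sum_distrib_left[symmetric])
  qed
  finally show ?thesis by (simp add: graph_form_def)
qed

lemma marginal_sum:
  assumes V: "finite V" and f: "(\<Sum>g | g permutes V. f g) = 0"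
  shows "i \<in> V \<Longrightarrow> (\<Sum>y\<in>V. marginal V f i y) = 0" "y \<in> V \<Longrightarrow> (\<Sum>i\<in>V. marginal V f i y) = 0"
proof -
  assume i: "i \<in> V"
  have "(\<Sum>y\<in>V. marginal V f i y) = (\<Sum>g | g permutes V. \<Sum>y\<in>V. if g i = y then f g else 0)"
    unfolding marginal_def by (rule sum.swap)
  also have "\<dots> = (\<Sum>g | g permutes V. f g)"
    using V i by (intro sum.cong refl) (simp add: permutes_in_image)
  finally show "(\<Sum>y\<in>V. marginal V f i y) = 0" using f by simp
next
  assume y: "y \<in> V"
  have "(\<Sum>i\<in>V. marginal V f i y) = (\<Sum>g | g permutes V. \<Sum>i\<in>V. if g i = y then f g else 0)"
    unfolding marginal_def by (rule sum.swap)
  also have "\<dots> = (\<Sum>g | g permutes V. f g)"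
  proof (intro sum.cong refl)
    fix g assume "g \<in> {g. g permutes V}"
    then have g: "g permutes V" by simp
    have "(\<Sum>i\<in>V. if g i = y then f g else 0) = (\<Sum>i\<in>V. if i = Hilbert_Choice.inv g y then f g else 0)"
      using g by (intro sum.cong refl) (metis permutes_inverses)
    then show "(\<Sum>i\<in>V. if g i = y then f g else 0) = f g"
      using V y permutes_inv[OF g] by (simp add: permutes_in_image)
  qed
  finally show "(\<Sum>i\<in>V. marginal V f i y) = 0" using f by simp
qed

text \<open>
  A mean-zero function is split into its projection onto the sums of functions of a single
  coordinate, on which the generator acts as the graph Laplacian, and a part without marginals.
\<close>

lemma gap_from_zero_marginals:
  assumes V: "finite V" "V \<noteq> {}"
    and gap: "\<And>u. (\<Sum>y\<in>V. u y) = 0 \<Longrightarrow> \<kappa> * (\<Sum>y\<in>V. (u y)\<^sup>2) \<le> graph_form c V u"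
    and zero: "\<And>h. (\<And>i y. i \<in> V \<Longrightarrow> y \<in> V \<Longrightarrow> marginal V h i y = 0) \<Longrightarrow>
      \<kappa> * corr V h id \<le> interchange_form c V h"
    and f: "(\<Sum>g | g permutes V. f g) = 0"
  shows "\<kappa> * corr V f id \<le> interchange_form c V f"
proof -
  define U where "U = marginal V f"
  obtain N where N: "0 < N" "\<forall>U. (\<forall>j\<in>V. (\<Sum>z\<in>V. U j z) = 0) \<longrightarrow> (\<forall>z\<in>V. (\<Sum>j\<in>V. U j z) = 0) \<longrightarrow>
    (\<forall>i\<in>V. \<forall>y\<in>V. marginal V (\<lambda>g. \<Sum>j\<in>V. U j (g j)) i y = N * U i y)"
    using marginal_coordinates[OF V] by (elim exE conjE)
  \<comment> \<open>The factor \<open>1 / N\<close> gives \<open>f1\<close> the marginals of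
    \<open>f\<close>, so that \<open>f2\<close> has none.\<close>
  define f1 where "f1 = (\<lambda>g. (\<Sum>j\<in>V. U j (g j)) / N)"
  define f2 where "f2 = (\<lambda>g. f g - f1 g)"
  let ?S = "{g. g permutes V}"
  have m1: "marginal V f1 i y = U i y" if "i \<in> V" "y \<in> V" for i y
  proof -
    have "marginal V f1 i y = marginal V (\<lambda>g. \<Sum>j\<in>V. U j (g j)) i y / N"
      unfolding marginal_def f1_def by (subst (2) sum_divide_distrib) (intro sum.cong refl, auto)
    also have "marginal V (\<lambda>g. \<Sum>j\<in>V. U j (g j)) i y = N * U i y"
      using N(2)[rule_format, OF _ _ that] marginal_sum[OF V(1) f] unfolding U_def by blast
    finally show ?thesis using N(1) by simp
  qed
  have m2: "marginal V f2 i y = 0" if "i \<in> V" "y \<in> V" for i y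
  proof -
    have "marginal V f2 i y = marginal V f i y - marginal V f1 i y"
      unfolding marginal_def f2_def sum_subtractf[symmetric] by (intro sum.cong refl) auto
    then show ?thesis using m1[OF that] by (simp add: U_def)
  qed
  have pair: "(\<Sum>g\<in>?S. h g * f1 g) = (\<Sum>i\<in>V. \<Sum>z\<in>V. U i z * marginal V h i z) / N" for h
    using sum_mult_coordinates[OF V(1), of h U] by (simp add: f1_def sum_divide_distrib[symmetric])
  define lap where "lap = (\<lambda>u z. \<Sum>x\<in>V. \<Sum>y\<in>V. c x y * (u z - u (tau x y z) :: real))"
  have gen1: "generator c V f1 g = (\<Sum>i\<in>V. lap (U i) (g i)) / N" for g
  proof -
    have "generator c V f1 g = (\<Sum>x\<in>V. \<Sum>y\<in>V. \<Sum>i\<in>V. c x y * (U i (g i) - U i (tau x y (g i))) / N)"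
      unfolding generator_def f1_def
      by (intro sum.cong refl)
        (simp add: sum_divide_distrib[symmetric] sum_distrib_left[symmetric] sum_subtractf
            diff_divide_distrib right_diff_distrib)
    also have "\<dots> = (\<Sum>i\<in>V. \<Sum>x\<in>V. \<Sum>y\<in>V. c x y * (U i (g i) - U i (tau x y (g i))) / N)"
      by (rule sum_swap_double[symmetric])
    finally show ?thesis by (simp add: lap_def sum_divide_distrib)
  qed
  have pairgen: "(\<Sum>g\<in>?S. h g * generator c V f1 g) = (\<Sum>i\<in>V. \<Sum>z\<in>V. lap (U i) z * marginal V h i z) / N" for h
    using sum_mult_coordinates[OF V(1), of h "\<lambda>i. lap (U i)"] by (simp add: gen1 sum_divide_distrib[symmetric])
  have split: "f g = f1 g + f2 g" for g by (simp add: f2_def)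
  have "corr V f id = (\<Sum>g\<in>?S. f1 g * f1 g) + 2 * (\<Sum>g\<in>?S. f2 g * f1 g) + corr V f2 id"
    by (simp add: corr_def split distrib_left distrib_right sum.distrib sum_distrib_left mult_ac)
  then have norm: "corr V f id = (\<Sum>i\<in>V. \<Sum>z\<in>V. (U i z)\<^sup>2) / N + corr V f2 id"
    unfolding pair by (simp add: m1 m2 power2_eq_square)
  have gen: "generator c V f g = generator c V f1 g + generator c V f2 g" for g
    using generator_diff[of c V f f1 g] by (simp add: f2_def)
  have "interchange_form c V f = (\<Sum>g\<in>?S. f1 g * generator c V f1 g) + (\<Sum>g\<in>?S. f2 g * generator c V f1 g)
      + (\<Sum>g\<in>?S. f1 g * generator c V f2 g) + interchange_form c V f2"
    unfolding interchange_form_generator by (simp add: gen split distrib_left distrib_right sum.distrib)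
  also have "(\<Sum>g\<in>?S. f1 g * generator c V f2 g) = (\<Sum>g\<in>?S. f2 g * generator c V f1 g)"
    using generator_symmetric[of f1 c V f2] by (simp add: mult.commute)
  \<comment> \<open>\<open>generator c V f1\<close> is again a sum of one-coordinate functions, so
    its pairing with \<open>f2\<close> involves only the vanishing marginals of
    \<open>f2\<close>.\<close>
  also have "(\<Sum>g\<in>?S. f2 g * generator c V f1 g) = 0"
    unfolding pairgen by (simp add: m2)
  also have "(\<Sum>g\<in>?S. f1 g * generator c V f1 g) = (\<Sum>i\<in>V. graph_form c V (U i)) / N"
    unfolding pairgen graph_form_laplacian[OF V(1), symmetric] lap_def by (simp add: m1)
  finally have form: "interchange_form c V f = (\<Sum>i\<in>V. graph_form c V (U i)) / N + interchange_form c V f2"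
    by simp
  have "\<kappa> * (\<Sum>i\<in>V. \<Sum>z\<in>V. (U i z)\<^sup>2) \<le> (\<Sum>i\<in>V. graph_form c V (U i))"
    unfolding sum_distrib_left[of \<kappa> _ V]
    by (intro sum_mono) (simp add: gap[unfolded sum_distrib_left] U_def marginal_sum[OF V(1) f])
  then have "\<kappa> * ((\<Sum>i\<in>V. \<Sum>z\<in>V. (U i z)\<^sup>2) / N) \<le> (\<Sum>i\<in>V. graph_form c V (U i)) / N"
    using N(1) by (simp add: divide_right_mono)
  moreover have "\<kappa> * corr V f2 id \<le> interchange_form c V f2"
    by (rule zero) (rule m2)
  ultimately show ?thesis
    unfolding norm form distrib_left by (rule add_mono)
qed

text \<open>The induction keeps \<open>\<kappa>\<close> fixed and varies the weights: by
  \<open>reduced_gap\<close>, removing a vertex preserves the gap hypothesis with the same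
  constant.\<close>

theorem interchange_gap:
  assumes V: "finite V" and \<kappa>: "0 \<le> \<kappa>"
    and c: "\<And>x y. c x y = c y x" "\<And>x y. 0 \<le> c x y"
    and gap: "\<And>u. (\<Sum>y\<in>V. u y) = 0 \<Longrightarrow> \<kappa> * (\<Sum>y\<in>V. (u y)\<^sup>2) \<le> graph_form c V u"
    and f: "(\<Sum>g | g permutes V. f g) = 0"
  shows "\<kappa> * corr V f id \<le> interchange_form c V f"
  using V c gap f
proof (induction V arbitrary: c f rule: finite_induct)
  case empty
  then show ?case by (simp add: corr_def interchange_form_def)
next
  case (insert x V)
  note V = insert.hyps and c = insert.prems(1,2) and gap = insert.prems(3)
  have red: "reduced V x c y z = reduced V x c z y" "0 \<le> reduced V x c y z" for y z
    using c total_rate_nonneg[OF V c] by (auto simp: reduced_def[OF V c])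
  show ?case
  proof (rule gap_from_zero_marginals[OF _ _ gap _ insert.prems(4)])
    fix h assume "\<And>i y. i \<in> insert x V \<Longrightarrow> y \<in> insert x V \<Longrightarrow> marginal (insert x V) h i y = 0"
    then show "\<kappa> * corr (insert x V) h id \<le> interchange_form c (insert x V) h"
      by (intro gap_zero_marginals[OF V c \<kappa> gap] insert.IH red) auto
  qed (use V in auto)
qed

section \<open>Signs and cycles\<close>

text \<open>For finite \<open>D\<close> and injective \<open>h\<close> this says that
  \<open>h\<close> acts on \<open>D\<close> as a single cycle. The form by invariant subsets fits
  \<open>chi\<close>, whose support is given by invariant sets.\<close>

definition transitive_on :: "('a \<Rightarrow> 'a) \<Rightarrow> 'a set \<Rightarrow> bool" where
  "transitive_on h D \<longleftrightarrow> D \<noteq> {} \<and> h ` D = D \<and> (\<forall>E\<subseteq>D. h ` E = E \<longrightarrow> E = {} \<or> E = D)"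

lemma transitive_onD:
  "transitive_on h D \<Longrightarrow> E \<subseteq> D \<Longrightarrow> h ` E = E \<Longrightarrow> E = {} \<or> E = D"
  by (simp add: transitive_on_def)

lemma image_transpose_notin: "x \<notin> E \<Longrightarrow> y \<notin> E \<Longrightarrow> tau x y ` E = E"
  by (auto simp: image_iff Transposition.transpose_def split: if_splits)

lemma image_transpose_swap: "x \<notin> E \<Longrightarrow> y \<in> E \<Longrightarrow> tau x y ` E = insert x (E - {y})"
  by (auto simp: image_iff Transposition.transpose_def split: if_splits)

lemma image_transpose_in: "x \<in> E \<Longrightarrow> y \<in> E \<Longrightarrow> tau x y ` E = E"
  by (auto simp: image_iff Transposition.transpose_def split: if_splits)

text \<open>The permutation \<open>tau b (h b) \<circ> h\<close> splices \<open>b\<close> out of the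
  cycle: it fixes \<open>b\<close> and still acts as a single cycle on the rest. Each splice costs
  one transposition.\<close>

lemma sign_transitive:
  assumes "finite D" "h permutes D" "transitive_on h D"
  shows "sign h = (- 1) ^ (card D + 1)"
  using assms
proof (induction "card D" arbitrary: D h rule: less_induct)
  case less
  obtain b where b: "b \<in> D" using less.prems(3) by (auto simp: transitive_on_def)
  show ?case
  proof (cases "h b = b")
    case True
    then have "{b} = D" using less.prems(3) b unfolding transitive_on_def by (metis empty_subsetI image_empty image_insert insert_not_empty insert_subset)
    then have "h = id" using less.prems(2) by (metis permutes_sing)
    then show ?thesis using \<open>{b} = D\<close> by auto
  next
    case False
    define d where "d = h b"
    define h' where "h' = tau b d \<circ> h"
    have d: "d \<in> D" "d \<noteq> b" using False b less.prems(2) by (auto simp: d_def permutes_in_image)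
    have h: "h = tau b d \<circ> h'" by (simp add: h'_def o_assoc)
    have "h' b = b" by (simp add: h'_def d_def)
    have "h' permutes D"
      unfolding h'_def using less.prems(2) b d by (intro permutes_compose permutes_swap_id)
    then have h': "h' permutes D - {b}"
      by (rule permutes_superset) (use \<open>h' b = b\<close> in auto)
    have "transitive_on h' (D - {b})"
      unfolding transitive_on_def
    proof (intro conjI allI impI)
      show "D - {b} \<noteq> {}" using d by auto
      show "h' ` (D - {b}) = D - {b}" using h' by (rule permutes_image)
      fix E assume E: "E \<subseteq> D - {b}" "h' ` E = E"
      have hE: "h ` E = tau b d ` E" using E(2) image_comp[of "tau b d" h' E] h by simp
      have bE: "b \<notin> E" using E(1) by auto
      show "E = {} \<or> E = D - {b}"
      proof (cases "d \<in> E")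
        case True
        then have "h ` insert b E = insert b E"
          using hE bE by (auto simp: image_transpose_swap d_def[symmetric])
        moreover have "insert b E \<subseteq> D" using E(1) b by auto
        ultimately have "insert b E = D" using transitive_onD[OF less.prems(3), of "insert b E"] by auto
        then show ?thesis using bE by auto
      next
        case False
        then have "h ` E = E" using hE bE by (simp add: image_transpose_notin)
        then have "E = {} \<or> E = D" using E(1) by (intro transitive_onD[OF less.prems(3)]) auto
        then show ?thesis using bE b by auto
      qed
    qed
    moreover have card: "card D = Suc (card (D - {b}))"
      using less.prems(1) b by (metis card_Suc_Diff1)
    ultimately have "sign h' = (- 1) ^ (card (D - {b}) + 1)"
      using less.prems(1) h' by (intro less.hyps) auto
    moreover have "sign h = sign (tau b d) * sign h'"
      unfolding h using h' less.prems(1)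
      by (intro sign_compose) (auto simp: permutation_swap_id intro: permutes_imp_permutation)
    ultimately show ?thesis using d card by (simp add: sign_swap_id)
  qed
qed

lemma inj_image_eq_bij: "inj h \<Longrightarrow> h ` C = C \<Longrightarrow> bij_betw h C C"
  by (auto simp: bij_betw_def inj_on_def inj_def)

lemma sign_on_transitive:
  assumes "finite D" "inj h" "transitive_on h D"
  shows "sign_on D h = (- 1) ^ (card D + 1)"
proof -
  have b: "bij_betw h D D" using assms by (intro inj_image_eq_bij) (auto simp: transitive_on_def)
  have im: "restrict_id h D ` E = h ` E" if "E \<subseteq> D" for E
    using that by (auto simp: restrict_id_def image_iff)
  have "transitive_on (restrict_id h D) D"
    using assms(3) unfolding transitive_on_def by (simp add: im)
  then show ?thesis
    unfolding sign_on_def using assms(1) b by (intro sign_transitive permutes_restrict_id) auto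
qed

lemma sign_on_Un:
  assumes "finite C" "finite D" "inj h" "h ` C = C" "h ` D = D" "C \<inter> D = {}"
  shows "sign_on (C \<union> D) h = sign_on C h * sign_on D h"
proof -
  have p: "restrict_id h C permutes C" "restrict_id h D permutes D"
    using assms by (auto intro!: permutes_restrict_id inj_image_eq_bij)
  have "restrict_id h (C \<union> D) = restrict_id h C \<circ> restrict_id h D"
    using assms(5,6) by (auto simp: restrict_id_def fun_eq_iff)
  then show ?thesis
    unfolding sign_on_def using p assms(1,2)
    by (simp add: sign_compose permutes_imp_permutation[OF assms(1)] permutes_imp_permutation[OF assms(2)])
qed

section \<open>Invariant sets and cycles through two points\<close>

lemma image_Diff_invariant: "inj h \<Longrightarrow> h ` A = A \<Longrightarrow> h ` C = C \<Longrightarrow> h ` (A - C) = A - C"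
  by (simp add: image_set_diff)

lemma image_Int_invariant: "inj h \<Longrightarrow> h ` A = A \<Longrightarrow> h ` C = C \<Longrightarrow> h ` (A \<inter> C) = A \<inter> C"
  by (simp add: image_Int)

lemma image_Un_invariant_iff:
  assumes "inj h" "h ` D = D" "C \<inter> D = {}"
  shows "h ` (C \<union> D) = C \<union> D \<longleftrightarrow> h ` C = C"
proof
  assume "h ` (C \<union> D) = C \<union> D"
  then have "h ` (C \<union> D - D) = C \<union> D - D" using assms by (intro image_Diff_invariant)
  moreover have "C \<union> D - D = C" using assms(3) by auto
  ultimately show "h ` C = C" by simp
qed (use assms in \<open>simp add: image_Un\<close>)

lemma ex_transitive_subset:
  assumes "finite D" "inj h" "h ` D = D" "b \<in> D"
  obtains E where "transitive_on h E" "b \<in> E" "E \<subseteq> D"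
proof -
  have "\<exists>E. transitive_on h E \<and> b \<in> E \<and> E \<subseteq> D"
    using assms(1,3,4)
  proof (induction D rule: finite_psubset_induct)
    case (psubset D)
    show ?case
    proof (cases "transitive_on h D")
      case False
      then obtain E where E: "E \<subseteq> D" "h ` E = E" "E \<noteq> {}" "E \<noteq> D"
        using psubset.prems unfolding transitive_on_def by auto
      have "h ` (D - E) = D - E" using assms(2) psubset.prems(1) E(2) by (rule image_Diff_invariant)
      then show ?thesis
        using psubset.IH[of E] psubset.IH[of "D - E"] E psubset.prems(2) by blast
    qed (use psubset.prems in blast)
  qed
  then show thesis using that by blast
qed

text \<open>For finite \<open>A\<close> and injective \<open>h\<close>: every cycle inside
  \<open>A\<close> meets \<open>S\<close>. In the same terms \<open>separates\<close> says that
  \<open>b\<close> lies in a cycle without \<open>a\<close>.\<close>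

definition no_cycle_avoiding :: "('a \<Rightarrow> 'a) \<Rightarrow> 'a set \<Rightarrow> 'a set \<Rightarrow> bool" where
  "no_cycle_avoiding h A S \<longleftrightarrow> (\<forall>D\<subseteq>A - S. h ` D = D \<longrightarrow> D = {})"

definition separates :: "('a \<Rightarrow> 'a) \<Rightarrow> 'a set \<Rightarrow> 'a \<Rightarrow> 'a \<Rightarrow> bool" where
  "separates h A a b \<longleftrightarrow> (\<exists>C\<subseteq>A. h ` C = C \<and> b \<in> C \<and> a \<notin> C)"

lemma no_cycle_avoidingD:
  "no_cycle_avoiding h A S \<Longrightarrow> D \<subseteq> A - S \<Longrightarrow> h ` D = D \<Longrightarrow> D = {}"
  by (simp add: no_cycle_avoiding_def)

lemma no_cycle_avoiding_mono:
  assumes "no_cycle_avoiding h A S" "C - T \<subseteq> A - S"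
  shows "no_cycle_avoiding h C T"
  using assms unfolding no_cycle_avoiding_def by (meson order_trans)

lemma transitive_on_iff:
  assumes "inj h" "h ` A = A" "a \<in> A" "b \<in> A"
  shows "transitive_on h A \<longleftrightarrow> no_cycle_avoiding h A {a, b} \<and> \<not> separates h A a b"
proof
  assume t: "transitive_on h A"
  show "no_cycle_avoiding h A {a, b} \<and> \<not> separates h A a b"
    unfolding no_cycle_avoiding_def separates_def
  proof (intro conjI allI impI notI)
    fix D assume "D \<subseteq> A - {a, b}" "h ` D = D"
    then show "D = {}" using transitive_onD[OF t, of D] assms(3) by auto
  next
    assume "\<exists>C\<subseteq>A. h ` C = C \<and> b \<in> C \<and> a \<notin> C"
    then obtain C where "C \<subseteq> A" "h ` C = C" "b \<in> C" "a \<notin> C" by auto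
    then show False using transitive_onD[OF t, of C] assms(3) by auto
  qed
next
  assume n: "no_cycle_avoiding h A {a, b} \<and> \<not> separates h A a b"
  have sep: "a \<in> C" if "C \<subseteq> A" "h ` C = C" "b \<in> C" for C
    using n that by (auto simp: separates_def)
  have av: "D = {}" if "D \<subseteq> A - {a, b}" "h ` D = D" for D
    using n that by (simp add: no_cycle_avoiding_def)
  show "transitive_on h A"
    unfolding transitive_on_def
  proof (intro conjI allI impI)
    fix E assume E: "E \<subseteq> A" "h ` E = E"
    have d: "h ` (A - E) = A - E" using assms(1,2) E(2) by (rule image_Diff_invariant)
    consider "a \<in> E" "b \<in> E" | "a \<notin> E" "b \<notin> E"
      using sep[OF E] sep[OF _ d] assms(3,4) by auto
    then show "E = {} \<or> E = A"
    proof cases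
      case 1
      then have "A - E = {}" using d by (intro av) auto
      then show ?thesis using E by blast
    next
      case 2
      then have "E = {}" using E by (intro av) auto
      then show ?thesis by blast
    qed
  qed (use assms in auto)
qed

text \<open>The separating set and its complement contain one of the two points each, and every
  cycle meets \<open>{a, b}\<close>, so both are single cycles. The two signs multiply to
  \<open>(- 1) ^ card A\<close>.\<close>

lemma sign_on_separates:
  assumes "finite A" "inj h" "h ` A = A" "no_cycle_avoiding h A {a, b}" "a \<in> A" "separates h A a b"
  shows "sign_on A h = (- 1) ^ card A"
proof -
  obtain C where C: "C \<subseteq> A" "h ` C = C" "b \<in> C" "a \<notin> C"
    using assms(6) by (auto simp: separates_def)
  have d: "h ` (A - C) = A - C" using assms(2,3) C(2) by (rule image_Diff_invariant)
  have 1: "transitive_on h C"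
    using transitive_on_iff[of h C b b] no_cycle_avoiding_mono[OF assms(4), of C "{b, b}"] assms(2) C
    by (auto simp: separates_def)
  have 2: "transitive_on h (A - C)"
    using transitive_on_iff[of h "A - C" a a] no_cycle_avoiding_mono[OF assms(4), of "A - C" "{a, a}"] assms(2,5) C d
    by (auto simp: separates_def)
  have fin: "finite C" "finite (A - C)" using assms(1) C(1) finite_subset by auto
  have "sign_on A h = sign_on (C \<union> (A - C)) h" using C(1) by (simp add: Un_absorb1)
  also have "\<dots> = sign_on C h * sign_on (A - C) h"
    using fin assms(2) C d by (intro sign_on_Un) auto
  also have "\<dots> = (- 1) ^ (card C + card (A - C))"
    using 1 2 fin assms(2) by (simp add: sign_on_transitive power_add)
  also have "card C + card (A - C) = card A"
    using C(1) assms(1) fin by (simp add: card_Diff_subset card_mono)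
  finally show ?thesis .
qed

lemma no_cycle_avoiding_transpose:
  assumes "a \<in> A" "b \<in> A"
  shows "no_cycle_avoiding (tau a b \<circ> g) A {a, b} \<longleftrightarrow> no_cycle_avoiding g A {a, b}"
proof -
  have "(tau a b \<circ> g) ` D = D \<longleftrightarrow> g ` D = D" if "D \<subseteq> A - {a, b}" for D
  proof -
    have t: "tau a b ` D = D" using that by (intro image_transpose_notin) auto
    have "(tau a b \<circ> g) ` D = D \<longleftrightarrow> tau a b ` g ` D = tau a b ` D"
      using t by (simp add: image_comp)
    also have "\<dots> \<longleftrightarrow> g ` D = D"
      by (rule inj_image_eq_iff) (simp add: bij_is_inj)
    finally show ?thesis .
  qed
  then show ?thesis
    unfolding no_cycle_avoiding_def by (intro iff_allI imp_cong refl)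
qed

text \<open>
  Multiplying by the transposition of \<open>a\<close> and \<open>b\<close> changes the sign, and the sign tells whether
  a permutation all of whose cycles meet \<open>{a, b}\<close> has one or two cycles.
\<close>

lemma transitive_on_transpose:
  assumes "finite A" "inj g" "g ` A = A" "a \<in> A" "b \<in> A" "a \<noteq> b"
  shows "transitive_on g A \<longleftrightarrow>
    no_cycle_avoiding (tau a b \<circ> g) A {a, b} \<and> separates (tau a b \<circ> g) A a b"
proof -
  let ?h = "tau a b \<circ> g"
  have h: "inj ?h" "?h ` A = A"
    using assms image_comp[of "tau a b" g A] image_transpose_in[of a A b]
    by (simp_all add: inj_compose bij_is_inj)
  have "sign_on A ?h = sign_on A (tau a b) * sign_on A g"
    using assms by (intro sign_on_compose inj_image_eq_bij) (auto simp: bij_is_inj image_transpose_in)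
  then have s: "sign_on A ?h = - sign_on A g"
    using assms by (simp add: sign_on_transpose)
  have n: "no_cycle_avoiding ?h A {a, b} \<longleftrightarrow> no_cycle_avoiding g A {a, b}"
    using assms(4,5) by (rule no_cycle_avoiding_transpose)
  have one: "sign_on A p = (- 1) ^ (card A + 1)"
    if "inj p" "p ` A = A" "no_cycle_avoiding p A {a, b}" "\<not> separates p A a b" for p
    using that assms by (intro sign_on_transitive) (auto simp: transitive_on_iff[of p A a b])
  have two: "sign_on A p = (- 1) ^ card A"
    if "inj p" "p ` A = A" "no_cycle_avoiding p A {a, b}" "separates p A a b" for p
    using that assms by (intro sign_on_separates) auto
  have "(- 1 :: int) ^ card A \<noteq> 0" by simp
  then show ?thesis
    unfolding transitive_on_iff[OF assms(2-5)]
    using n s one[of g] two[of g] one[of ?h] two[of ?h] h assms(2,3) by fastforce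
qed

text \<open>Symmetric difference with \<open>D\<close> is a sign-reversing involution on the subsets
  of \<open>S\<close>.\<close>

lemma sum_sign_flip:
  fixes F :: "'a set \<Rightarrow> real"
  assumes "D \<subseteq> S" "\<And>B. B \<subseteq> S \<Longrightarrow> F ((B - D) \<union> (D - B)) = - F B"
  shows "(\<Sum>B\<in>Pow S. F B) = 0"
proof -
  let ?i = "\<lambda>B. (B - D) \<union> (D - B)"
  have "(\<Sum>B\<in>Pow S. F B) = (\<Sum>B\<in>Pow S. F (?i B))"
  proof (rule sum.reindex_bij_witness[of _ ?i ?i])
    fix B
    have "?i (?i B) = B" by blast
    then show "F (?i (?i B)) = F B" "?i (?i B) = B" "?i (?i B) = B" by simp_all
  qed (use assms(1) in auto)
  also have "\<dots> = - (\<Sum>B\<in>Pow S. F B)"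
    unfolding sum_negf[symmetric] by (intro sum.cong refl) (use assms(2) in auto)
  finally show ?thesis by simp
qed

text \<open>The sign character of the action on \<open>C\<close>, taken on the joint stabiliser of
  \<open>A\<close> and \<open>C\<close> and extended by zero. On the stabiliser of \<open>A\<close>
  it is the diagonal matrix coefficient at \<open>e_C\<close> in the exterior algebra.\<close>

definition chi :: "'a set \<Rightarrow> 'a set \<Rightarrow> 'a set \<Rightarrow> ('a \<Rightarrow> 'a) \<Rightarrow> real" where
  "chi V A C h = (if h permutes V \<and> h ` A = A \<and> h ` C = C then of_int (sign_on C h) else 0)"

text \<open>
  Adding or removing a cycle of \<open>h\<close> that avoids \<open>a\<close> and \<open>b\<close> changes the sign of a summand, hence
  everything cancels as soon as there is such a cycle.
\<close>

lemma sum_chi_subsets: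
  assumes V: "finite V" "A \<subseteq> V" and h: "h permutes V" "h ` A = A" and ab: "a \<in> A" "b \<in> A"
  shows "(\<Sum>B\<in>Pow (A - {a, b}). (- 1) ^ card B * chi V A (insert b B) h) =
    (if no_cycle_avoiding h A {a, b} \<and> (a = b \<or> separates h A a b) then 1 else 0)"
proof -
  let ?S = "A - {a, b}"
  let ?F = "\<lambda>B. (- 1) ^ card B * chi V A (insert b B) h"
  have fin: "finite A" using V finite_subset by blast
  have inj: "inj h" using h(1) by (rule permutes_inj)
  have chi: "chi V A C h = (if h ` C = C then of_int (sign_on C h) else 0)" for C
    using h by (simp add: chi_def)
  show ?thesis
  proof (cases "no_cycle_avoiding h A {a, b}")
    case False
    then obtain D0 where D0: "D0 \<subseteq> ?S" "h ` D0 = D0" "D0 \<noteq> {}"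
      by (auto simp: no_cycle_avoiding_def)
    then obtain d where "d \<in> D0" by blast
    have "finite D0" using D0(1) fin by (meson finite_Diff finite_subset)
    then obtain D where D: "transitive_on h D" "D \<subseteq> D0"
      using ex_transitive_subset[OF _ inj D0(2) \<open>d \<in> D0\<close>] by metis
    have DS: "D \<subseteq> ?S" using D D0 by blast
    have finD: "finite D" using DS fin by (meson finite_Diff finite_subset)
    have hD: "h ` D = D" using D(1) by (simp add: transitive_on_def)
    have add: "?F (B \<union> D) = - ?F B" if B: "B \<subseteq> ?S" "B \<inter> D = {}" for B
    proof -
      have finB: "finite B" using B fin by (meson finite_Diff finite_subset)
      have dis: "insert b B \<inter> D = {}" using B DS by blast
      have eq: "insert b (B \<union> D) = insert b B \<union> D" by blast
      have "chi V A (insert b (B \<union> D)) h = chi V A (insert b B) h * (- 1) ^ (card D + 1)"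
        unfolding chi eq using sign_on_Un[OF _ finD inj _ hD dis] finB
        by (auto simp: image_Un_invariant_iff[OF inj hD dis] sign_on_transitive[OF finD inj D(1)]
            simp del: image_insert Un_insert_left)
      moreover have "card (B \<union> D) = card B + card D"
        using finB finD B by (intro card_Un_disjoint) auto
      ultimately show ?thesis
        by (simp add: power_add mult_ac flip: power_mult_distrib)
    qed
    have "(\<Sum>B\<in>Pow ?S. ?F B) = 0"
    proof (rule sum_sign_flip[OF DS])
      fix B assume B: "B \<subseteq> ?S"
      \<comment> \<open>If \<open>insert b B\<close> is invariant, the cycle \<open>D\<close> lies
        inside \<open>B\<close> or is disjoint from it. Otherwise the summand is zero, and when
        \<open>B\<close> cuts \<open>D\<close> properly, so does its partner, whose summand then
        vanishes too.\<close>
      consider "B \<inter> D = {}" | "D \<subseteq> B" | "h ` insert b B \<noteq> insert b B" "\<not> D \<subseteq> B" "B \<inter> D \<noteq> {}"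
      proof (cases "h ` insert b B = insert b B")
        case True
        then have "h ` (insert b B \<inter> D) = insert b B \<inter> D"
          by (rule image_Int_invariant[OF inj _ hD])
        moreover have "insert b B \<inter> D = B \<inter> D" using DS by blast
        ultimately have "B \<inter> D = {} \<or> B \<inter> D = D"
          using transitive_onD[OF D(1), of "B \<inter> D"] by simp
        then show ?thesis using that by blast
      qed (use that in blast)
      then show "?F ((B - D) \<union> (D - B)) = - ?F B"
      proof cases
        case 1
        then have "(B - D) \<union> (D - B) = B \<union> D" by blast
        then show ?thesis using add[OF B 1] by simp
      next
        case 2
        then have eq: "(B - D) \<union> (D - B) = B - D" "(B - D) \<union> D = B" by blast+
        have "?F ((B - D) \<union> D) = - ?F (B - D)" by (rule add) (use B in blast)+
        then show ?thesis unfolding eq by linarith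
      next
        case 3
        have "h ` insert b ((B - D) \<union> (D - B)) \<noteq> insert b ((B - D) \<union> (D - B))"
        proof
          assume "h ` insert b ((B - D) \<union> (D - B)) = insert b ((B - D) \<union> (D - B))"
          then have "h ` (insert b ((B - D) \<union> (D - B)) \<inter> D) = insert b ((B - D) \<union> (D - B)) \<inter> D"
            by (rule image_Int_invariant[OF inj _ hD])
          moreover have "insert b ((B - D) \<union> (D - B)) \<inter> D = D - B" using DS by blast
          ultimately have "D - B = {} \<or> D - B = D"
            using transitive_onD[OF D(1), of "D - B"] by simp
          then show False using 3 by blast
        qed
        then show ?thesis using 3(1) by (simp add: chi del: image_insert)
      qed
    qed
    then show ?thesis using False by simp
  next
    case True
    \<comment> \<open>\<open>O'\<close> is the cycle of \<open>b\<close>. An invariant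
      \<open>insert b B\<close> contains it, and the remainder is invariant and avoids
      \<open>a\<close> and \<open>b\<close>, hence is empty; so at most \<open>B = O' - {b}\<close>
      survives.\<close>
    obtain O' where O: "transitive_on h O'" "b \<in> O'" "O' \<subseteq> A"
      using ex_transitive_subset[OF fin inj h(2) ab(2)] by metis
    have hO: "h ` O' = O'" using O by (simp add: transitive_on_def)
    have finO: "finite O'" using O fin finite_subset by blast
    have uniq: "insert b B = O'" if B: "B \<subseteq> ?S" "h ` insert b B = insert b B" for B
    proof -
      have "h ` (O' \<inter> insert b B) = O' \<inter> insert b B"
        using inj hO B(2) by (rule image_Int_invariant)
      then have 1: "O' \<subseteq> insert b B"
        using transitive_onD[OF O(1), of "O' \<inter> insert b B"] O(2) by auto
      have "h ` (insert b B - O') = insert b B - O'"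
        using inj B(2) hO by (rule image_Diff_invariant)
      moreover have "insert b B - O' \<subseteq> A - {a, b}" using B(1) O(2) by blast
      ultimately have "insert b B - O' = {}" by (intro no_cycle_avoidingD[OF True])
      with 1 show ?thesis by blast
    qed
    have sep: "a = b \<or> separates h A a b \<longleftrightarrow> O' - {b} \<subseteq> ?S"
    proof
      assume l: "a = b \<or> separates h A a b"
      show "O' - {b} \<subseteq> ?S"
      proof (cases "a = b")
        case False
        then obtain C where C: "C \<subseteq> A" "h ` C = C" "b \<in> C" "a \<notin> C" using l by (auto simp: separates_def)
        have "h ` (O' \<inter> C) = O' \<inter> C" using inj hO C(2) by (rule image_Int_invariant)
        then have "O' \<subseteq> C" using transitive_onD[OF O(1), of "O' \<inter> C"] O(2) C(3) by auto
        then show ?thesis using C O by blast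
      qed (use O in blast)
    next
      assume "O' - {b} \<subseteq> ?S"
      then have "a = b \<or> a \<notin> O'" by blast
      then show "a = b \<or> separates h A a b" using O hO by (auto simp: separates_def)
    qed
    have F: "?F B = (if B = O' - {b} then 1 else 0)" if B: "B \<subseteq> ?S" for B
    proof (cases "h ` insert b B = insert b B")
      case True
      then have eq: "insert b B = O'" using B uniq by blast
      then have BO: "B = O' - {b}" using B by blast
      have "card O' = Suc (card B)"
        unfolding BO using finO O(2) by (metis card_Suc_Diff1)
      then have "?F B = (- 1) ^ card B * (- 1) ^ (card B + 2)"
        using True unfolding eq chi hO by (simp add: sign_on_transitive[OF finO inj O(1)])
      then show ?thesis using BO by (simp flip: power_mult_distrib)
    next
      case False
      then have "B \<noteq> O' - {b}" using hO O(2) by (metis insert_Diff)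
      then show ?thesis using False by (simp add: chi del: image_insert)
    qed
    have "(\<Sum>B\<in>Pow ?S. ?F B) = (\<Sum>B\<in>Pow ?S. if B = O' - {b} then 1 else 0)"
      by (intro sum.cong refl F) auto
    also have "\<dots> = (if O' - {b} \<subseteq> ?S then 1 else 0)" using fin by simp
    finally show ?thesis using True sep by simp
  qed
qed

section \<open>Positive definite functions counting cycles\<close>

lemma sum_correlation:
  fixes f :: "('a \<Rightarrow> 'a) \<Rightarrow> real"
  shows "(\<Sum>g | g permutes V. \<Sum>x | x permutes V. f x * f (Hilbert_Choice.inv g \<circ> x)) = (\<Sum>x | x permutes V. f x)\<^sup>2"
proof -
  have "(\<Sum>g | g permutes V. \<Sum>x | x permutes V. f x * f (Hilbert_Choice.inv g \<circ> x)) =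
      (\<Sum>x | x permutes V. f x * (\<Sum>g | g permutes V. f (Hilbert_Choice.inv g \<circ> x)))"
    unfolding sum_distrib_left by (rule sum.swap)
  also have "\<dots> = (\<Sum>x | x permutes V. f x * (\<Sum>x | x permutes V. f x))"
  proof (rule sum.cong[OF refl])
    fix x assume x: "x \<in> {x. x permutes V}"
    have "(\<Sum>g | g permutes V. f (Hilbert_Choice.inv g \<circ> x)) = (\<Sum>g | g permutes V. f (g \<circ> x))"
      by (rule sum_permutations_inverse[symmetric, of "\<lambda>g. f (g \<circ> x)"])
    also have "\<dots> = (\<Sum>x | x permutes V. f x)"
      using x by (intro sum_permutes_compose_right) simp
    finally show "f x * (\<Sum>g | g permutes V. f (Hilbert_Choice.inv g \<circ> x)) = f x * (\<Sum>x | x permutes V. f x)"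
      by simp
  qed
  finally show ?thesis by (simp add: power2_eq_square sum_distrib_right)
qed

context
  fixes V A :: "'a set"
  assumes V: "finite V" and A: "A \<subseteq> V"
begin

lemma finite_A: "finite A"
  using A V by (rule finite_subset)

section \<open>Sign characters extended by zero\<close>

lemma chi_compose:
  assumes u: "u permutes V" "u ` A = A" "u ` C = C" and C: "C \<subseteq> V" and h: "h permutes V"
  shows "chi V A C (h \<circ> u) = chi V A C h * of_int (sign_on C u)"
    "chi V A C (u \<circ> h) = of_int (sign_on C u) * chi V A C h"
proof -
  have fin: "finite C" using C V by (rule finite_subset)
  have inj: "inj u" "inj h" using u(1) h by (auto intro: permutes_inj)
  have p: "h \<circ> u permutes V" "u \<circ> h permutes V" using u(1) h by (auto intro: permutes_compose)
  have img: "(h \<circ> u) ` E = E \<longleftrightarrow> h ` E = E" "(u \<circ> h) ` E = E \<longleftrightarrow> h ` E = E" if "u ` E = E" for E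
  proof -
    show "(h \<circ> u) ` E = E \<longleftrightarrow> h ` E = E" using image_comp[of h u E] that by simp
    have "(u \<circ> h) ` E = E \<longleftrightarrow> u ` h ` E = u ` E" using image_comp[of u h E] that by simp
    then show "(u \<circ> h) ` E = E \<longleftrightarrow> h ` E = E" using inj(1) by (simp add: inj_image_eq_iff)
  qed
  have s: "sign_on C (h \<circ> u) = sign_on C h * sign_on C u" "sign_on C (u \<circ> h) = sign_on C u * sign_on C h"
    if "h ` C = C"
    using inj_image_eq_bij[OF inj(2) that] inj_image_eq_bij[OF inj(1) u(3)] fin
    by (blast intro: sign_on_compose)+
  show "chi V A C (h \<circ> u) = chi V A C h * of_int (sign_on C u)"
    "chi V A C (u \<circ> h) = of_int (sign_on C u) * chi V A C h"
    using p h s unfolding chi_def img[OF u(2)] img[OF u(3)] by auto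
qed

text \<open>A character of a subgroup, extended by zero, reproduces itself under correlation: for
  \<open>y\<close> in the subgroup its value splits off, and for all other \<open>y\<close> both
  sides vanish.\<close>

lemma chi_convolution:
  assumes C: "C \<subseteq> V" and z: "z permutes V"
  shows "(\<Sum>y | y permutes V. chi V A C y * chi V A C (z \<circ> y)) =
    (\<Sum>y | y permutes V. (chi V A C y)\<^sup>2) * chi V A C z"
  unfolding sum_distrib_right
proof (rule sum.cong[OF refl])
  fix y assume y: "y \<in> {y. y permutes V}"
  show "chi V A C y * chi V A C (z \<circ> y) = (chi V A C y)\<^sup>2 * chi V A C z"
  proof (cases "y ` A = A \<and> y ` C = C")
    case True
    then have "chi V A C (z \<circ> y) = chi V A C z * of_int (sign_on C y)"
      using chi_compose(1)[of y C z] y C z by simp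
    moreover have "chi V A C y = of_int (sign_on C y)"
      using True y by (simp add: chi_def)
    ultimately show ?thesis by (simp add: power2_eq_square mult_ac)
  qed (auto simp: chi_def)
qed

lemma chi_norm_pos: "0 < (\<Sum>y | y permutes V. (chi V A C y)\<^sup>2)"
proof -
  have "(chi V A C id)\<^sup>2 \<le> (\<Sum>y | y permutes V. (chi V A C y)\<^sup>2)"
    by (rule member_le_sum[of id _ "\<lambda>y. (chi V A C y)\<^sup>2"]) (auto simp: finite_permutations V)
  then show ?thesis by (simp add: chi_def)
qed

lemma image_inv_eq_iff: "bij h \<Longrightarrow> Hilbert_Choice.inv h ` C = C \<longleftrightarrow> h ` C = C"
  by (metis bij_betw_imp_inj_on bij_is_surj image_f_inv_f image_inv_f_f)

lemma chi_inv:
  assumes C: "C \<subseteq> V" and h: "h permutes V"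
  shows "chi V A C (Hilbert_Choice.inv h) = chi V A C h"
proof (cases "h ` A = A \<and> h ` C = C")
  case True
  have b: "bij h" using h by (rule permutes_bij)
  have "chi V A C (Hilbert_Choice.inv h \<circ> h) = chi V A C (Hilbert_Choice.inv h) * of_int (sign_on C h)"
    using True h C permutes_inv[OF h] by (intro chi_compose(1)) auto
  then have "chi V A C (Hilbert_Choice.inv h) * of_int (sign_on C h) = 1"
    using permutes_inv_o(2)[OF h] by (simp add: chi_def)
  moreover have "sign_on C h = 1 \<or> sign_on C h = -1"
    unfolding sign_on_def by (simp add: sign_def)
  moreover have "chi V A C h = of_int (sign_on C h)" using True h by (simp add: chi_def)
  ultimately show ?thesis by auto
next
  case False
  then show ?thesis
    using permutes_bij[OF h] by (auto simp: chi_def image_inv_eq_iff)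
qed

lemma chi_conjugate:
  assumes C: "C \<subseteq> V" and s: "s permutes V" "s ` A = A" and h: "h permutes V"
  shows "chi V A (s ` C) (s \<circ> h \<circ> Hilbert_Choice.inv s) = chi V A C h"
proof -
  have p: "s \<circ> h \<circ> Hilbert_Choice.inv s permutes V"
    using s(1) h by (intro permutes_compose permutes_inv)
  have inj: "inj s" using s(1) by (rule permutes_inj)
  have inv_s: "Hilbert_Choice.inv s (s x) = x" for x using inj by simp
  have img: "(s \<circ> h \<circ> Hilbert_Choice.inv s) ` s ` E = s ` E \<longleftrightarrow> h ` E = E" for E
  proof -
    have "(s \<circ> h \<circ> Hilbert_Choice.inv s) ` s ` E = s ` h ` E" by (simp add: image_image inv_s)
    then show ?thesis using inj by (simp add: inj_image_eq_iff)
  qed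
  have "sign_on (s ` C) (s \<circ> h \<circ> Hilbert_Choice.inv s) = sign_on C h" if hC: "h ` C = C"
  proof -
    have fin: "finite C" using C V by (rule finite_subset)
    have q: "restrict_id h C permutes C"
      using hC h by (intro permutes_restrict_id inj_image_eq_bij permutes_inj)
    have "restrict_id (s \<circ> h \<circ> Hilbert_Choice.inv s) (s ` C) = s \<circ> restrict_id h C \<circ> Hilbert_Choice.inv s"
    proof
      fix x
      have "x = s (Hilbert_Choice.inv s x)" using s(1) by (simp add: permutes_inverses)
      then obtain z where "x = s z" by blast
      then show "restrict_id (s \<circ> h \<circ> Hilbert_Choice.inv s) (s ` C) x = (s \<circ> restrict_id h C \<circ> Hilbert_Choice.inv s) x"
        using inj by (auto simp: restrict_id_def inv_s inj_image_mem_iff)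
    qed
    moreover have "permutation s" "permutation (restrict_id h C)"
      using s(1) V q fin by (auto intro: permutes_imp_permutation)
    moreover from this have "permutation (Hilbert_Choice.inv s)" "permutation (s \<circ> restrict_id h C)"
      by (auto intro: permutation_inverse permutation_compose)
    ultimately show ?thesis
      unfolding sign_on_def by (simp add: sign_compose sign_inverse)
  qed
  then show ?thesis
    using p h img[of A] img[of C] s(2) by (simp add: chi_def)
qed

text \<open>
  In the exterior algebra, \<open>root_function B b0\<close> describes the vector \<open>\<Sum>a\<in>A - B. e\<^sub>a \<and> e\<^sub>B\<close>, and
  \<open>cycle_kernel B b0\<close> is its matrix coefficient. The auxiliary point \<open>b0\<close> serves to compare the
  orientations of the sets \<open>insert a B\<close>; the result does not depend on it.
\<close>

definition cycle_kernel :: "'a set \<Rightarrow> 'a \<Rightarrow> ('a \<Rightarrow> 'a) \<Rightarrow> real" where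
  "cycle_kernel B b0 g = (\<Sum>a\<in>A - B. \<Sum>b\<in>A - B. chi V A (insert b0 B) (tau a b0 \<circ> g \<circ> tau b b0))"

definition root_function :: "'a set \<Rightarrow> 'a \<Rightarrow> ('a \<Rightarrow> 'a) \<Rightarrow> real" where
  "root_function B b0 x = (\<Sum>a\<in>A - B. chi V A (insert b0 B) (tau a b0 \<circ> x))"

context
  fixes B :: "'a set" and b0 :: 'a
  assumes B: "B \<subseteq> A" and b0: "b0 \<in> A" "b0 \<notin> B"
begin

lemma C_subset: "insert b0 B \<subseteq> V"
  using A B b0 by auto

lemma swap_permutes: "a \<in> A \<Longrightarrow> b \<in> A \<Longrightarrow> tau a b permutes V"
  using A by (intro permutes_swap_id) auto

text \<open>This exhibits \<open>cycle_kernel\<close> as a positive multiple of an autocorrelation,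
  hence as positive definite. It follows termwise from \<open>chi_convolution\<close> after
  substituting \<open>tau a b0 \<circ> x\<close> for \<open>x\<close>.\<close>

lemma root_function_correlation:
  assumes g: "g permutes V"
  shows "(\<Sum>x | x permutes V. root_function B b0 x * root_function B b0 (Hilbert_Choice.inv g \<circ> x)) =
    (\<Sum>y | y permutes V. (chi V A (insert b0 B) y)\<^sup>2) * cycle_kernel B b0 g"
proof -
  let ?c = "chi V A (insert b0 B)" and ?N = "\<Sum>y | y permutes V. (chi V A (insert b0 B) y)\<^sup>2"
  have "(\<Sum>x | x permutes V. root_function B b0 x * root_function B b0 (Hilbert_Choice.inv g \<circ> x)) =
      (\<Sum>x | x permutes V. \<Sum>a\<in>A - B. \<Sum>b\<in>A - B. ?c (tau a b0 \<circ> x) * ?c (tau b b0 \<circ> (Hilbert_Choice.inv g \<circ> x)))"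
    unfolding root_function_def sum_product ..
  also have "\<dots> = (\<Sum>a\<in>A - B. \<Sum>b\<in>A - B. \<Sum>x | x permutes V. ?c (tau a b0 \<circ> x) * ?c (tau b b0 \<circ> (Hilbert_Choice.inv g \<circ> x)))"
    by (rule sum_swap_double)
  also have "\<dots> = (\<Sum>a\<in>A - B. \<Sum>b\<in>A - B. ?N * ?c (tau a b0 \<circ> g \<circ> tau b b0))"
  proof (intro sum.cong refl)
    fix a b assume ab: "a \<in> A - B" "b \<in> A - B"
    have p: "tau a b0 permutes V" "tau b b0 permutes V"
      using ab b0 by (auto intro: swap_permutes)
    have ig: "Hilbert_Choice.inv g permutes V" using g by (rule permutes_inv)
    have z: "tau b b0 \<circ> Hilbert_Choice.inv g \<circ> tau a b0 permutes V" "tau a b0 \<circ> g \<circ> tau b b0 permutes V"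
      using p ig g by (auto intro!: permutes_compose)
    have "(\<Sum>x | x permutes V. ?c (tau a b0 \<circ> x) * ?c (tau b b0 \<circ> (Hilbert_Choice.inv g \<circ> x))) =
        (\<Sum>x | x permutes V. ?c (tau a b0 \<circ> x) * ?c (tau b b0 \<circ> Hilbert_Choice.inv g \<circ> tau a b0 \<circ> (tau a b0 \<circ> x)))"
      by (intro sum.cong refl) (simp add: fun_eq_iff o_def)
    also have "\<dots> = (\<Sum>x | x permutes V. ?c x * ?c (tau b b0 \<circ> Hilbert_Choice.inv g \<circ> tau a b0 \<circ> x))"
      by (rule sum_permutes_compose_left[OF p(1), of "\<lambda>x. ?c x * ?c (tau b b0 \<circ> Hilbert_Choice.inv g \<circ> tau a b0 \<circ> x)"])
    also have "\<dots> = ?N * ?c (tau b b0 \<circ> Hilbert_Choice.inv g \<circ> tau a b0)"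
      using C_subset z(1) by (rule chi_convolution)
    also have "tau b b0 \<circ> Hilbert_Choice.inv g \<circ> tau a b0 = Hilbert_Choice.inv (tau a b0 \<circ> g \<circ> tau b b0)"
      using g by (simp add: o_inv_distrib permutes_bij bij_comp inv_swap_id o_assoc)
    also have "?c \<dots> = ?c (tau a b0 \<circ> g \<circ> tau b b0)"
      using C_subset z(2) by (rule chi_inv)
    finally show "(\<Sum>x | x permutes V. ?c (tau a b0 \<circ> x) * ?c (tau b b0 \<circ> (Hilbert_Choice.inv g \<circ> x))) =
      ?N * ?c (tau a b0 \<circ> g \<circ> tau b b0)" .
  qed
  finally show ?thesis by (simp add: cycle_kernel_def sum_distrib_left)
qed

lemma transpose_product:
  "tau b b0 \<circ> tau a b0 = (if a = b \<or> a = b0 \<or> b = b0 then id else tau a b0) \<circ> tau a b"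
  by (auto simp: fun_eq_iff Transposition.transpose_def)

text \<open>Conjugation by \<open>tau b b0\<close> carries \<open>insert b0 B\<close> to
  \<open>insert b B\<close>, which removes \<open>b0\<close> from the kernel. The factor
  \<open>?u\<close> left over is trivial or swaps two points outside \<open>insert b B\<close>, so
  its sign there is 1.\<close>

lemma chi_cycle_kernel_term:
  assumes ab: "a \<in> A - B" "b \<in> A - B" and g: "g permutes V"
  shows "chi V A (insert b0 B) (tau a b0 \<circ> g \<circ> tau b b0) = chi V A (insert b B) (tau a b \<circ> g)"
proof -
  let ?s = "tau b b0" and ?u = "if a = b \<or> a = b0 \<or> b = b0 then id else tau a b0"
  have p: "?s permutes V" "tau a b0 permutes V" "tau a b permutes V"
    using ab b0 by (auto intro: swap_permutes)
  have s: "?s ` A = A" using ab b0 by (intro image_transpose_in) auto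
  have sC: "?s ` insert b0 B = insert b B"
    using ab b0 image_transpose_notin[of b B b0] by auto
  have C': "insert b B \<subseteq> V" using ab A B by auto
  have u: "?u permutes V" "?u ` A = A" "?u ` insert b B = insert b B"
    using p ab b0 image_transpose_in[of a A b0] image_transpose_notin[of a "insert b B" b0] by auto
  have su: "sign_on (insert b B) ?u = 1"
  proof -
    have "sign_on (insert b B) ?u = sign_on (insert b B) id"
      using ab b0 by (intro sign_on_cong) (auto simp: Transposition.transpose_def)
    then show ?thesis by simp
  qed
  have "chi V A (insert b0 B) (tau a b0 \<circ> g \<circ> ?s) =
      chi V A (?s ` insert b0 B) (?s \<circ> (tau a b0 \<circ> g \<circ> ?s) \<circ> Hilbert_Choice.inv ?s)"
    by (rule chi_conjugate[symmetric]) (use C_subset p s g in \<open>auto intro!: permutes_compose\<close>)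
  also have "?s \<circ> (tau a b0 \<circ> g \<circ> ?s) \<circ> Hilbert_Choice.inv ?s = (?s \<circ> tau a b0) \<circ> g"
    by (simp add: fun_eq_iff inv_swap_id)
  also have "\<dots> = ?u \<circ> (tau a b \<circ> g)"
    unfolding transpose_product by (simp add: o_assoc)
  also have "chi V A (?s ` insert b0 B) \<dots> = chi V A (insert b B) (tau a b \<circ> g)"
    unfolding sC using chi_compose(2)[OF u C', of "tau a b \<circ> g"] su p g by (simp add: permutes_compose)
  finally show ?thesis .
qed

lemma cycle_kernel_eq:
  "g permutes V \<Longrightarrow> cycle_kernel B b0 g = (\<Sum>a\<in>A - B. \<Sum>b\<in>A - B. chi V A (insert b B) (tau a b \<circ> g))"
  unfolding cycle_kernel_def by (intro sum.cong refl chi_cycle_kernel_term)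

lemma cycle_kernel_id: "cycle_kernel B b0 id = card (A - B)"
proof -
  have "chi V A (insert b B) (tau a b \<circ> id) = (if b = a then 1 else 0)" if "a \<in> A - B" "b \<in> A - B" for a b
  proof -
    have "tau a b ` insert b B \<noteq> insert b B" if "a \<noteq> b"
    proof -
      have "a \<in> tau a b ` insert b B" by auto
      then show ?thesis using \<open>a \<in> A - B\<close> that by auto
    qed
    then show ?thesis by (auto simp: chi_def)
  qed
  then have "cycle_kernel B b0 id = (\<Sum>a\<in>A - B. \<Sum>b\<in>A - B. if b = a then 1 else 0)"
    unfolding cycle_kernel_eq[OF permutes_id] by (intro sum.cong refl) auto
  then show ?thesis using finite_A by simp
qed

text \<open>Swapping \<open>b0\<close> with a point of \<open>B\<close> preserves
  \<open>insert b0 B\<close> and is odd there, so \<open>chi\<close> has mean zero. Then the root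
  function has mean zero, and the sum of its correlations is the square of its sum.\<close>

lemma sum_cycle_kernel:
  assumes "B \<noteq> {}"
  shows "(\<Sum>g | g permutes V. cycle_kernel B b0 g) = 0"
proof -
  let ?c = "chi V A (insert b0 B)" and ?N = "\<Sum>y | y permutes V. (chi V A (insert b0 B) y)\<^sup>2"
  obtain d where d: "d \<in> B" using assms by blast
  have t: "tau d b0 permutes V" "tau d b0 ` A = A" "tau d b0 ` insert b0 B = insert b0 B"
    by (intro swap_permutes image_transpose_in; use d B b0 in auto)+
  have "(\<Sum>x | x permutes V. ?c x) = (\<Sum>x | x permutes V. ?c (tau d b0 \<circ> x))"
    by (rule sum_permutes_compose_left[OF t(1), symmetric])
  also have "sign_on (insert b0 B) (tau d b0) = - 1"
    by (rule sign_on_transpose) (use d b0 in auto)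
  then have "(\<Sum>x | x permutes V. ?c (tau d b0 \<circ> x)) = (\<Sum>x | x permutes V. - ?c x)"
    by (intro sum.cong refl) (simp add: chi_compose(2)[OF t C_subset])
  finally have "(\<Sum>x | x permutes V. ?c x) = 0" by (simp add: sum_negf)
  then have "(\<Sum>x | x permutes V. ?c (tau a b0 \<circ> x)) = 0" if "a \<in> A - B" for a
    using sum_permutes_compose_left[of "tau a b0" V ?c] swap_permutes[of a b0] that b0 by simp
  then have *: "(\<Sum>x | x permutes V. root_function B b0 x) = 0"
    unfolding root_function_def by (subst sum.swap) simp
  have "?N * (\<Sum>g | g permutes V. cycle_kernel B b0 g) =
      (\<Sum>g | g permutes V. \<Sum>x | x permutes V. root_function B b0 x * root_function B b0 (Hilbert_Choice.inv g \<circ> x))"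
    unfolding sum_distrib_left by (intro sum.cong refl) (simp add: root_function_correlation)
  also have "\<dots> = 0"
    unfolding sum_correlation * by simp
  finally show "(\<Sum>g | g permutes V. cycle_kernel B b0 g) = 0"
    using chi_norm_pos[of "insert b0 B"] by simp
qed

end

lemma image_transpose_compose_iff:
  assumes "a \<in> A" "b \<in> A"
  shows "(tau a b \<circ> g) ` A = A \<longleftrightarrow> g ` A = A"
proof -
  have "(tau a b \<circ> g) ` A = A \<longleftrightarrow> tau a b ` g ` A = tau a b ` A"
    using image_comp[of "tau a b" g A] image_transpose_in[OF assms] by simp
  also have "\<dots> \<longleftrightarrow> g ` A = A" by (rule inj_image_eq_iff) (simp add: bij_is_inj)
  finally show ?thesis .
qed

text \<open>For invariant \<open>A\<close> each \<open>b\<close> is matched by the single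
  \<open>a = g b\<close>. Since kernels with nonempty \<open>B\<close> have mean zero, these produce
  the limit \<open>1 / k\<close>.\<close>

lemma cycle_kernel_empty:
  assumes g: "g permutes V" and b0: "b0 \<in> A"
  shows "cycle_kernel {} b0 g = (if g ` A = A then card A else 0)"
proof -
  have c: "chi V A {b} (tau a b \<circ> g) = (if g ` A = A then if a = g b then 1 else 0 else 0)" if "a \<in> A" "b \<in> A" for a b
  proof -
    have "tau a b \<circ> g permutes V" using g that A by (intro permutes_compose permutes_swap_id) auto
    moreover have "tau a b (g b) = b \<longleftrightarrow> a = g b" by (auto simp: Transposition.transpose_def)
    moreover have "sign_on {b} (tau a b \<circ> g) = 1" if "a = g b"
    proof -
      have "sign_on {b} (tau a b \<circ> g) = sign_on {b} id" using that by (intro sign_on_cong) auto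
      then show ?thesis by simp
    qed
    ultimately show ?thesis
      using image_transpose_compose_iff[OF that, of g] by (auto simp: chi_def)
  qed
  have "cycle_kernel {} b0 g = (\<Sum>b\<in>A. \<Sum>a\<in>A. chi V A {b} (tau a b \<circ> g))"
    using cycle_kernel_eq[of "{}" b0 g] g b0 by (subst sum.swap) simp
  also have "\<dots> = (\<Sum>b\<in>A. if g ` A = A then 1 else 0)"
    by (intro sum.cong refl) (auto simp: c finite_A)
  finally show ?thesis by simp
qed

text \<open>After exchanging sums, each of the \<open>(card A)\<^sup>2\<close> pairs
  \<open>(a, b)\<close> is settled by \<open>sum_chi_subsets\<close> for
  \<open>tau a b \<circ> g\<close>: it contributes 1 exactly if multiplying back by
  \<open>tau a b\<close> yields a single cycle on \<open>A\<close>, that is, if \<open>g\<close>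
  acts on \<open>A\<close> as one cycle.\<close>

lemma alternating_sum_cycle_kernel:
  assumes g: "g permutes V" and b0: "\<And>B. B \<subset> A \<Longrightarrow> b0 B \<in> A - B"
  shows "(\<Sum>B\<in>Pow A - {A}. (- 1) ^ card B * cycle_kernel B (b0 B) g) = (if transitive_on g A then (real (card A))\<^sup>2 else 0)"
proof -
  let ?F = "\<lambda>B a b. (- 1) ^ card B * chi V A (insert b B) (tau a b \<circ> g)"
  have "(\<Sum>B\<in>Pow A - {A}. (- 1) ^ card B * cycle_kernel B (b0 B) g) = (\<Sum>B\<in>Pow A - {A}. \<Sum>a\<in>A - B. \<Sum>b\<in>A - B. ?F B a b)"
  proof (rule sum.cong[OF refl])
    fix B assume "B \<in> Pow A - {A}"
    then have "B \<subset> A" by auto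
    with b0[OF this] show "(- 1) ^ card B * cycle_kernel B (b0 B) g = (\<Sum>a\<in>A - B. \<Sum>b\<in>A - B. ?F B a b)"
      by (subst cycle_kernel_eq) (auto simp: g sum_distrib_left)
  qed
  also have "\<dots> = (\<Sum>B\<in>Pow A. \<Sum>a\<in>A - B. \<Sum>b\<in>A - B. ?F B a b)"
    using finite_A by (intro sum.mono_neutral_left) auto
  also have "\<dots> = (\<Sum>B\<in>Pow A. \<Sum>a\<in>A. \<Sum>b\<in>A. if B \<subseteq> A - {a, b} then ?F B a b else 0)"
  proof (rule sum.cong[OF refl])
    fix B assume "B \<in> Pow A"
    have "(\<Sum>a\<in>A - B. \<Sum>b\<in>A - B. ?F B a b) = (\<Sum>a\<in>A. if a \<in> A - B then \<Sum>b\<in>A - B. ?F B a b else 0)"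
      using finite_A by (intro sum.mono_neutral_cong_left) auto
    also have "\<dots> = (\<Sum>a\<in>A. \<Sum>b\<in>A. if B \<subseteq> A - {a, b} then ?F B a b else 0)"
    proof (rule sum.cong[OF refl])
      fix a assume "a \<in> A"
      show "(if a \<in> A - B then \<Sum>b\<in>A - B. ?F B a b else 0) = (\<Sum>b\<in>A. if B \<subseteq> A - {a, b} then ?F B a b else 0)"
      proof (cases "a \<in> B")
        case False
        then have "(\<Sum>b\<in>A - B. ?F B a b) = (\<Sum>b\<in>A. if B \<subseteq> A - {a, b} then ?F B a b else 0)"
          using finite_A \<open>B \<in> Pow A\<close> by (intro sum.mono_neutral_cong_left) auto
        then show ?thesis using False \<open>a \<in> A\<close> by simp
      next
        case True
        then have "(\<Sum>b\<in>A. if B \<subseteq> A - {a, b} then ?F B a b else 0) = 0" by (intro sum.neutral) auto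
        then show ?thesis using True by simp
      qed
    qed
    finally show "(\<Sum>a\<in>A - B. \<Sum>b\<in>A - B. ?F B a b) = (\<Sum>a\<in>A. \<Sum>b\<in>A. if B \<subseteq> A - {a, b} then ?F B a b else 0)" .
  qed
  also have "\<dots> = (\<Sum>a\<in>A. \<Sum>b\<in>A. \<Sum>B\<in>Pow A. if B \<subseteq> A - {a, b} then ?F B a b else 0)"
    by (rule sum_swap_double)
  also have "\<dots> = (\<Sum>a\<in>A. \<Sum>b\<in>A. if transitive_on g A then 1 else 0)"
  proof (intro sum.cong refl)
    fix a b assume ab: "a \<in> A" "b \<in> A"
    let ?h = "tau a b \<circ> g"
    have h: "?h permutes V" using g ab A by (intro permutes_compose permutes_swap_id) auto
    have "(\<Sum>B\<in>Pow A. if B \<subseteq> A - {a, b} then ?F B a b else 0) = (\<Sum>B\<in>Pow (A - {a, b}). ?F B a b)"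
      using finite_A by (intro sum.mono_neutral_cong_right) auto
    also have "\<dots> = (if transitive_on g A then 1 else 0)"
    proof (cases "g ` A = A")
      case True
      have inj: "inj g" using g by (rule permutes_inj)
      have "transitive_on g A \<longleftrightarrow> no_cycle_avoiding ?h A {a, b} \<and> (a = b \<or> separates ?h A a b)"
      proof (cases "a = b")
        case True
        then show ?thesis
          using transitive_on_iff[OF inj \<open>g ` A = A\<close> ab] by (auto simp: separates_def)
      next
        case False
        then show ?thesis
          using transitive_on_transpose[OF finite_A inj True ab False] by simp
      qed
      then show ?thesis
        using sum_chi_subsets[OF V A h _ ab] image_transpose_compose_iff[OF ab, of g] True by simp
    next
      case False
      then have "chi V A C ?h = 0" for C
        using image_transpose_compose_iff[OF ab, of g] by (simp add: chi_def)
      then show ?thesis using False by (simp add: transitive_on_def)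
    qed
    finally show "(\<Sum>B\<in>Pow A. if B \<subseteq> A - {a, b} then ?F B a b else 0) = (if transitive_on g A then 1 else 0)" .
  qed
  also have "\<dots> = (if transitive_on g A then (real (card A))\<^sup>2 else 0)"
    by (simp add: power2_eq_square)
  finally show ?thesis .
qed

end

section \<open>Invariant sets of a uniform permutation\<close>

lemma ex_permutes_image:
  assumes "finite V" "A \<subseteq> V" "A' \<subseteq> V" "card A = card A'"
  shows "\<exists>p. p permutes V \<and> p ` A = A'"
proof -
  have fin: "finite A" "finite A'" using assms finite_subset by auto
  obtain f where f: "bij_betw f A A'" using finite_same_card_bij[OF fin assms(4)] by blast
  have "card (V - A) = card (V - A')" using assms fin by (simp add: card_Diff_subset)
  then obtain h where h: "bij_betw h (V - A) (V - A')"
    using finite_same_card_bij[of "V - A" "V - A'"] assms(1) by auto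
  define p where "p = (\<lambda>x. if x \<in> A then f x else if x \<in> V then h x else x)"
  have "bij_betw p (A \<union> (V - A)) (A' \<union> (V - A'))"
  proof (rule bij_betw_combine)
    show "bij_betw p A A'" using f by (subst bij_betw_cong[of A p f]) (auto simp: p_def)
    show "bij_betw p (V - A) (V - A')" using h by (subst bij_betw_cong[of _ p h]) (auto simp: p_def)
  qed auto
  moreover have "A \<union> (V - A) = V" "A' \<union> (V - A') = V" using assms by auto
  ultimately have "p permutes V"
    using assms(2) by (intro bij_imp_permutes) (auto simp: p_def)
  moreover have "p ` A = A'" using f by (auto simp: p_def bij_betw_def)
  ultimately show ?thesis by blast
qed

text \<open>A uniform permutation takes a \<open>k\<close>-set to every \<open>k\<close>-set with
  the same probability, so the number of invariant \<open>k\<close>-sets is 1 on average.\<close>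

lemma sum_card_invariant:
  assumes V: "finite V" and k: "k \<le> card V"
  shows "(\<Sum>A | A \<subseteq> V \<and> card A = k. \<Sum>g | g permutes V. if g ` A = A then 1 else 0 :: real) = fact (card V)"
proof -
  let ?P = "{A. A \<subseteq> V \<and> card A = k}"
  define N :: "_ \<Rightarrow> _ \<Rightarrow> real" where "N = (\<lambda>A A'. \<Sum>g | g permutes V. if g ` A = A' then 1 else 0)"
  have finP: "finite ?P" using V by simp
  have eq: "N A A' = N A A" if AA: "A \<in> ?P" "A' \<in> ?P" for A A'
  proof -
    obtain p where p: "p permutes V" "p ` A = A'"
      using ex_permutes_image[OF V, of A A'] AA by auto
    have "N A A = (\<Sum>g | g permutes V. if (p \<circ> g) ` A = A' then 1 else 0)"
      unfolding N_def
    proof (intro sum.cong refl)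
      fix g
      have "(p \<circ> g) ` A = A' \<longleftrightarrow> p ` g ` A = p ` A" using p(2) image_comp[of p g A] by simp
      then show "(if g ` A = A then 1 else 0 :: real) = (if (p \<circ> g) ` A = A' then 1 else 0)"
        using permutes_inj[OF p(1)] by (simp add: inj_image_eq_iff)
    qed
    also have "\<dots> = N A A'"
      unfolding N_def by (rule sum_permutes_compose_left[OF p(1), of "\<lambda>g. if g ` A = A' then 1 else 0"])
    finally show ?thesis ..
  qed
  have row: "(\<Sum>A'\<in>?P. N A A') = fact (card V)" if "A \<in> ?P" for A
  proof -
    have "(\<Sum>A'\<in>?P. N A A') = (\<Sum>g | g permutes V. \<Sum>A'\<in>?P. if g ` A = A' then 1 else 0)"
      unfolding N_def by (rule sum.swap)
    also have "\<dots> = (\<Sum>g | g permutes V. 1)"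
    proof (intro sum.cong refl)
      fix g assume "g \<in> {g. g permutes V}"
      then have g: "g permutes V" by simp
      have "g ` A \<in> ?P"
        using that g permutes_image[OF g] permutes_inj_on[OF g, of A] by (auto simp: card_image)
      then show "(\<Sum>A'\<in>?P. if g ` A = A' then 1 else 0 :: real) = 1" using finP by simp
    qed
    finally show ?thesis using V by (simp add: card_permutations)
  qed
  have diag: "real (card ?P) * N A A = fact (card V)" if "A \<in> ?P" for A
    using row[OF that] eq[OF that] by simp
  have "card ?P > 0" using k by (simp add: n_subsets V)
  then have "N A A = fact (card V) / real (card ?P)" if "A \<in> ?P" for A
    using diag[OF that] by (simp add: field_simps)
  then have "(\<Sum>A\<in>?P. N A A) = fact (card V)"
    using \<open>card ?P > 0\<close> by simp
  then show ?thesis by (simp add: N_def)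
qed

section \<open>The second eigenvalue of the Laplacian\<close>

text \<open>The graph Laplacian with weights \<open>c\<close>, applied to \<open>u\<close>, at the
  vertex \<open>x\<close>.\<close>

definition inner_form :: "('a \<Rightarrow> 'a \<Rightarrow> real) \<Rightarrow> 'a set \<Rightarrow> ('a \<Rightarrow> real) \<Rightarrow> 'a \<Rightarrow> real" where
  "inner_form c V u x = (\<Sum>y\<in>V. c x y * (u x - u y))"

lemma sum_inner_form:
  assumes sym: "\<And>x y. c x y = c y x"
  shows "(\<Sum>x\<in>V. v x * inner_form c V u x) = (\<Sum>x\<in>V. \<Sum>y\<in>V. c x y * (v x - v y) * (u x - u y)) / 2"
proof -
  let ?S = "\<Sum>x\<in>V. \<Sum>y\<in>V. c x y * v x * (u x - u y)"
  have "?S = (\<Sum>x\<in>V. \<Sum>y\<in>V. c x y * v y * (u y - u x))"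
    by (rule trans[OF sum.swap]) (simp add: sym)
  then have "?S + ?S = (\<Sum>x\<in>V. \<Sum>y\<in>V. c x y * v x * (u x - u y) + c x y * v y * (u y - u x))"
    by (simp add: sum.distrib)
  also have "\<dots> = (\<Sum>x\<in>V. \<Sum>y\<in>V. c x y * (v x - v y) * (u x - u y))"
    by (intro sum.cong refl) (simp add: algebra_simps)
  finally have "?S = (\<Sum>x\<in>V. \<Sum>y\<in>V. c x y * (v x - v y) * (u x - u y)) / 2" by simp
  moreover have "(\<Sum>x\<in>V. v x * inner_form c V u x) = ?S"
    unfolding inner_form_def sum_distrib_left by (simp add: mult_ac)
  ultimately show ?thesis by simp
qed

lemma graph_form_add:
  assumes sym: "\<And>x y. c x y = c y x"
  shows "graph_form c V (\<lambda>x. u x + e * v x) =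
    graph_form c V u + 4 * e * (\<Sum>x\<in>V. v x * inner_form c V u x) + e\<^sup>2 * graph_form c V v"
proof -
  have "graph_form c V (\<lambda>x. u x + e * v x) = (\<Sum>x\<in>V. \<Sum>y\<in>V. c x y * (u x - u y)\<^sup>2 +
      2 * e * (c x y * (v x - v y) * (u x - u y)) + e\<^sup>2 * (c x y * (v x - v y)\<^sup>2))"
    unfolding graph_form_def by (intro sum.cong refl) (simp add: power2_eq_square algebra_simps)
  then show ?thesis
    unfolding sum_inner_form[OF sym] graph_form_def by (simp add: sum.distrib sum_distrib_left[symmetric])
qed

section \<open>The minimiser of the Rayleigh quotient\<close>

lemma compact_box: "compact {u :: 'a \<Rightarrow> real. \<forall>x. u x \<in> (if x \<in> V then {-1..1} else {0})}"
proof -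
  have "compactin (product_topology (\<lambda>_. euclidean) UNIV) (PiE UNIV (\<lambda>x. if x \<in> V then {-1..1} else {0 :: real}))"
    by (subst compactin_PiE) auto
  then show ?thesis
    by (simp add: euclidean_product_topology compactin_euclidean_iff PiE_def Pi_def extensional_def)
qed

text \<open>Compactness of the unit sphere of mean-zero functions gives a minimiser, and the first
  variation makes it an eigenfunction of the Laplacian, so its eigenvalue can be compared with the
  listed ones.\<close>

lemma ex_rayleigh_minimiser:
  assumes V: "finite V" "x0 \<in> V" "y0 \<in> V" "x0 \<noteq> y0" and sym: "\<And>x y. c x y = c y x"
  obtains h \<mu> where "(\<Sum>x\<in>V. h x) = 0" "(\<Sum>x\<in>V. (h x)\<^sup>2) = 1"
    "\<And>x. x \<in> V \<Longrightarrow> inner_form c V h x = \<mu> * h x"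
    "\<And>u. (\<Sum>x\<in>V. u x) = 0 \<Longrightarrow> 2 * \<mu> * (\<Sum>x\<in>V. (u x)\<^sup>2) \<le> graph_form c V u"
proof -
  define S where "S = {u :: 'a \<Rightarrow> real. \<forall>x. u x \<in> (if x \<in> V then {-1..1} else {0})} \<inter>
    ({u. (\<Sum>x\<in>V. u x) = 0} \<inter> {u. (\<Sum>x\<in>V. (u x)\<^sup>2) = 1})"
  have cont: "continuous_on A (\<lambda>u :: 'a \<Rightarrow> real. u x)" for A x
    using continuous_on_product_coordinates by (rule continuous_on_subset) simp
  have "closed {u :: 'a \<Rightarrow> real. (\<Sum>x\<in>V. u x) = 0}" "closed {u :: 'a \<Rightarrow> real. (\<Sum>x\<in>V. (u x)\<^sup>2) = 1}"
    by (intro closed_Collect_eq continuous_intros cont)+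
  then have "compact S"
    unfolding S_def by (intro compact_Int_closed compact_box closed_Int)
  have norm_S: "\<bar>u x\<bar> \<le> 1" if "(\<Sum>x\<in>V. (u x)\<^sup>2) = 1" "x \<in> V" for u :: "'a \<Rightarrow> real" and x
  proof -
    have "(u x)\<^sup>2 \<le> (\<Sum>x\<in>V. (u x)\<^sup>2)" using V(1) that(2) by (intro member_le_sum) auto
    then show ?thesis using that(1) by (simp add: abs_square_le_1)
  qed
  have in_S: "(\<lambda>x. if x \<in> V then u x else 0) \<in> S" if "(\<Sum>x\<in>V. u x) = 0" "(\<Sum>x\<in>V. (u x)\<^sup>2) = 1" for u :: "'a \<Rightarrow> real"
    using that norm_S[of u] unfolding S_def by (auto simp: abs_le_iff minus_le_iff)
  \<comment> \<open>Mass one half at each of two points, with opposite signs, satisfies both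
    constraints; \<open>x0 \<noteq> y0\<close> thus makes \<open>S\<close> nonempty.\<close>
  define w where "w = (\<lambda>x. (if x = x0 then 1 / sqrt 2 else 0) - (if x = y0 then 1 / sqrt 2 else 0))"
  have "(\<Sum>x\<in>V. w x) = 0" using V by (simp add: w_def sum_subtractf)
  moreover have "(\<Sum>x\<in>V. (w x)\<^sup>2) = (\<Sum>x\<in>V. (if x = x0 then 1 / 2 else 0) + (if x = y0 then 1 / 2 else 0))"
    using V(4) by (intro sum.cong refl) (auto simp: w_def power_divide)
  then have "(\<Sum>x\<in>V. (w x)\<^sup>2) = 1" using V by (simp add: sum.distrib)
  ultimately have "S \<noteq> {}" using in_S by blast
  have "continuous_on S (graph_form c V)"
    unfolding graph_form_def by (intro continuous_intros cont)
  then obtain h where h: "h \<in> S" "\<And>u. u \<in> S \<Longrightarrow> graph_form c V h \<le> graph_form c V u"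
    using continuous_attains_inf[OF \<open>compact S\<close> \<open>S \<noteq> {}\<close>] by blast
  have hS: "(\<Sum>x\<in>V. h x) = 0" "(\<Sum>x\<in>V. (h x)\<^sup>2) = 1" using h(1) by (auto simp: S_def)
  define q where "q = graph_form c V h"
  have min: "q * (\<Sum>x\<in>V. (u x)\<^sup>2) \<le> graph_form c V u" if u: "(\<Sum>x\<in>V. u x) = 0" for u
  proof (cases "(\<Sum>x\<in>V. (u x)\<^sup>2) = 0")
    case True
    then have "u x = 0" if "x \<in> V" for x using that V(1) by (simp add: sum_nonneg_eq_0_iff)
    then show ?thesis by (simp add: graph_form_def)
  next
    case False
    define s where "s = sqrt (\<Sum>x\<in>V. (u x)\<^sup>2)"
    have s: "s > 0" "s\<^sup>2 = (\<Sum>x\<in>V. (u x)\<^sup>2)"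
      using False by (auto simp: s_def sum_nonneg order_less_le)
    let ?v = "\<lambda>x. u x / s"
    have "(\<Sum>x\<in>V. ?v x) = 0" using u by (simp add: sum_divide_distrib[symmetric])
    moreover have "(\<Sum>x\<in>V. (?v x)\<^sup>2) = 1"
      using s False by (simp add: power_divide sum_divide_distrib[symmetric])
    ultimately have "q \<le> graph_form c V (\<lambda>x. if x \<in> V then ?v x else 0)"
      unfolding q_def by (intro h(2) in_S)
    also have "\<dots> = graph_form c V u / s\<^sup>2"
      by (simp add: graph_form_def sum_divide_distrib diff_divide_distrib[symmetric] power_divide)
    finally have "q * s\<^sup>2 \<le> graph_form c V u" using s(1) by (simp add: pos_le_divide_eq)
    then show ?thesis by (simp add: s(2))
  qed
  \<comment> \<open>The residual of the eigenvalue equation is the direction of variation. It has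
    mean zero itself, so the constraint brings in no further multiplier.\<close>
  define w where "w = (\<lambda>x. 2 * inner_form c V h x - q * h x)"
  have "(\<Sum>x\<in>V. inner_form c V h x) = 0"
    using sum_inner_form[OF sym, where v = "\<lambda>_. 1" and u = h and V = V] by simp
  then have w0: "(\<Sum>x\<in>V. w x) = 0"
    using hS by (simp add: w_def sum_subtractf sum_distrib_left[symmetric])
  define b where "b = (\<Sum>x\<in>V. (w x)\<^sup>2)"
  define d where "d = graph_form c V w - q * b"
  have d: "0 \<le> d" using min[OF w0] by (simp add: d_def b_def)
  have var: "0 \<le> 2 * e * b + e\<^sup>2 * d" for e
  proof -
    have "(\<Sum>x\<in>V. h x + e * w x) = 0"
      using hS w0 by (simp add: sum.distrib sum_distrib_left[symmetric])
    from min[OF this] have "q * (\<Sum>x\<in>V. (h x + e * w x)\<^sup>2) \<le>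
        q + 4 * e * (\<Sum>x\<in>V. w x * inner_form c V h x) + e\<^sup>2 * graph_form c V w"
      unfolding graph_form_add[OF sym] q_def .
    also have "(\<Sum>x\<in>V. (h x + e * w x)\<^sup>2) = (\<Sum>x\<in>V. (h x)\<^sup>2 + 2 * e * (w x * h x) + e\<^sup>2 * (w x)\<^sup>2)"
      by (intro sum.cong refl) (simp add: power2_eq_square algebra_simps)
    also have "\<dots> = 1 + 2 * e * (\<Sum>x\<in>V. w x * h x) + e\<^sup>2 * b"
      using hS by (simp add: sum.distrib sum_distrib_left[symmetric] b_def)
    finally have 1: "q * (1 + 2 * e * (\<Sum>x\<in>V. w x * h x) + e\<^sup>2 * b) \<le>
        q + 4 * e * (\<Sum>x\<in>V. w x * inner_form c V h x) + e\<^sup>2 * graph_form c V w" .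
    have "b = (\<Sum>x\<in>V. 2 * (w x * inner_form c V h x) - q * (w x * h x))"
      unfolding b_def by (intro sum.cong refl) (simp add: w_def power2_eq_square algebra_simps)
    then have "b = 2 * (\<Sum>x\<in>V. w x * inner_form c V h x) - q * (\<Sum>x\<in>V. w x * h x)"
      by (simp add: sum_subtractf sum_distrib_left[symmetric])
    then have "2 * e * b = 2 * e * (2 * (\<Sum>x\<in>V. w x * inner_form c V h x) - q * (\<Sum>x\<in>V. w x * h x))"
      by (rule arg_cong)
    also have "\<dots> = 4 * e * (\<Sum>x\<in>V. w x * inner_form c V h x) - q * (2 * e * (\<Sum>x\<in>V. w x * h x))"
      by (simp add: algebra_simps)
    finally show ?thesis using 1 by (simp add: d_def algebra_simps)
  qed
  have "b = 0"
  proof -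
    \<comment> \<open>With \<open>e = - r\<close> the expansion becomes
      \<open>- (r\<^sup>2 * (d + 2))\<close>; the \<open>+ 1\<close> keeps the denominator positive
      when \<open>d = 0\<close>.\<close>
    define r where "r = b / (d + 1)"
    have b: "b = r * (d + 1)" using d by (simp add: r_def)
    have "2 * (- r) * b + (- r)\<^sup>2 * d = - (r\<^sup>2 * (d + 2))"
      unfolding b by (simp add: power2_eq_square algebra_simps)
    then have "r\<^sup>2 * (d + 2) \<le> 0" using var[of "- r"] by simp
    then show ?thesis using d b by (simp add: mult_le_0_iff)
  qed
  then have w: "w x = 0" if "x \<in> V" for x
    using that V(1) by (simp add: b_def sum_nonneg_eq_0_iff)
  have "inner_form c V h x = q / 2 * h x" if "x \<in> V" for x
    using w[OF that] by (simp add: w_def)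
  moreover have "2 * (q / 2) * (\<Sum>x\<in>V. (u x)\<^sup>2) \<le> graph_form c V u" if "(\<Sum>x\<in>V. u x) = 0" for u
    using min[OF that] by simp
  ultimately show thesis using that[OF hS, of "q / 2"] by blast
qed

text \<open>Vanishing on the diagonal and off the vertex set makes symmetry and nonnegativity hold
  for all arguments, as \<open>interchange_gap\<close> asks.\<close>

definition weight :: "nat \<Rightarrow> (nat \<Rightarrow> nat \<Rightarrow> real) \<Rightarrow> nat \<Rightarrow> nat \<Rightarrow> real" where
  "weight n a x y = (if x \<noteq> y \<and> x \<in> {1..n} \<and> y \<in> {1..n} then edge_weight a x y else 0)"

lemma weight_sym: "weight n a x y = weight n a y x"
  by (auto simp: weight_def edge_weight_def)

lemma laplacian_mult_vec:
  assumes i: "i < n"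
  shows "(laplacian n a *\<^sub>v vec n (\<lambda>j. h (j + 1))) $ i = inner_form (weight n a) {1..n} h (i + 1)"
proof -
  let ?w = "edge_weight a (i + 1)"
  have shift: "(\<Sum>j<n. F (j + 1)) = (\<Sum>y\<in>{1..n}. F y)" for F :: "nat \<Rightarrow> real"
    by (rule sum.reindex_bij_witness[of _ "\<lambda>y. y - 1" "\<lambda>j. j + 1"]) auto
  have "(laplacian n a *\<^sub>v vec n (\<lambda>j. h (j + 1))) $ i =
      (\<Sum>j<n. (if i + 1 = j + 1 then \<Sum>k\<in>{1..n} - {i + 1}. ?w k else - ?w (j + 1)) * h (j + 1))"
    using i by (simp add: laplacian_def scalar_prod_def atLeast0LessThan)
  also have "\<dots> = (\<Sum>y\<in>{1..n}. (if i + 1 = y then \<Sum>k\<in>{1..n} - {i + 1}. ?w k else - ?w y) * h y)"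
    by (rule shift)
  also have "\<dots> = (\<Sum>k\<in>{1..n} - {i + 1}. ?w k) * h (i + 1) + (\<Sum>y\<in>{1..n} - {i + 1}. - ?w y * h y)"
    using i by (subst sum.remove[of _ "i + 1"]) auto
  also have "\<dots> = (\<Sum>y\<in>{1..n} - {i + 1}. ?w y * (h (i + 1) - h y))"
    unfolding sum_distrib_right sum.distrib[symmetric] by (intro sum.cong refl) (simp add: algebra_simps)
  also have "\<dots> = (\<Sum>y\<in>{1..n} - {i + 1}. weight n a (i + 1) y * (h (i + 1) - h y))"
    using i by (intro sum.cong refl) (auto simp: weight_def)
  also have "\<dots> = inner_form (weight n a) {1..n} h (i + 1)"
    unfolding inner_form_def by (intro sum.mono_neutral_left) auto
  finally show ?thesis .
qed

lemma laplacian_carrier [simp]: "laplacian n a \<in> carrier_mat n n"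
  by (simp add: laplacian_def)

lemma laplacian_eigenvalue:
  assumes "\<And>x. x \<in> {1..n} \<Longrightarrow> inner_form (weight n a) {1..n} h x = \<mu> * h x" "x \<in> {1..n}" "h x \<noteq> 0"
  shows "poly (char_poly (laplacian n a)) \<mu> = 0"
proof -
  let ?v = "vec n (\<lambda>j. h (j + 1))"
  have "?v $ (x - 1) \<noteq> 0\<^sub>v n $ (x - 1)" using assms(2,3) by auto
  then have "?v \<noteq> 0\<^sub>v n" by metis
  moreover have "laplacian n a *\<^sub>v ?v = \<mu> \<cdot>\<^sub>v ?v"
  proof (rule eq_vecI)
    fix i assume "i < dim_vec (\<mu> \<cdot>\<^sub>v ?v)"
    then have i: "i < n" by simp
    then show "(laplacian n a *\<^sub>v ?v) $ i = (\<mu> \<cdot>\<^sub>v ?v) $ i"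
      using laplacian_mult_vec[OF i, of a h] assms(1)[of "i + 1"] by simp
  qed (simp add: laplacian_def)
  moreover have "dim_row (laplacian n a) = n" by (simp add: laplacian_def)
  ultimately have "eigenvector (laplacian n a) ?v \<mu>"
    unfolding eigenvector_def by simp
  then have "eigenvalue (laplacian n a) \<mu>" unfolding eigenvalue_def by blast
  then show ?thesis by (simp add: eigenvalue_root_char_poly[OF laplacian_carrier])
qed

text \<open>
  A non-constant harmonic function makes \<open>0\<close> a multiple root: shifted to vanish at a vertex, it is in
  the kernel of the corresponding principal minor.
\<close>

lemma pderiv_char_poly_laplacian:
  assumes h: "\<And>x. x \<in> {1..n} \<Longrightarrow> inner_form (weight n a) {1..n} h x = 0"
    and nc: "x \<in> {1..n}" "y \<in> {1..n}" "h x \<noteq> h y"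
  shows "poly (pderiv (char_poly (laplacian n a))) 0 = 0"
proof -
  let ?L = "laplacian n a"
  have "poly (char_poly (mat_delete ?L i i)) 0 = 0" if i: "i < n" for i
  proof -
    define v where "v = (\<lambda>z. h z - h (i + 1))"
    have v0: "v (i + 1) = 0" by (simp add: v_def)
    have iv: "inner_form (weight n a) {1..n} v z = inner_form (weight n a) {1..n} h z" for z
      by (simp add: inner_form_def v_def)
    let ?u = "vec (n - 1) (\<lambda>j. v (insert_index i j + 1))"
    obtain z where z: "z \<in> {1..n}" "v z \<noteq> 0"
      using nc by (cases "h x = h (i + 1)") (auto simp: v_def)
    have L: "mat_delete ?L i i \<in> carrier_mat (n - 1) (n - 1)"
      using mat_delete_carrier[OF laplacian_carrier] by simp
    have img: "insert_index i ` {0..<n - 1} = {0..<n} - {i}"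
      using insert_index_image[of i "n - 1"] i by simp
    have "z - 1 \<in> {0..<n} - {i}" using z v0 by (cases "z = i + 1") auto
    then have "z - 1 \<in> insert_index i ` {0..<n - 1}" by (simp only: img)
    then obtain j where j: "j < n - 1" "insert_index i j = z - 1" by auto
    have "?u $ j \<noteq> 0\<^sub>v (n - 1) $ j" using j z by auto
    then have "?u \<noteq> 0\<^sub>v (n - 1)" by metis
    moreover have "mat_delete ?L i i *\<^sub>v ?u = 0 \<cdot>\<^sub>v ?u"
    proof (rule eq_vecI)
      fix k assume "k < dim_vec (0 \<cdot>\<^sub>v ?u)"
      then have k: "k < n - 1" by simp
      let ?k = "insert_index i k"
      have k': "?k < n" using img k by (metis Diff_iff atLeastLessThan_iff image_eqI zero_le)
      have idx: "mat_delete ?L i i $$ (k, j) = ?L $$ (?k, insert_index i j)" if "j < n - 1" for j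
        using that k i by (simp add: mat_delete_def laplacian_def insert_index_def)
      have "(mat_delete ?L i i *\<^sub>v ?u) $ k = (\<Sum>j\<in>{0..<n - 1}. mat_delete ?L i i $$ (k, j) * ?u $ j)"
        using k carrier_matD[OF L] by (simp add: scalar_prod_def)
      also have "\<dots> = (\<Sum>j\<in>{0..<n - 1}. ?L $$ (?k, insert_index i j) * v (insert_index i j + 1))"
        by (intro sum.cong refl) (simp add: idx)
      also have "\<dots> = (\<Sum>j\<in>{0..<n} - {i}. ?L $$ (?k, j) * v (j + 1))"
        unfolding img[symmetric] by (subst sum.reindex) (auto simp: insert_index_inj_on)
      also have "\<dots> = (\<Sum>j\<in>{0..<n}. ?L $$ (?k, j) * v (j + 1))"
        using v0 by (intro sum.mono_neutral_left) auto
      also have "\<dots> = (?L *\<^sub>v vec n (\<lambda>j. v (j + 1))) $ ?k"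
        using k' carrier_matD[OF laplacian_carrier[of n a]] by (simp add: scalar_prod_def)
      also have "\<dots> = 0"
        using laplacian_mult_vec[OF k', of a v] iv h[of "?k + 1"] k' by simp
      finally show "(mat_delete ?L i i *\<^sub>v ?u) $ k = (0 \<cdot>\<^sub>v ?u) $ k" using k by simp
    qed (use carrier_matD[OF L] in simp)
    ultimately have "eigenvector (mat_delete ?L i i) ?u 0"
      unfolding eigenvector_def by (simp add: laplacian_def)
    then have "eigenvalue (mat_delete ?L i i) 0" unfolding eigenvalue_def by blast
    then show ?thesis by (simp add: eigenvalue_root_char_poly[OF L])
  qed
  then show ?thesis by (simp add: pderiv_char_poly[OF laplacian_carrier] poly_sum)
qed

text \<open>The minimum \<open>\<mu>\<close> is one of the listed eigenvalues, and only
  \<open>\<mu> = lam 0\<close> could lie below \<open>lam 1\<close>. In that case the minimiser is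
  harmonic and, having mean zero and norm 1, not constant; so 0 is a multiple root, some later
  \<open>lam j\<close> is 0, and \<open>lam 1 \<le> 0\<close> follows.\<close>

lemma laplacian_gap:
  fixes lam :: "nat \<Rightarrow> real"
  assumes n: "2 \<le> n" and cp: "char_poly (laplacian n a) = (\<Prod>i<n. [:- lam i, 1:])"
    and lam0: "lam 0 = 0" and mono: "\<And>i. Suc i < n \<Longrightarrow> lam i \<le> lam (Suc i)"
    and u: "(\<Sum>x\<in>{1..n}. u x) = 0"
  shows "2 * lam 1 * (\<Sum>x\<in>{1..n}. (u x)\<^sup>2) \<le> graph_form (weight n a) {1..n} u"
proof -
  let ?c = "weight n a"
  obtain h \<mu> where h: "(\<Sum>x\<in>{1..n}. h x) = 0" "(\<Sum>x\<in>{1..n}. (h x)\<^sup>2) = 1"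
    and eig: "\<And>x. x \<in> {1..n} \<Longrightarrow> inner_form ?c {1..n} h x = \<mu> * h x"
    and min: "\<And>u. (\<Sum>x\<in>{1..n}. u x) = 0 \<Longrightarrow> 2 * \<mu> * (\<Sum>x\<in>{1..n}. (u x)\<^sup>2) \<le> graph_form ?c {1..n} u"
    by (rule ex_rayleigh_minimiser[of "{1..n}" 1 2 ?c]) (use n weight_sym in auto)
  have le: "lam 1 \<le> lam i" if "1 \<le> i" "i < n" for i
    using that
  proof (induction i rule: dec_induct)
    case (step i)
    then show ?case using mono[of i] by simp
  qed simp
  have "\<exists>x\<in>{1..n}. h x \<noteq> 0" using h(2) by (metis (mono_tags, lifting) power_zero_numeral sum.neutral zero_neq_one)
  then obtain x where x: "x \<in> {1..n}" "h x \<noteq> 0" by blast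
  have "poly (\<Prod>i<n. [:- lam i, 1:]) \<mu> = 0"
    using laplacian_eigenvalue[OF eig x] by (simp add: cp)
  then obtain i where i: "i < n" "\<mu> = lam i" by (auto simp: poly_prod)
  have "lam 1 \<le> \<mu>"
  proof (cases "i = 0")
    case True
    then have "\<mu> = 0" using i lam0 by simp
    have "\<exists>y\<in>{1..n}. h y \<noteq> h x"
    proof (rule ccontr)
      assume "\<not> ?thesis"
      then have "(\<Sum>y\<in>{1..n}. h y) = (\<Sum>y\<in>{1..n}. h x)" by (intro sum.cong) auto
      then show False using h(1) x n by simp
    qed
    then have "poly (pderiv (char_poly (laplacian n a))) 0 = 0"
      using pderiv_char_poly_laplacian[of n a h _ x] eig \<open>\<mu> = 0\<close> x by auto
    moreover have "{..<n} = insert 0 {1..<n}" using n by auto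
    then have "char_poly (laplacian n a) = [:0, 1:] * (\<Prod>i\<in>{1..<n}. [:- lam i, 1:])"
      by (simp add: cp lam0)
    ultimately have "(\<Prod>i\<in>{1..<n}. - lam i) = 0"
      by (simp add: pderiv_mult pderiv_pCons poly_prod)
    then obtain j where "j \<in> {1..<n}" "lam j = 0" by auto
    then show ?thesis using le[of j] \<open>\<mu> = 0\<close> by simp
  next
    case False
    then show ?thesis using le[of i] i by simp
  qed
  then have "2 * lam 1 * (\<Sum>x\<in>{1..n}. (u x)\<^sup>2) \<le> 2 * \<mu> * (\<Sum>x\<in>{1..n}. (u x)\<^sup>2)"
    by (intro mult_right_mono) (auto simp: sum_nonneg)
  also have "\<dots> \<le> graph_form ?c {1..n} u" using u by (rule min)
  finally show ?thesis .
qed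

section \<open>Decay along the process\<close>

lemma sum_weight:
  assumes sym: "\<And>x y. F x y = (F y x :: real)"
  shows "(\<Sum>x\<in>{1..n}. \<Sum>y\<in>{1..n}. weight n a x y * F x y) = 2 * (\<Sum>(i, j)\<in>vertex_pairs n. a i j * F i j)"
proof -
  let ?G = "\<lambda>(x, y). weight n a x y * F x y"
  have "(\<Sum>x\<in>{1..n}. \<Sum>y\<in>{1..n}. weight n a x y * F x y) = (\<Sum>p\<in>{1..n} \<times> {1..n}. ?G p)"
    by (simp add: sum.cartesian_product)
  also have "\<dots> = (\<Sum>p\<in>vertex_pairs n \<union> prod.swap ` vertex_pairs n. ?G p)"
  proof (rule sum.mono_neutral_right)
    show "vertex_pairs n \<union> prod.swap ` vertex_pairs n \<subseteq> {1..n} \<times> {1..n}"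
      by (auto simp: vertex_pairs_def)
    show "\<forall>p\<in>{1..n} \<times> {1..n} - (vertex_pairs n \<union> prod.swap ` vertex_pairs n). ?G p = 0"
    proof
      fix p assume p: "p \<in> {1..n} \<times> {1..n} - (vertex_pairs n \<union> prod.swap ` vertex_pairs n)"
      obtain x y where xy: "p = (x, y)" by fastforce
      have "x = y"
      proof (rule ccontr)
        assume "x \<noteq> y"
        then have "(x, y) \<in> vertex_pairs n \<or> (y, x) \<in> vertex_pairs n"
          using p by (auto simp: vertex_pairs_def xy)
        then show False using p by (force simp: xy)
      qed
      then show "?G p = 0" by (simp add: weight_def xy)
    qed
  qed auto
  also have "\<dots> = (\<Sum>p\<in>vertex_pairs n. ?G p) + (\<Sum>p\<in>prod.swap ` vertex_pairs n. ?G p)"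
    by (rule sum.union_disjoint) (simp, simp, auto simp: vertex_pairs_def)
  also have "(\<Sum>p\<in>prod.swap ` vertex_pairs n. ?G p) = (\<Sum>p\<in>vertex_pairs n. ?G p)"
    by (subst sum.reindex) (auto intro!: sum.cong simp: weight_sym[of n a] sym)
  also have "(\<Sum>p\<in>vertex_pairs n. ?G p) = (\<Sum>(i, j)\<in>vertex_pairs n. a i j * F i j)"
    by (intro sum.cong refl) (auto simp: weight_def vertex_pairs_def edge_weight_def)
  finally show ?thesis by simp
qed

locale interchange_process =
  fixes n :: nat and a :: "nat \<Rightarrow> nat \<Rightarrow> real"
  assumes rates: "\<And>i j. (i, j) \<in> vertex_pairs n \<Longrightarrow> 0 \<le> a i j"
begin

abbreviation vertices :: "nat set" where
  "vertices \<equiv> {1..n}"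

abbreviation perms :: "(nat \<Rightarrow> nat) set" where
  "perms \<equiv> {g. g permutes vertices}"

definition law :: "real \<Rightarrow> (nat \<Rightarrow> nat) \<Rightarrow> real" where
  "law t g = pmf (interchange_pmf n a t) g"

lemma finite_perms: "finite perms"
  by (simp add: finite_permutations)

lemma set_interchange_pmf:
  assumes t: "0 \<le> t"
  shows "set_pmf (interchange_pmf n a t) \<subseteq> perms"
proof -
  have "pmf (interchange_pmf n a t) g = 0" if "\<not> g permutes vertices" for g
  proof -
    have "pmf (interchange_pmf n a t) g = gr_exp n (\<lambda>g. - t * interchange_Delta n a g) g"
      by (rule pmf_interchange[OF rates t])
    also have "\<dots> = 0" using that by (rule gr_exp_interchange_outside)
    finally show ?thesis .
  qed
  then show ?thesis by (auto simp: set_pmf_eq)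
qed

lemma sum_law: "0 \<le> t \<Longrightarrow> (\<Sum>g\<in>perms. law t g) = 1"
  unfolding law_def by (rule sum_pmf_eq_1[OF finite_perms set_interchange_pmf])

text \<open>Convolution of the law with \<open>f\<close> on the group, that is, the semigroup
  \<open>exp (- t \<Delta>)\<close> applied to \<open>f\<close>.\<close>

definition flow :: "((nat \<Rightarrow> nat) \<Rightarrow> real) \<Rightarrow> real \<Rightarrow> (nat \<Rightarrow> nat) \<Rightarrow> real" where
  "flow f t x = (\<Sum>g\<in>perms. law t g * f (Hilbert_Choice.inv g \<circ> x))"

lemma flow_0: "x \<in> perms \<Longrightarrow> flow f 0 x = f x"
proof -
  assume x: "x \<in> perms"
  have "flow f 0 x = (\<Sum>g\<in>perms. if g = id then f x else 0)"
    unfolding flow_def law_def interchange_initial by (intro sum.cong refl) (auto simp: inv_id)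
  also have "\<dots> = f x" using finite_perms by (simp add: permutes_id)
  finally show ?thesis .
qed

lemma sum_flow: "0 \<le> t \<Longrightarrow> (\<Sum>x\<in>perms. flow f t x) = (\<Sum>x\<in>perms. f x)"
proof -
  assume t: "0 \<le> t"
  have "(\<Sum>x\<in>perms. flow f t x) = (\<Sum>g\<in>perms. law t g * (\<Sum>x\<in>perms. f (Hilbert_Choice.inv g \<circ> x)))"
    unfolding flow_def sum_distrib_left by (rule sum.swap)
  also have "\<dots> = (\<Sum>g\<in>perms. law t g * (\<Sum>x\<in>perms. f x))"
    by (intro sum.cong refl) (simp add: sum_permutes_compose_left permutes_inv)
  finally show ?thesis using sum_law[OF t] by (simp add: sum_distrib_right[symmetric])
qed

text \<open>Reindexing by \<open>tau i j \<circ> g\<close> moves a jump of the process from the law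
  to the argument \<open>x\<close>. The factor \<open>1 / 2\<close> compensates for the ordered
  pairs in \<open>generator\<close>.\<close>

lemma flow_derivative:
  assumes t: "0 \<le> t" and x: "x \<in> perms"
  shows "((\<lambda>s. flow f s x) has_real_derivative - generator (weight n a) vertices (flow f t) x / 2)
    (at t within {0..})"
proof -
  let ?tau = "\<lambda>i j. Transposition.transpose i j"
  have "((\<lambda>s. flow f s x) has_real_derivative (\<Sum>g\<in>perms.
      (\<Sum>(i, j)\<in>vertex_pairs n. a i j * (law t (?tau i j \<circ> g) - law t g)) * f (Hilbert_Choice.inv g \<circ> x))) (at t within {0..})"
    unfolding flow_def law_def
    by (intro DERIV_sum DERIV_cmult_right interchange_forward_equation[OF rates t])
  also have "(\<Sum>g\<in>perms. (\<Sum>(i, j)\<in>vertex_pairs n. a i j * (law t (?tau i j \<circ> g) - law t g)) * f (Hilbert_Choice.inv g \<circ> x)) =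
      (\<Sum>e\<in>vertex_pairs n. \<Sum>g\<in>perms. a (fst e) (snd e) * (law t (?tau (fst e) (snd e) \<circ> g) - law t g) * f (Hilbert_Choice.inv g \<circ> x))"
    unfolding sum_distrib_right case_prod_beta by (rule sum.swap)
  also have "\<dots> = (\<Sum>e\<in>vertex_pairs n. a (fst e) (snd e) * (flow f t (?tau (fst e) (snd e) \<circ> x) - flow f t x))"
  proof (rule sum.cong[OF refl])
    fix e assume "e \<in> vertex_pairs n"
    then have p: "?tau (fst e) (snd e) permutes vertices"
      using transpose_permutes_pair[of "fst e" "snd e"] by simp
    let ?t = "?tau (fst e) (snd e)"
    have "(\<Sum>g\<in>perms. law t (?t \<circ> g) * f (Hilbert_Choice.inv g \<circ> x)) = (\<Sum>g\<in>perms. law t (?t \<circ> g) * f (Hilbert_Choice.inv (?t \<circ> g) \<circ> (?t \<circ> x)))"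
    proof (rule sum.cong[OF refl])
      fix g assume "g \<in> perms"
      then have "Hilbert_Choice.inv (?t \<circ> g) = Hilbert_Choice.inv g \<circ> ?t"
        using p by (simp add: o_inv_distrib permutes_bij inv_swap_id)
      then have "Hilbert_Choice.inv (?t \<circ> g) \<circ> (?t \<circ> x) = Hilbert_Choice.inv g \<circ> x"
        by (simp add: fun_eq_iff)
      then show "law t (?t \<circ> g) * f (Hilbert_Choice.inv g \<circ> x) =
          law t (?t \<circ> g) * f (Hilbert_Choice.inv (?t \<circ> g) \<circ> (?t \<circ> x))"
        by (simp only:)
    qed
    also have "\<dots> = flow f t (?t \<circ> x)"
      unfolding flow_def by (rule sum_permutes_compose_left[OF p, of "\<lambda>g. law t g * f (Hilbert_Choice.inv g \<circ> (?t \<circ> x))"])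
    finally show "(\<Sum>g\<in>perms. a (fst e) (snd e) * (law t (?t \<circ> g) - law t g) * f (Hilbert_Choice.inv g \<circ> x)) =
        a (fst e) (snd e) * (flow f t (?t \<circ> x) - flow f t x)"
      by (simp add: flow_def[of f t x] sum_distrib_left[symmetric] mult.assoc left_diff_distrib sum_subtractf)
  qed
  also have "\<dots> = - generator (weight n a) vertices (flow f t) x / 2"
    unfolding generator_def
    by (subst sum_weight) (auto simp: transpose_commute case_prod_beta sum_negf[symmetric] algebra_simps intro!: sum.cong)
  finally show ?thesis .
qed

text \<open>Gronwall: the squared norm \<open>\<phi>\<close> has derivative
  \<open>- interchange_form\<close>, which is at most \<open>- \<kappa> * \<phi>\<close>, so
  \<open>exp (\<kappa> * s) * \<phi> s\<close> does not increase. Mean zero persists along the flow,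
  which lets the gap act at every time.\<close>

lemma flow_decay:
  assumes \<kappa>: "0 \<le> \<kappa>" and t: "0 \<le> t" and f: "(\<Sum>x\<in>perms. f x) = 0"
    and gap: "\<And>u. (\<Sum>y\<in>vertices. u y) = 0 \<Longrightarrow> \<kappa> * (\<Sum>y\<in>vertices. (u y)\<^sup>2) \<le> graph_form (weight n a) vertices u"
  shows "(\<Sum>x\<in>perms. (flow f t x)\<^sup>2) \<le> exp (- \<kappa> * t) * (\<Sum>x\<in>perms. (f x)\<^sup>2)"
proof -
  let ?c = "weight n a"
  define \<phi> where "\<phi> = (\<lambda>s. \<Sum>x\<in>perms. (flow f s x)\<^sup>2)"
  define D where "D = (\<lambda>s. - interchange_form ?c vertices (flow f s))"
  have nonneg: "0 \<le> ?c x y" for x y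
    using rates[of x y] rates[of y x] by (auto simp: weight_def edge_weight_def vertex_pairs_def)
  have deriv: "(\<phi> has_real_derivative D s) (at s within {0..})" if s: "0 \<le> s" for s
  proof -
    have "(\<phi> has_real_derivative (\<Sum>x\<in>perms. 2 * (flow f s x * (- generator ?c vertices (flow f s) x / 2)))) (at s within {0..})"
      unfolding \<phi>_def
    proof (rule DERIV_sum)
      fix x assume "x \<in> perms"
      from DERIV_power[OF flow_derivative[OF s this, of f], of 2]
      show "((\<lambda>s. (flow f s x)\<^sup>2) has_real_derivative 2 * (flow f s x * (- generator ?c vertices (flow f s) x / 2))) (at s within {0..})"
        by (simp add: mult_ac)
    qed
    also have "(\<Sum>x\<in>perms. 2 * (flow f s x * (- generator ?c vertices (flow f s) x / 2))) = D s"
      by (simp add: D_def interchange_form_generator sum_negf)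
    finally show ?thesis .
  qed
  have D: "D s \<le> - \<kappa> * \<phi> s" if s: "0 \<le> s" for s
  proof -
    have "\<kappa> * corr vertices (flow f s) id \<le> interchange_form ?c vertices (flow f s)"
      by (rule interchange_gap) (use \<kappa> weight_sym nonneg gap sum_flow[OF s] f in auto)
    then show ?thesis by (simp add: D_def \<phi>_def corr_def power2_eq_square)
  qed
  let ?\<psi> = "\<lambda>s. exp (\<kappa> * s) * \<phi> s"
  have d\<psi>: "(?\<psi> has_real_derivative (\<kappa> * exp (\<kappa> * s) * \<phi> s + D s * exp (\<kappa> * s))) (at s within {0..})"
    if "0 \<le> s" for s
    by (rule DERIV_cong, rule DERIV_mult[OF _ deriv[OF that]]) (auto intro!: derivative_eq_intros)
  have "?\<psi> t \<le> ?\<psi> 0"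
  proof (cases "t = 0")
    case False
    \<comment> \<open>At 0 the derivative is only one-sided, so monotonicity is drawn from the open
      interval together with continuity up to the ends.\<close>
    show ?thesis
    proof (rule DERIV_nonpos_imp_decreasing_open[of 0 t])
      show "0 \<le> t" by (rule t)
      fix s assume s: "0 < s" "s < t"
      have "(?\<psi> has_real_derivative (\<kappa> * exp (\<kappa> * s) * \<phi> s + D s * exp (\<kappa> * s))) (at s)"
        using d\<psi>[of s] s at_within_interior[of s "{0..}"] by simp
      moreover have "\<kappa> * exp (\<kappa> * s) * \<phi> s + D s * exp (\<kappa> * s) = exp (\<kappa> * s) * (\<kappa> * \<phi> s + D s)"
        by (simp add: algebra_simps)
      then have "\<kappa> * exp (\<kappa> * s) * \<phi> s + D s * exp (\<kappa> * s) \<le> 0"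
        using D[of s] s by (simp add: mult_nonneg_nonpos)
      ultimately show "\<exists>y. (?\<psi> has_real_derivative y) (at s) \<and> y \<le> 0" by blast
    next
      show "continuous_on {0..t} ?\<psi>"
        unfolding continuous_on_eq_continuous_within
      proof
        fix s assume "s \<in> {0..t}"
        then have "continuous (at s within {0..}) ?\<psi>" using d\<psi>[of s] by (auto intro: DERIV_continuous)
        then show "continuous (at s within {0..t}) ?\<psi>" by (rule continuous_within_subset) auto
      qed
    qed
  qed simp
  moreover have "\<phi> 0 = (\<Sum>x\<in>perms. (f x)\<^sup>2)"
    unfolding \<phi>_def by (intro sum.cong refl) (simp add: flow_0)
  ultimately have "exp (\<kappa> * t) * \<phi> t \<le> (\<Sum>x\<in>perms. (f x)\<^sup>2)" by simp
  then have "exp (- \<kappa> * t) * (exp (\<kappa> * t) * \<phi> t) \<le> exp (- \<kappa> * t) * (\<Sum>x\<in>perms. (f x)\<^sup>2)"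
    by (intro mult_left_mono) auto
  then show ?thesis by (simp add: \<phi>_def exp_add[symmetric] mult.assoc[symmetric])
qed

text \<open>The squared norm of the flow decays at rate \<open>2 * l\<close>, so the norm decays at
  rate \<open>l\<close>, and Cauchy-Schwarz against \<open>f\<close> supplies the other factor of
  the norm.\<close>

lemma correlation_decay_mean_zero:
  assumes l: "0 \<le> l" and t: "0 \<le> t" and f: "(\<Sum>x\<in>perms. f x) = 0"
    and gap: "\<And>u. (\<Sum>y\<in>vertices. u y) = 0 \<Longrightarrow> 2 * l * (\<Sum>y\<in>vertices. (u y)\<^sup>2) \<le> graph_form (weight n a) vertices u"
  shows "\<bar>\<Sum>g\<in>perms. law t g * (\<Sum>x\<in>perms. f x * f (Hilbert_Choice.inv g \<circ> x))\<bar> \<le> exp (- t * l) * (\<Sum>x\<in>perms. (f x)\<^sup>2)"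
proof -
  let ?N = "\<Sum>x\<in>perms. (f x)\<^sup>2"
  have "(\<Sum>g\<in>perms. law t g * (\<Sum>x\<in>perms. f x * f (Hilbert_Choice.inv g \<circ> x))) = (\<Sum>x\<in>perms. f x * flow f t x)"
    unfolding flow_def sum_distrib_left by (subst sum.swap) (simp add: mult_ac)
  moreover have "(\<Sum>x\<in>perms. f x * flow f t x)\<^sup>2 \<le> (exp (- t * l) * ?N)\<^sup>2"
  proof -
    have "(\<Sum>x\<in>perms. f x * flow f t x)\<^sup>2 \<le> ?N * (\<Sum>x\<in>perms. (flow f t x)\<^sup>2)"
      by (rule Cauchy_Schwarz_ineq_sum)
    also have "\<dots> \<le> ?N * (exp (- (2 * l) * t) * ?N)"
      by (intro mult_left_mono flow_decay) (use l t f gap in \<open>auto simp: sum_nonneg\<close>)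
    also have "exp (- (2 * l) * t) = exp (- t * l) * exp (- t * l)"
      by (simp add: exp_add[symmetric])
    finally show ?thesis by (simp add: power2_eq_square mult_ac)
  qed
  then have "\<bar>\<Sum>x\<in>perms. f x * flow f t x\<bar> \<le> \<bar>exp (- t * l) * ?N\<bar>"
    by (simp only: abs_le_square_iff)
  moreover have "0 \<le> exp (- t * l) * ?N" by (simp add: sum_nonneg)
  ultimately show ?thesis by linarith
qed

text \<open>Subtracting the mean \<open>m\<close> lowers every correlation by
  \<open>fact n * m\<^sup>2\<close> and cannot increase the norm.\<close>

lemma correlation_decay:
  assumes l: "0 \<le> l" and t: "0 \<le> t"
    and gap: "\<And>u. (\<Sum>y\<in>vertices. u y) = 0 \<Longrightarrow> 2 * l * (\<Sum>y\<in>vertices. (u y)\<^sup>2) \<le> graph_form (weight n a) vertices u"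
  shows "\<bar>(\<Sum>g\<in>perms. law t g * (\<Sum>x\<in>perms. f x * f (Hilbert_Choice.inv g \<circ> x))) - (\<Sum>x\<in>perms. f x)\<^sup>2 / fact n\<bar>
    \<le> exp (- t * l) * (\<Sum>x\<in>perms. (f x)\<^sup>2)"
proof -
  define m where "m = (\<Sum>x\<in>perms. f x) / fact n"
  define f0 where "f0 = (\<lambda>x. f x - m)"
  have card: "real (card perms) = fact n" by (simp add: card_permutations)
  have sum: "(\<Sum>x\<in>perms. f x) = fact n * m" by (simp add: m_def)
  have f0: "(\<Sum>x\<in>perms. f0 x) = 0"
    unfolding f0_def sum_subtractf sum_constant card sum by simp
  have cor: "(\<Sum>x\<in>perms. f0 x * f0 (Hilbert_Choice.inv g \<circ> x)) = (\<Sum>x\<in>perms. f x * f (Hilbert_Choice.inv g \<circ> x)) - fact n * m\<^sup>2"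
    if "g \<in> perms" for g
  proof -
    have s: "(\<Sum>x\<in>perms. f (Hilbert_Choice.inv g \<circ> x)) = fact n * m"
      using that sum by (simp add: sum_permutes_compose_left permutes_inv)
    have "(\<Sum>x\<in>perms. f0 x * f0 (Hilbert_Choice.inv g \<circ> x)) =
        (\<Sum>x\<in>perms. f x * f (Hilbert_Choice.inv g \<circ> x) - m * f x - m * f (Hilbert_Choice.inv g \<circ> x) + m\<^sup>2)"
      by (intro sum.cong refl) (simp add: f0_def power2_eq_square algebra_simps)
    also have "\<dots> = (\<Sum>x\<in>perms. f x * f (Hilbert_Choice.inv g \<circ> x)) - m * (fact n * m) - m * (fact n * m) + fact n * m\<^sup>2"
      unfolding sum.distrib sum_subtractf sum_distrib_left[symmetric] s sum sum_constant card by simp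
    finally show ?thesis by (simp add: power2_eq_square)
  qed
  have "(\<Sum>g\<in>perms. law t g * (\<Sum>x\<in>perms. f0 x * f0 (Hilbert_Choice.inv g \<circ> x))) =
      (\<Sum>g\<in>perms. law t g * (\<Sum>x\<in>perms. f x * f (Hilbert_Choice.inv g \<circ> x)) - fact n * m\<^sup>2 * law t g)"
    by (intro sum.cong refl, subst cor, assumption) (simp add: right_diff_distrib)
  also have "\<dots> = (\<Sum>g\<in>perms. law t g * (\<Sum>x\<in>perms. f x * f (Hilbert_Choice.inv g \<circ> x))) - fact n * m\<^sup>2"
    using sum_law[OF t] by (simp add: sum_subtractf sum_distrib_left[symmetric])
  also have "fact n * m\<^sup>2 = (\<Sum>x\<in>perms. f x)\<^sup>2 / fact n"
    unfolding sum by (simp add: power2_eq_square)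
  finally have eq: "(\<Sum>g\<in>perms. law t g * (\<Sum>x\<in>perms. f0 x * f0 (Hilbert_Choice.inv g \<circ> x))) =
      (\<Sum>g\<in>perms. law t g * (\<Sum>x\<in>perms. f x * f (Hilbert_Choice.inv g \<circ> x))) - (\<Sum>x\<in>perms. f x)\<^sup>2 / fact n" .
  have "\<bar>(\<Sum>g\<in>perms. law t g * (\<Sum>x\<in>perms. f x * f (Hilbert_Choice.inv g \<circ> x))) - (\<Sum>x\<in>perms. f x)\<^sup>2 / fact n\<bar> \<le>
      exp (- t * l) * (\<Sum>x\<in>perms. (f0 x)\<^sup>2)"
    using correlation_decay_mean_zero[OF l t f0 gap] unfolding eq .
  also have "(\<Sum>x\<in>perms. (f0 x)\<^sup>2) \<le> (\<Sum>x\<in>perms. (f x)\<^sup>2)"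
    using cor[of id] by (simp add: permutes_id power2_eq_square)
  finally show ?thesis by (simp add: mult_left_mono)
qed

end

section \<open>Orbits as cycles\<close>

lemma orbit_transitive:
  assumes "finite E" "inj g" "transitive_on g E" "x \<in> E"
  shows "orbit g x = E"
proof -
  have gE: "g ` E = E" using assms(3) by (simp add: transitive_on_def)
  have sub: "orbit g x \<subseteq> E"
  proof
    fix y assume "y \<in> orbit g x"
    then show "y \<in> E" by induction (use gE assms(4) in auto)
  qed
  have "g ` orbit g x \<subseteq> orbit g x" by (auto intro: orbit.step)
  then have "g ` orbit g x = orbit g x"
    using sub assms(1,2) by (intro endo_inj_surj) (auto intro: finite_subset inj_on_subset)
  moreover have "orbit g x \<noteq> {}" by (auto intro: orbit.base)
  ultimately show ?thesis using transitive_onD[OF assms(3) sub] by blast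
qed

lemma num_cycles_eq_transitive:
  assumes g: "g permutes {1..n}"
  shows "num_cycles n k g = card {A. A \<subseteq> {1..n} \<and> card A = k \<and> transitive_on g A}"
proof -
  have inj: "inj g" and gV: "g ` {1..n} = {1..n}"
    using g by (auto simp: permutes_inj permutes_image)
  have "{C \<in> orbit g ` {1..n}. card C = k} = {A. A \<subseteq> {1..n} \<and> card A = k \<and> transitive_on g A}"
  proof (intro equalityI subsetI)
    fix C assume "C \<in> {C \<in> orbit g ` {1..n}. card C = k}"
    then obtain x where x: "x \<in> {1..n}" "C = orbit g x" "card C = k" by auto
    obtain E where E: "transitive_on g E" "x \<in> E" "E \<subseteq> {1..n}"
      using ex_transitive_subset[OF _ inj gV x(1)] by auto
    then have "orbit g x = E" using inj by (intro orbit_transitive) (auto intro: finite_subset)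
    then show "C \<in> {A. A \<subseteq> {1..n} \<and> card A = k \<and> transitive_on g A}" using x E by simp
  next
    fix A assume A: "A \<in> {A. A \<subseteq> {1..n} \<and> card A = k \<and> transitive_on g A}"
    then obtain x where x: "x \<in> A" by (auto simp: transitive_on_def)
    have "orbit g x = A" using A inj x by (intro orbit_transitive) (auto intro: finite_subset)
    then show "A \<in> {C \<in> orbit g ` {1..n}. card C = k}" using A x by blast
  qed
  then show ?thesis by (simp add: num_cycles_def)
qed

section \<open>The expected number of cycles\<close>

context interchange_process
begin

text \<open>\<open>N * K\<close> is the autocorrelation of \<open>f\<close>, so the squared norm of
  \<open>f\<close> is its value \<open>N * card (A - B)\<close> at the identity, and
  \<open>N\<close> cancels from the estimate.\<close>

lemma cycle_kernel_decay:
  assumes l: "0 \<le> l" and t: "0 \<le> t"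
    and gap: "\<And>u. (\<Sum>y\<in>vertices. u y) = 0 \<Longrightarrow> 2 * l * (\<Sum>y\<in>vertices. (u y)\<^sup>2) \<le> graph_form (weight n a) vertices u"
    and A: "A \<subseteq> vertices" and B: "B \<subseteq> A" "b0 \<in> A" "b0 \<notin> B"
  defines "K \<equiv> cycle_kernel vertices A B b0"
  shows "\<bar>(\<Sum>g\<in>perms. law t g * K g) - (\<Sum>g\<in>perms. K g) / fact n\<bar> \<le> exp (- t * l) * card (A - B)"
proof -
  note V = finite_atLeastAtMost[of 1 n]
  define f where "f = root_function vertices A B b0"
  define N where "N = (\<Sum>y\<in>perms. (chi vertices A (insert b0 B) y)\<^sup>2)"
  have N: "0 < N" unfolding N_def using V A by (rule chi_norm_pos)
  have cor: "(\<Sum>x\<in>perms. f x * f (Hilbert_Choice.inv g \<circ> x)) = N * K g" if "g \<in> perms" for g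
    unfolding f_def N_def K_def using that by (intro root_function_correlation V A B) auto
  have "(\<Sum>x\<in>perms. (f x)\<^sup>2) = N * K id"
    using cor[of id] by (simp add: permutes_id power2_eq_square)
  then have norm: "(\<Sum>x\<in>perms. (f x)\<^sup>2) = N * card (A - B)"
    using cycle_kernel_id[OF V A B] by (simp add: K_def)
  have "(\<Sum>x\<in>perms. f x)\<^sup>2 = (\<Sum>g\<in>perms. N * K g)"
    unfolding sum_correlation[symmetric] by (intro sum.cong refl cor)
  then have sq: "(\<Sum>x\<in>perms. f x)\<^sup>2 = N * (\<Sum>g\<in>perms. K g)"
    by (simp only: sum_distrib_left)
  have "(\<Sum>g\<in>perms. law t g * (\<Sum>x\<in>perms. f x * f (Hilbert_Choice.inv g \<circ> x))) = N * (\<Sum>g\<in>perms. law t g * K g)"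
    unfolding sum_distrib_left by (intro sum.cong refl, subst sum_distrib_left[symmetric], subst cor, assumption) simp
  then have "\<bar>N * (\<Sum>g\<in>perms. law t g * K g) - N * (\<Sum>g\<in>perms. K g) / fact n\<bar> \<le> exp (- t * l) * (N * card (A - B))"
    using correlation_decay[OF l t gap, of f] unfolding norm sq by simp
  also have "N * (\<Sum>g\<in>perms. law t g * K g) - N * (\<Sum>g\<in>perms. K g) / fact n =
      N * ((\<Sum>g\<in>perms. law t g * K g) - (\<Sum>g\<in>perms. K g) / fact n)"
    by (simp add: right_diff_distrib)
  finally have "N * \<bar>(\<Sum>g\<in>perms. law t g * K g) - (\<Sum>g\<in>perms. K g) / fact n\<bar> \<le>
      N * (exp (- t * l) * card (A - B))"
    using N by (simp add: abs_mult mult_ac)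
  then show ?thesis using N by (simp only: mult_le_cancel_left_pos)
qed

lemma expected_cycles_eq:
  "0 \<le> t \<Longrightarrow> expected_cycles n a k t = (\<Sum>g\<in>perms. law t g * num_cycles n k g)"
  unfolding expected_cycles_def law_def
  using set_interchange_pmf[of t] finite_perms
  by (subst integral_measure_pmf_real[of perms]) (auto simp: mult.commute)

text \<open>Both the limit of the signed sum and the bound for each term carry a factor
  \<open>k\<close>; dividing by \<open>(real k)\<^sup>2\<close> leaves \<open>1 / k\<close> in
  each.\<close>

lemma expected_cycles_bound:
  assumes l: "0 \<le> l" and t: "0 \<le> t" and k: "1 \<le> k" "k \<le> n"
    and gap: "\<And>u. (\<Sum>y\<in>vertices. u y) = 0 \<Longrightarrow> 2 * l * (\<Sum>y\<in>vertices. (u y)\<^sup>2) \<le> graph_form (weight n a) vertices u"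
  shows "\<bar>expected_cycles n a k t - 1 / real k\<bar> \<le> 3 ^ n / real k * exp (- t * l)"
proof -
  note V = finite_atLeastAtMost[of 1 n]
  define b0 where "b0 = (\<lambda>A B :: nat set. SOME b. b \<in> A - B)"
  define K where "K = (\<lambda>A B. cycle_kernel vertices A B (b0 A B))"
  define s where "s = (\<lambda>B :: nat set. (- 1 :: real) ^ card B)"
  let ?P = "{A. A \<subseteq> vertices \<and> card A = k}"
  let ?Q = "\<lambda>A. Pow A - {A}"
  have finP: "finite ?P" by simp
  have A: "A \<subseteq> vertices" "card A = k" "finite A" "A \<noteq> {}" if "A \<in> ?P" for A
  proof -
    show "A \<subseteq> vertices" "card A = k" using that by auto
    then show "finite A" "A \<noteq> {}" using finite_subset V k by auto
  qed
  have b0: "b0 A B \<in> A - B" if "B \<subset> A" for A B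
    unfolding b0_def using that by (intro someI_ex[of "\<lambda>b. b \<in> A - B"]) auto
  have id: "(\<Sum>A\<in>?P. \<Sum>B\<in>?Q A. s B * K A B g) = (real k)\<^sup>2 * num_cycles n k g" if g: "g \<in> perms" for g
  proof -
    have "(\<Sum>A\<in>?P. \<Sum>B\<in>?Q A. s B * K A B g) = (\<Sum>A\<in>?P. if transitive_on g A then (real k)\<^sup>2 else 0)"
    proof (rule sum.cong[OF refl])
      fix A assume "A \<in> ?P"
      note A = A[OF this]
      have "(\<Sum>B\<in>?Q A. s B * K A B g) = (if transitive_on g A then (real (card A))\<^sup>2 else 0)"
        unfolding s_def K_def using V A(1) g b0 by (intro alternating_sum_cycle_kernel) auto
      then show "(\<Sum>B\<in>?Q A. s B * K A B g) = (if transitive_on g A then (real k)\<^sup>2 else 0)"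
        by (simp only: A(2))
    qed
    also have "\<dots> = (\<Sum>A\<in>?P \<inter> {A. transitive_on g A}. (real k)\<^sup>2)"
      unfolding sum.inter_restrict[OF finP] by simp
    also have "\<dots> = (real k)\<^sup>2 * card (?P \<inter> {A. transitive_on g A})" by simp
    also have "?P \<inter> {A. transitive_on g A} = {A. A \<subseteq> vertices \<and> card A = k \<and> transitive_on g A}" by auto
    finally show ?thesis using g num_cycles_eq_transitive[of g n k] by simp
  qed
  have "(real k)\<^sup>2 * expected_cycles n a k t = (\<Sum>g\<in>perms. law t g * (\<Sum>A\<in>?P. \<Sum>B\<in>?Q A. s B * K A B g))"
    unfolding expected_cycles_eq[OF t] sum_distrib_left
  proof (rule sum.cong[OF refl])
    fix g assume g: "g \<in> perms"
    show "(real k)\<^sup>2 * (law t g * real (num_cycles n k g)) = (\<Sum>A\<in>?P. \<Sum>B\<in>?Q A. law t g * (s B * K A B g))"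
      unfolding sum_distrib_left[symmetric] id[OF g] by simp
  qed
  also have "\<dots> = (\<Sum>A\<in>?P. \<Sum>B\<in>?Q A. s B * (\<Sum>g\<in>perms. law t g * K A B g))"
    unfolding sum_distrib_left
    by (subst sum.swap, rule sum.cong[OF refl], subst sum.swap) (simp add: mult_ac)
  finally have E: "(real k)\<^sup>2 * expected_cycles n a k t = \<dots>" .
  \<comment> \<open>Kernels with \<open>B \<noteq> {}\<close> have mean zero. Those with
    \<open>B = {}\<close> give \<open>k\<close> times the probability that a uniform permutation
    preserves \<open>A\<close>, and these probabilities sum to 1 over the
    \<open>k\<close>-sets.\<close>
  have mean: "(\<Sum>A\<in>?P. \<Sum>B\<in>?Q A. s B * ((\<Sum>g\<in>perms. K A B g) / fact n)) = real k"
  proof -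
    have "(\<Sum>A\<in>?P. \<Sum>B\<in>?Q A. s B * ((\<Sum>g\<in>perms. K A B g) / fact n)) =
        (\<Sum>A\<in>?P. real k / fact n * (\<Sum>g\<in>perms. if g ` A = A then 1 else 0))"
    proof (rule sum.cong[OF refl])
      fix A assume "A \<in> ?P"
      note A = A[OF this]
      have 0: "(\<Sum>g\<in>perms. K A B g) = 0" if "B \<in> ?Q A" "B \<noteq> {}" for B
        unfolding K_def using V A(1) that b0[of B A] by (intro sum_cycle_kernel) auto
      have "(\<Sum>B\<in>?Q A. s B * ((\<Sum>g\<in>perms. K A B g) / fact n)) =
          (\<Sum>B\<in>{{}}. s B * ((\<Sum>g\<in>perms. K A B g) / fact n))"
      proof (rule sum.mono_neutral_right)
        show "\<forall>B\<in>?Q A - {{}}. s B * ((\<Sum>g\<in>perms. K A B g) / fact n) = 0"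
          using 0 by simp
      qed (use A in auto)
      also have "\<dots> = (\<Sum>g\<in>perms. K A {} g) / fact n" by (simp add: s_def)
      also have "(\<Sum>g\<in>perms. K A {} g) = (\<Sum>g\<in>perms. real k * (if g ` A = A then 1 else 0))"
      proof (rule sum.cong[OF refl])
        fix g assume g: "g \<in> perms"
        have "b0 A {} \<in> A" using b0[of "{}" A] A by auto
        then have "K A {} g = (if g ` A = A then card A else 0)"
          unfolding K_def using g by (intro cycle_kernel_empty[OF V A(1)]) auto
        then show "K A {} g = real k * (if g ` A = A then 1 else 0)" using A by simp
      qed
      finally show "(\<Sum>B\<in>?Q A. s B * ((\<Sum>g\<in>perms. K A B g) / fact n)) =
          real k / fact n * (\<Sum>g\<in>perms. if g ` A = A then 1 else 0)"
        by (simp only: sum_distrib_left[symmetric] times_divide_eq_left)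
    qed
    also have "\<dots> = real k / fact n * fact n"
      using sum_card_invariant[OF V, of k] k unfolding sum_distrib_left[symmetric] by simp
    finally show ?thesis by simp
  qed
  have diff: "(real k)\<^sup>2 * expected_cycles n a k t - real k =
      (\<Sum>A\<in>?P. \<Sum>B\<in>?Q A. s B * ((\<Sum>g\<in>perms. law t g * K A B g) - (\<Sum>g\<in>perms. K A B g) / fact n))"
    unfolding E right_diff_distrib sum_subtractf mean ..
  have "\<bar>(real k)\<^sup>2 * expected_cycles n a k t - real k\<bar> \<le> (\<Sum>A\<in>?P. \<Sum>B\<in>Pow A. exp (- t * l) * real k)"
    unfolding diff
  proof (rule order_trans[OF sum_abs], rule sum_mono)
    fix A assume "A \<in> ?P"
    note A = A[OF this]
    have "\<bar>\<Sum>B\<in>?Q A. s B * ((\<Sum>g\<in>perms. law t g * K A B g) - (\<Sum>g\<in>perms. K A B g) / fact n)\<bar> \<le>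
        (\<Sum>B\<in>?Q A. exp (- t * l) * real k)"
    proof (rule order_trans[OF sum_abs], rule sum_mono)
      fix B assume B: "B \<in> ?Q A"
      have "\<bar>(\<Sum>g\<in>perms. law t g * K A B g) - (\<Sum>g\<in>perms. K A B g) / fact n\<bar> \<le> exp (- t * l) * card (A - B)"
        unfolding K_def using B b0[of B A] by (intro cycle_kernel_decay[OF l t gap A(1)]) auto
      also have "\<dots> \<le> exp (- t * l) * real k"
        using A card_mono[of A "A - B"] by (intro mult_left_mono) auto
      finally show "\<bar>s B * ((\<Sum>g\<in>perms. law t g * K A B g) - (\<Sum>g\<in>perms. K A B g) / fact n)\<bar> \<le> exp (- t * l) * real k"
        by (simp add: abs_mult s_def)
    qed
    also have "\<dots> \<le> (\<Sum>B\<in>Pow A. exp (- t * l) * real k)"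
      using A by (intro sum_mono2) auto
    finally show "\<bar>\<Sum>B\<in>?Q A. s B * ((\<Sum>g\<in>perms. law t g * K A B g) - (\<Sum>g\<in>perms. K A B g) / fact n)\<bar> \<le>
        (\<Sum>B\<in>Pow A. exp (- t * l) * real k)" .
  qed
  also have "\<dots> = (\<Sum>A\<in>?P. 2 ^ k * (exp (- t * l) * real k))"
  proof (rule sum.cong[OF refl])
    fix A assume "A \<in> ?P"
    note A = A[OF this]
    have "card (Pow A) = 2 ^ k" using card_Pow[OF A(3)] by (simp only: A(2))
    then show "(\<Sum>B\<in>Pow A. exp (- t * l) * real k) = 2 ^ k * (exp (- t * l) * real k)" by simp
  qed
  also have "\<dots> = real (n choose k) * 2 ^ k * (exp (- t * l) * real k)"
    unfolding sum_constant n_subsets[OF V] by simp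
  also have "\<dots> \<le> 3 ^ n * (exp (- t * l) * real k)"
  proof (rule mult_right_mono)
    have "real (n choose k) * 2 ^ k * 1 ^ (n - k) \<le> (\<Sum>k\<le>n. real (n choose k) * 2 ^ k * 1 ^ (n - k))"
      using k by (intro member_le_sum) auto
    also have "\<dots> = (2 + 1) ^ n" by (rule binomial_ring[symmetric])
    finally show "real (n choose k) * 2 ^ k \<le> 3 ^ n" by simp
  qed simp
  finally have *: "\<bar>(real k)\<^sup>2 * expected_cycles n a k t - real k\<bar> \<le> 3 ^ n * (exp (- t * l) * real k)" .
  have "(real k)\<^sup>2 * expected_cycles n a k t - real k = (real k)\<^sup>2 * (expected_cycles n a k t - 1 / real k)"
    using k by (simp add: power2_eq_square right_diff_distrib)
  then have "(real k)\<^sup>2 * \<bar>expected_cycles n a k t - 1 / real k\<bar> \<le> (real k)\<^sup>2 * (3 ^ n / real k * exp (- t * l))"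
    using * k by (simp add: abs_mult power2_eq_square mult_ac)
  moreover have "0 < (real k)\<^sup>2" using k by simp
  ultimately show ?thesis by (simp only: mult_le_cancel_left_pos)
qed

end

theorem theorem2:
  fixes n :: nat and a :: "nat \<Rightarrow> nat \<Rightarrow> real" and lam :: "nat \<Rightarrow> real"
    and k :: nat and t :: real
  assumes "2 \<le> n"
    and "\<And>i j. 1 \<le> i \<Longrightarrow> i < j \<Longrightarrow> j \<le> n \<Longrightarrow> 0 \<le> a i j"
    and "char_poly (laplacian n a) = (\<Prod>i<n. [:- lam i, 1:])"
    and "lam 0 = 0"
    and "\<And>i. Suc i < n \<Longrightarrow> lam i \<le> lam (Suc i)"
    and "1 \<le> k" and "k \<le> n"
    and "0 \<le> t"
  shows "\<bar>expected_cycles n a k t - 1 / real k\<bar> \<le> 3 ^ n / real k * exp (- t * lam 1)"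
proof -
  interpret interchange_process n a
    by unfold_locales (use assms(2) in \<open>auto simp: vertex_pairs_def\<close>)
  have "0 \<le> lam 1" using assms(5)[of 0] assms(1,4) by simp
  then show ?thesis
    using assms(8,6,7) laplacian_gap[OF assms(1,3-5)] by (rule expected_cycles_bound)
qed

end
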